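(* Let the conditions (K1)--(K4) of the context be satisfied, let $p$ and $q$ be the classical order and the stage order of an algebraically stable and coercive $m$-stage Runge--Kutta method with $2q\ge p$, and let the additional conditions (A1) and (A2) of the context (which depend on $p-q$) be satisfied. Suppose that the solution $u$ of $\dot u+A(u)u=0$ on $[0,T]$ has the regularity $u\in C^{p+1}([0,T],Y)$ with $S^ku\in C^{p+1-k}([0,T],Y)$ for $k=1,\dots,p-q$. Let $u_n$ be the numerical solution with stepsize $\tau$ and $u_0=u(0)$: $$U_{ni}=u_n+\tau\sum_{j=1}^m a_{ij}\dot U_{nj},\quad \dot U_{ni}+A(U_{ni})U_{ni}=0\quad(i=1,\dots,m),\qquad u_{n+1}=u_n+\tau\sum_{i=1}^m b_i\dot U_{ni}.$$ Then there exists $\bar\tau>0$ such that for stepsizes $0<\tau\le\bar\tau$, the errors are bounded, with $t_n=n\tau$, by $$\|u_n-u(t_n)\|\le C\tau^{p},$$ where $C$ is independent of $n$ and $\tau$ with $0\le n\tau\le T$.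
   Context: Let $X$ and $Y$ be real Hilbert spaces such that $Y$ is densely and continuously embedded in $X$. The inner product on $X$ is $(\cdot,\cdot)$, the norms are $|\cdot|=\|\cdot\|_X$ and $\|\cdot\|=\|\cdot\|_Y$, chosen such that $|y|\le\|y\|$ for all $y\in Y$. For every $y\in Y$, $A(y)$ is a closed linear operator on $X$ with domain $D(A(y))$. For every $R>0$ the following conditions hold, with real numbers $M_R^A,M_R^B,L_R^A,L_R^B$ (and $M_{k,R}$ below) depending only on $R$ (and $k$). (K1) For every $y\in Y$, $A(y)$ has the open left complex half-plane in its resolvent set (in the sense of the complexification) and satisfies $(w,A(y)w)\ge0$ for all $w\in D(A(y))$. Moreover $Y\subset D(A(y))$, and for $\|y\|\le R$, $|A(y)w|\le M_R^A\|w\|$ for all $w\in Y$. (K2) There is an isometry $S:Y\to X$, self-adjoint as a linear operator on $X$ (with domain $Y$), such that for every $y\in Y$ with $\|y\|\le R$, $SA(y)S^{-1}=A(y)+B(y)$ (with equality of domains), where $|B(y)v|\le M_R^B|v|$ for all $v\in X$. (K3) For all $y,\widetilde y\in Y$ with $\|y\|\le R$, $\|\widetilde y\|\le R$: $|(A(y)-A(\widetilde y))w|\le L_R^A|y-\widetilde y|\,\|w\|$ for all $w\in Y$, and $|(B(y)-B(\widetilde y))v|\le L_R^B\|y-\widetilde y\|\,|v|$ for all $v\in X$. (K4) is a local Lipschitz condition in $X$ and $Y$ on a semilinear term $f(u)$ on the right-hand side of the evolution equation; since $f=0$ here, it holds trivially. (A1) For $k=1,\dots,p-q$ and for every $y\in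 Y$ with $\|y\|\le R$, $S^kA(y)S^{-k}=A(y)+B_k(y)$, where $|B_k(y)v|\le M_{k,R}|v|$ for all $v\in X$. (A2) Let $L(Y,X)$ and $L(X,X)$ denote the Banach spaces of bounded linear operators from $Y$ to $X$ and from $X$ to $X$. The maps $y\in Y\mapsto A(y)\in L(Y,X)$ and $y\in Y\mapsto B_k(y)\in L(X,X)$ ($k=1,\dots,p-q$) are arbitrarily differentiable, and for any $R>0$ their derivatives up to any fixed order are uniformly bounded for $\|y\|\le R$. In the Runge--Kutta equations the dot in $\dot U_{ni}$ is only notation: $\dot U_{ni}=-A(U_{ni})U_{ni}$. Nodes: $c_i=\sum_{j=1}^m a_{ij}$. Stage order $q$: $\sum_{j=1}^m a_{ij}c_j^{k-1}=c_i^k/k$ for $i=1,\dots,m$ and $k=1,\dots,q$. It is always assumed that the quadrature order is at least $q+1$: $\sum_{j=1}^m b_jc_j^{k-1}=1/k$ for $k=1,\dots,q+1$. Classical order $p$: the local error (the error after one step starting from the exact solution) is of size $O(\tau^{p+1})$ whenever the method is applied to an ordinary differential equation $\dot y=g(y)$ in $\mathbb R^N$ with an arbitrarily differentiable function $g$. Coercivity: the matrix $\mathcal O=(a_{ij})\in\mathbb R^{m\times m}$ is invertible and there exist a positive diagonal matrix $\mathcal D=\mathrm{diag}(d_i)$ and $\alpha>0$ such that $v^T\mathcal D\mathcal O^{-1}v\ge\alpha\,v^T\mathcal Dv$ for all $v\in\mathbb R^m$. Algebraic stability: the weights $b_i$ are positive, and the matrix with entries $b_ia_{ij}+b_ja_{ji}-b_ib_j$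 is positive semidefinite. Convention on the numerical solution: there is a constant $C_*$ depending only on the Runge--Kutta coefficients such that for every $\rho>0$ and $\|u_n\|\le\rho$ the equations for the stages have, for sufficiently small $\tau$ (depending on $\rho$), a unique solution $(U_{ni})\in Y^m$ with $|U_{ni}|\le C_*|u_n|$ and $\|U_{ni}\|\le C_*\|u_n\|$. Such a $C_*$ is fixed, and the numerical solution is the one with these stages. *)

theory Defs
  imports "HOL-Analysis.Analysis"
begin

section \<open>Unbounded operators on a real Hilbert space\<close>

text \<open>
  An operator with domain \<open>D\<close> is a function of which only the values on \<open>D\<close> matter. Products,
  inverses and powers of unbounded operators are formed on graphs. Equality of graphs includes
  equality of domains.
\<close>

definition op_graph :: "'x set \<Rightarrow> ('x \<Rightarrow> 'x) \<Rightarrow> ('x \<times> 'x) set"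
  where "op_graph D A = (\<lambda>x. (x, A x)) ` D"

definition closed_linear_operator :: "'x::real_normed_vector set \<Rightarrow> ('x \<Rightarrow> 'x) \<Rightarrow> bool"
  where "closed_linear_operator D A \<longleftrightarrow>
    subspace D \<and>
    (\<forall>x\<in>D. \<forall>y\<in>D. A (x + y) = A x + A y) \<and>
    (\<forall>r. \<forall>x\<in>D. A (r *\<^sub>R x) = r *\<^sub>R A x) \<and>
    closed (op_graph D A)"

definition adjoint_graph :: "('x::real_inner \<times> 'x) set \<Rightarrow> ('x \<times> 'x) set"
  where "adjoint_graph G = {(v, w). \<forall>(x, z)\<in>G. inner z v = inner x w}"

definition self_adjoint_graph :: "('x::real_inner \<times> 'x) set \<Rightarrow> bool"
  where "self_adjoint_graph G \<longleftrightarrow> closure (Domain G) = UNIV \<and> adjoint_graph G = G"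

text \<open>
  The complexification of \<open>X\<close> is \<open>X \<times> X\<close>, where \<open>(x, y)\<close> stands for \<open>x + \<i>y\<close>; the product norm is
  the norm of the complexified inner product. The operator acts by \<open>map_prod A A\<close> on \<open>D \<times> D\<close>.
\<close>

definition cscale :: "complex \<Rightarrow> 'x::real_vector \<times> 'x \<Rightarrow> 'x \<times> 'x"
  where "cscale l z =
    (Re l *\<^sub>R fst z - Im l *\<^sub>R snd z, Re l *\<^sub>R snd z + Im l *\<^sub>R fst z)"

definition complex_resolvent_set :: "'x::real_normed_vector set \<Rightarrow> ('x \<Rightarrow> 'x) \<Rightarrow> complex set"
  where "complex_resolvent_set D A =
    {l. bij_betw (\<lambda>z. cscale l z - map_prod A A z) (D \<times> D) UNIV \<and>
        (\<exists>K. \<forall>z\<in>D \<times> D. norm z \<le> K * norm (cscale l z - map_prod A A z))}"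

text \<open>
  The space \<open>Y\<close> is a type of its own with inclusion \<open>j\<close> into \<open>X\<close>. An operator \<open>S\<close> from \<open>Y\<close> to \<open>X\<close>
  is, as an operator on \<open>X\<close> with domain \<open>Y\<close>, the graph \<open>graph_in_X j S\<close>.
\<close>

definition dense_embedding :: "('y::real_normed_vector \<Rightarrow> 'x::real_normed_vector) \<Rightarrow> bool"
  where "dense_embedding j \<longleftrightarrow>
    bounded_linear j \<and> inj j \<and> closure (range j) = UNIV \<and> (\<forall>y. norm (j y) \<le> norm y)"

definition graph_in_X :: "('y \<Rightarrow> 'x) \<Rightarrow> ('y \<Rightarrow> 'x) \<Rightarrow> ('x \<times> 'x) set"
  where "graph_in_X j S = range (\<lambda>y. (j y, S y))"

text \<open>
  The graph of \<open>P M P\<inverse>\<close>, where \<open>P\<close> and \<open>M\<close> are given by their graphs: relational composition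
  \<open>O\<close> applies its left argument first.
\<close>

definition conjugate_graph :: "('x \<times> 'x) set \<Rightarrow> ('x \<times> 'x) set \<Rightarrow> ('x \<times> 'x) set"
  where "conjugate_graph P M = P\<inverse> O M O P"


section \<open>Differentiability\<close>

text \<open>\<open>f \<in> C\<^sup>k(I, E)\<close> on a real interval \<open>I\<close>, with one-sided derivatives at its endpoints.\<close>

definition Ck_on :: "nat \<Rightarrow> real set \<Rightarrow> (real \<Rightarrow> 'e::real_normed_vector) \<Rightarrow> bool"
  where "Ck_on k I f \<longleftrightarrow>
    (\<exists>F. (\<forall>t\<in>I. F 0 t = f t) \<and>
         (\<forall>i<k. \<forall>t\<in>I. (F i has_vector_derivative F (Suc i) t) (at t within I)) \<and>
         (\<forall>i\<le>k. continuous_on I (F i)))"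

text \<open>
  All Frechet derivatives of \<open>f\<close> at once: \<open>F y [h\<^sub>1, \<dots>, h\<^sub>n]\<close> is the \<open>n\<close>-th derivative at \<open>y\<close>,
  applied to the directions \<open>h\<^sub>1, \<dots>, h\<^sub>n\<close>. The last conjunct says that the map taking \<open>y\<close> to the
  bounded \<open>n\<close>-linear map \<open>F y\<close> is Frechet differentiable in the norm of bounded \<open>n\<close>-linear maps,
  with derivative given by \<open>F\<close> on lists of length \<open>n + 1\<close>.
\<close>

definition frechet_derivatives ::
  "('y::real_normed_vector \<Rightarrow> 'z::real_normed_vector) \<Rightarrow> ('y \<Rightarrow> 'y list \<Rightarrow> 'z) \<Rightarrow> bool"
  where "frechet_derivatives f F \<longleftrightarrow>
    (\<forall>y. F y [] = f y) \<and>
    (\<forall>y hs i. i < length hs \<longrightarrow> linear (\<lambda>h. F y (hs[i := h]))) \<and>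
    (\<forall>y n. \<exists>K. \<forall>hs. length hs = n \<longrightarrow> norm (F y hs) \<le> K * prod_list (map norm hs)) \<and>
    (\<forall>y n. \<forall>e>0. \<exists>d>0. \<forall>h. norm h < d \<longrightarrow>
       (\<forall>hs. length hs = n \<longrightarrow>
          norm (F (y + h) hs - F y hs - F y (h # hs)) \<le> e * norm h * prod_list (map norm hs)))"

definition smooth_bounded_on_balls ::
  "('y::real_normed_vector \<Rightarrow> 'z::real_normed_vector) \<Rightarrow> bool"
  where "smooth_bounded_on_balls f \<longleftrightarrow>
    (\<exists>F. frechet_derivatives f F \<and>
         (\<forall>R>0. \<forall>n. \<exists>K. \<forall>y hs. norm y \<le> R \<longrightarrow> length hs = n \<longrightarrow>
            norm (F y hs) \<le> K * prod_list (map norm hs)))"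


section \<open>The evolution equation\<close>

definition cond_K1 ::
  "('y::real_inner \<Rightarrow> 'x::real_inner) \<Rightarrow> ('y \<Rightarrow> 'x set) \<Rightarrow> ('y \<Rightarrow> 'x \<Rightarrow> 'x) \<Rightarrow> bool"
  where "cond_K1 j D A \<longleftrightarrow>
    (\<forall>y. {l. Re l < 0} \<subseteq> complex_resolvent_set (D y) (A y)) \<and>
    (\<forall>y. \<forall>w\<in>D y. inner w (A y w) \<ge> 0) \<and>
    (\<forall>y. range j \<subseteq> D y) \<and>
    (\<forall>R>0. \<exists>M. \<forall>y. norm y \<le> R \<longrightarrow> (\<forall>w. norm (A y (j w)) \<le> M * norm w))"

definition cond_K2 ::
  "('y::real_inner \<Rightarrow> 'x::real_inner) \<Rightarrow> ('y \<Rightarrow> 'x set) \<Rightarrow> ('y \<Rightarrow> 'x \<Rightarrow> 'x) \<Rightarrow>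
   ('y \<Rightarrow> 'x) \<Rightarrow> ('y \<Rightarrow> 'x \<Rightarrow>\<^sub>L 'x) \<Rightarrow> bool"
  where "cond_K2 j D A S B \<longleftrightarrow>
    linear S \<and> (\<forall>y. norm (S y) = norm y) \<and>
    self_adjoint_graph (graph_in_X j S) \<and>
    (\<forall>y. conjugate_graph (graph_in_X j S) (op_graph (D y) (A y)) =
         op_graph (D y) (\<lambda>v. A y v + blinfun_apply (B y) v)) \<and>
    (\<forall>R>0. \<exists>M. \<forall>y. norm y \<le> R \<longrightarrow> (\<forall>v. norm (blinfun_apply (B y) v) \<le> M * norm v))"

definition cond_K3 ::
  "('y::real_inner \<Rightarrow> 'x::real_inner) \<Rightarrow> ('y \<Rightarrow> 'x \<Rightarrow> 'x) \<Rightarrow> ('y \<Rightarrow> 'x \<Rightarrow>\<^sub>L 'x) \<Rightarrow> bool"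
  where "cond_K3 j A B \<longleftrightarrow>
    (\<forall>R>0. \<exists>L. \<forall>y y'. norm y \<le> R \<longrightarrow> norm y' \<le> R \<longrightarrow>
       (\<forall>w. norm (A y (j w) - A y' (j w)) \<le> L * norm (j y - j y') * norm w)) \<and>
    (\<forall>R>0. \<exists>L. \<forall>y y'. norm y \<le> R \<longrightarrow> norm y' \<le> R \<longrightarrow>
       (\<forall>v. norm (blinfun_apply (B y) v - blinfun_apply (B y') v) \<le> L * norm (y - y') * norm v))"

definition cond_A1 ::
  "('y::real_inner \<Rightarrow> 'x::real_inner) \<Rightarrow> ('y \<Rightarrow> 'x set) \<Rightarrow> ('y \<Rightarrow> 'x \<Rightarrow> 'x) \<Rightarrow>
   ('y \<Rightarrow> 'x) \<Rightarrow> (nat \<Rightarrow> 'y \<Rightarrow> 'x \<Rightarrow>\<^sub>L 'x) \<Rightarrow> nat \<Rightarrow> bool"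
  where "cond_A1 j D A S Bk r \<longleftrightarrow>
    (\<forall>k\<in>{1..r}.
      (\<forall>y. conjugate_graph (graph_in_X j S ^^ k) (op_graph (D y) (A y)) =
           op_graph (D y) (\<lambda>v. A y v + blinfun_apply (Bk k y) v)) \<and>
      (\<forall>R>0. \<exists>M. \<forall>y. norm y \<le> R \<longrightarrow> (\<forall>v. norm (blinfun_apply (Bk k y) v) \<le> M * norm v)))"

definition cond_A2 ::
  "('y::real_inner \<Rightarrow> 'x::real_inner) \<Rightarrow> ('y \<Rightarrow> 'x \<Rightarrow> 'x) \<Rightarrow>
   (nat \<Rightarrow> 'y \<Rightarrow> 'x \<Rightarrow>\<^sub>L 'x) \<Rightarrow> nat \<Rightarrow> bool"
  where "cond_A2 j A Bk r \<longleftrightarrow>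
    smooth_bounded_on_balls (\<lambda>y. Blinfun (\<lambda>w. A y (j w))) \<and>
    (\<forall>k\<in>{1..r}. smooth_bounded_on_balls (Bk k))"

definition solves_evolution ::
  "('y::real_inner \<Rightarrow> 'x::real_inner) \<Rightarrow> ('y \<Rightarrow> 'x \<Rightarrow> 'x) \<Rightarrow> real \<Rightarrow> (real \<Rightarrow> 'y) \<Rightarrow> bool"
  where "solves_evolution j A T u \<longleftrightarrow>
    (\<forall>t\<in>{0..T}. ((\<lambda>s. j (u s)) has_vector_derivative - A (u t) (j (u t))) (at t within {0..T}))"

text \<open>
  The function \<open>S\<^sup>k u\<close> is a \<open>C\<^sup>l\<close> function into \<open>Y\<close>; in particular \<open>u(t)\<close> lies in the domain of \<open>S\<^sup>k\<close>.
\<close>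

definition power_regular ::
  "('y::real_inner \<Rightarrow> 'x::real_inner) \<Rightarrow> ('y \<Rightarrow> 'x) \<Rightarrow> real \<Rightarrow> (real \<Rightarrow> 'y) \<Rightarrow> nat \<Rightarrow> nat \<Rightarrow> bool"
  where "power_regular j S T u k l \<longleftrightarrow>
    (\<exists>v. (\<forall>t\<in>{0..T}. (j (u t), j (v t)) \<in> graph_in_X j S ^^ k) \<and> Ck_on l {0..T} v)"


section \<open>Runge--Kutta methods\<close>

definition rk_node :: "real^'m^'m \<Rightarrow> 'm::finite \<Rightarrow> real"
  where "rk_node a i = (\<Sum>k\<in>UNIV. a $ i $ k)"

definition has_stage_order :: "real^'m^'m \<Rightarrow> nat \<Rightarrow> bool"
  where "has_stage_order a q \<longleftrightarrow>
    (\<forall>i. \<forall>k\<in>{1..q}. (\<Sum>l\<in>UNIV. a $ i $ l * rk_node a l ^ (k - 1)) = rk_node a i ^ k / real k)"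

definition has_quadrature_order :: "real^'m^'m \<Rightarrow> real^'m \<Rightarrow> nat \<Rightarrow> bool"
  where "has_quadrature_order a b r \<longleftrightarrow>
    (\<forall>k\<in>{1..r}. (\<Sum>l\<in>UNIV. b $ l * rk_node a l ^ (k - 1)) = 1 / real k)"

definition coercive :: "real^'m^'m \<Rightarrow> bool"
  where "coercive a \<longleftrightarrow>
    invertible a \<and>
    (\<exists>(d::real^'m) \<alpha>. (\<forall>i. d $ i > 0) \<and> \<alpha> > 0 \<and>
      (let \<D> = (\<chi> i k. if i = k then d $ i else 0) in
       \<forall>v. inner v ((\<D> ** matrix_inv a) *v v) \<ge> \<alpha> * inner v (\<D> *v v)))"

definition algebraically_stable :: "real^'m^'m \<Rightarrow> real^'m \<Rightarrow> bool"
  where "algebraically_stable a b \<longleftrightarrow>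
    (\<forall>i. b $ i > 0) \<and>
    (\<forall>v. inner v ((\<chi> i k. b $ i * a $ i $ k + b $ k * a $ k $ i - b $ i * b $ k) *v v) \<ge> 0)"

text \<open>
  The classical order quantifies over ordinary differential equations in \<open>\<real>\<^sup>N\<close> for every \<open>N\<close>. Hence
  \<open>\<real>\<^sup>N\<close> is here the set of real sequences that vanish from index \<open>N\<close> on; the product topology induces
  the Euclidean topology on it. A field on \<open>\<real>\<^sup>N\<close> is arbitrarily differentiable iff its components
  \<open>x \<mapsto> g x i\<close> have continuous partial derivatives of all orders: \<open>G [k\<^sub>1, \<dots>, k\<^sub>n]\<close> is the partial
  derivative of order \<open>n\<close> with respect to the coordinates \<open>k\<^sub>n, \<dots>, k\<^sub>1\<close>.
\<close>

definition RN :: "nat \<Rightarrow> (nat \<Rightarrow> real) set"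
  where "RN N = {x. \<forall>i\<ge>N. x i = 0}"

definition smooth_field :: "nat \<Rightarrow> ((nat \<Rightarrow> real) \<Rightarrow> nat \<Rightarrow> real) \<Rightarrow> bool"
  where "smooth_field N g \<longleftrightarrow>
    (\<forall>i<N. \<exists>G :: nat list \<Rightarrow> (nat \<Rightarrow> real) \<Rightarrow> real.
       (\<forall>x\<in>RN N. G [] x = g x i) \<and>
       (\<forall>ks. set ks \<subseteq> {..<N} \<longrightarrow>
          continuous_on (RN N) (G ks) \<and>
          (\<forall>k<N. \<forall>x\<in>RN N.
             ((\<lambda>s. G ks (x(k := s))) has_real_derivative G (k # ks) x) (at (x k)))))"

definition solves_ode ::
  "nat \<Rightarrow> ((nat \<Rightarrow> real) \<Rightarrow> nat \<Rightarrow> real) \<Rightarrow> real \<Rightarrow> (real \<Rightarrow> nat \<Rightarrow> real) \<Rightarrow> bool"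
  where "solves_ode N g h y \<longleftrightarrow>
    (\<forall>t\<in>{0..h}. y t \<in> RN N \<and>
       (\<forall>i<N. ((\<lambda>s. y s i) has_real_derivative g (y t) i) (at t within {0..h})))"

text \<open>
  \<open>ode_rk_step N g a b \<tau> \<delta> y0 y1\<close>: one step from \<open>y0\<close> to \<open>y1\<close> with all stages \<open>\<delta>\<close>-close to \<open>y0\<close>.
  Since \<open>g\<close> need not be globally Lipschitz, the implicit stage equations may have spurious solutions
  far from \<open>y0\<close>; the method uses the solution near \<open>y0\<close>, which exists and is unique for fixed small
  \<open>\<delta>\<close> and all sufficiently small \<open>\<tau>\<close>.
\<close>

definition ode_rk_step ::
  "nat \<Rightarrow> ((nat \<Rightarrow> real) \<Rightarrow> nat \<Rightarrow> real) \<Rightarrow> real^'m^'m \<Rightarrow> real^'m \<Rightarrow> real \<Rightarrow> real \<Rightarrow>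
   (nat \<Rightarrow> real) \<Rightarrow> (nat \<Rightarrow> real) \<Rightarrow> bool"
  where "ode_rk_step N g a b \<tau> \<delta> y0 y1 \<longleftrightarrow>
    (\<exists>Y :: 'm \<Rightarrow> nat \<Rightarrow> real.
       (\<forall>l. Y l \<in> RN N \<and> (\<forall>i<N. \<bar>Y l i - y0 i\<bar> \<le> \<delta>)) \<and>
       (\<forall>l. \<forall>i<N. Y l i = y0 i + \<tau> * (\<Sum>k\<in>UNIV. a $ l $ k * g (Y k) i)) \<and>
       (\<forall>i<N. y1 i = y0 i + \<tau> * (\<Sum>k\<in>UNIV. b $ k * g (Y k) i)))"

definition has_classical_order :: "real^'m^'m \<Rightarrow> real^'m \<Rightarrow> nat \<Rightarrow> bool"
  where "has_classical_order a b p \<longleftrightarrow>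
    (\<forall>N g h y. smooth_field N g \<longrightarrow> h > 0 \<longrightarrow> solves_ode N g h y \<longrightarrow>
       (\<exists>C. \<exists>\<delta>>0. \<exists>\<tau>0>0. \<tau>0 \<le> h \<and>
          (\<forall>\<tau> y1. 0 < \<tau> \<longrightarrow> \<tau> \<le> \<tau>0 \<longrightarrow> ode_rk_step N g a b \<tau> \<delta> (y 0) y1 \<longrightarrow>
             (\<forall>i<N. \<bar>y1 i - y \<tau> i\<bar> \<le> C * \<tau> ^ (p + 1)))))"

text \<open>
  \<open>rk_stages j A a Cs \<tau> un U\<close>: the family \<open>U\<close> in \<open>Y\<close> solves the stage equations of the step starting
  from \<open>un\<close>, and obeys the two bounds with the constant \<open>Cs\<close> that single out the stages of the
  numerical solution.
\<close>

definition rk_stages ::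
  "('y::real_inner \<Rightarrow> 'x::real_inner) \<Rightarrow> ('y \<Rightarrow> 'x \<Rightarrow> 'x) \<Rightarrow> real^'m^'m \<Rightarrow> real \<Rightarrow> real \<Rightarrow>
   'y \<Rightarrow> ('m::finite \<Rightarrow> 'y) \<Rightarrow> bool"
  where "rk_stages j A a Cs \<tau> un U \<longleftrightarrow>
    (\<forall>i. j (U i) = j un + \<tau> *\<^sub>R (\<Sum>k\<in>UNIV. a $ i $ k *\<^sub>R (- A (U k) (j (U k))))) \<and>
    (\<forall>i. norm (j (U i)) \<le> Cs * norm (j un) \<and> norm (U i) \<le> Cs * norm un)"

definition stage_constant ::
  "('y::real_inner \<Rightarrow> 'x::real_inner) \<Rightarrow> ('y \<Rightarrow> 'x \<Rightarrow> 'x) \<Rightarrow> real^'m^'m \<Rightarrow> real \<Rightarrow> bool"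
  where "stage_constant j A a Cs \<longleftrightarrow>
    (\<forall>\<rho>>0. \<exists>\<tau>0>0. \<forall>\<tau> un. 0 < \<tau> \<longrightarrow> \<tau> \<le> \<tau>0 \<longrightarrow> norm un \<le> \<rho> \<longrightarrow>
       (\<exists>!U :: 'm \<Rightarrow> 'y. rk_stages j A a Cs \<tau> un U))"

text \<open>
  \<open>un\<close> is a numerical solution up to time \<open>T\<close>; the values \<open>un n\<close> with \<open>n * \<tau> > T\<close> are irrelevant.
\<close>

definition rk_solution ::
  "('y::real_inner \<Rightarrow> 'x::real_inner) \<Rightarrow> ('y \<Rightarrow> 'x \<Rightarrow> 'x) \<Rightarrow> real^'m^'m \<Rightarrow> real^'m \<Rightarrow> real \<Rightarrow>
   real \<Rightarrow> real \<Rightarrow> 'y \<Rightarrow> (nat \<Rightarrow> 'y) \<Rightarrow> bool"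
  where "rk_solution j A a b Cs T \<tau> u0 un \<longleftrightarrow>
    un 0 = u0 \<and>
    (\<forall>n. real (Suc n) * \<tau> \<le> T \<longrightarrow>
       (\<exists>U :: 'm \<Rightarrow> 'y. rk_stages j A a Cs \<tau> (un n) U \<and>
          j (un (Suc n)) = j (un n) + \<tau> *\<^sub>R (\<Sum>i\<in>UNIV. b $ i *\<^sub>R (- A (U i) (j (U i))))))"

end

theory Submission
  imports Defs
begin

text \<open>
  Let \<open>r = p - q\<close>. Differences are measured in the norm of \<open>Y\<close> by applying the isometry \<open>S\<close>. In this
  form the equation is dissipative up to bounded terms, because \<open>A y\<close> is accretive and its commutator
  with \<open>S\<close> is bounded. Hence algebraic stability and coercivity give the classical B-stability estimate
  for one step (\<open>rk_step_stable\<close>), and a numerical step may be compared with any reference stages that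
  satisfy the Runge--Kutta equations up to small defects, provided that \<open>S\<close> maps them boundedly into
  \<open>Y\<close>: this is needed to absorb the dependence of the operators on the state (\<open>step_stability\<close>).

  The solution at the nodes is a bad choice of reference stages, since it leaves defects of order
  \<open>q + 1\<close> only. It is corrected by \<open>r\<close> steps of a fixed-point iteration for the stage equations,
  linearized along the solution. Each step gains a factor \<open>\<tau>\<close> and costs one power of \<open>S\<close>, as the
  linearized operator maps the domain of \<open>S ^ k\<close> into that of \<open>S ^ (k - 1)\<close>; the \<open>r\<close> powers of \<open>S\<close> that
  the solution admits are exactly enough. The remaining nonlinear terms are quadratic in the
  corrections and thus of order \<open>2 q + 2\<close>. What is left in the update is a sum of terms in which a
  Taylor coefficient of the stage defect is propagated through powers of nodes and the coefficient
  matrix (\<open>defect_expansion\<close>). Their weights are differences of two sides of order conditions for tall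
  trees and vanish up to order \<open>p\<close>. These conditions are read off from the classical order, applied to
  linear chains \<open>z\<^sub>k\<^sub>+\<^sub>1' = t ^ l k * z\<^sub>k\<close> (\<open>chain_order_condition\<close>). This gives \<open>reference_stages\<close>.

  To avoid unbounded operators, the argument is carried out with the bounded map \<open>K = S\<inverse> j\<close> on \<open>Y\<close>:
  an element \<open>K ^ k z\<close> of the domain of \<open>S ^ k\<close> is represented by \<open>z\<close>, and \<open>A y\<close> acts on these
  representatives as a bounded operator \<open>Q k y\<close>, with \<open>K (Q (k + 1) y z) = Q k y (K z)\<close>. As nodes may lie
  outside of \<open>[0, 1]\<close>, the solution is extended beyond \<open>[0, T]\<close> by a linear reflection formula, which is
  compatible with \<open>K\<close>; the residual of the extended solution is of order \<open>p\<close> near the end points.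

  A discrete Gronwall argument sums up the one-step errors. It keeps the numerical solution in a fixed
  ball, on which the stages exist and the constants are uniform.
\<close>

section \<open>Stability of one Runge--Kutta step\<close>

text \<open>
  A quadratic form in real variables that is nonnegative stays so when the variables are replaced by
  vectors: splitting off the components along one of the vectors makes that vector vanish, and the
  split-off part is the form evaluated at real numbers.
\<close>

lemma nonneg_form_vectors:
  fixes m :: "'m::finite \<Rightarrow> 'm \<Rightarrow> real" and x :: "'m \<Rightarrow> 'x::real_inner"
  assumes form: "\<And>v::'m \<Rightarrow> real. 0 \<le> (\<Sum>i\<in>UNIV. \<Sum>k\<in>UNIV. m i k * (v i * v k))"
  shows "0 \<le> (\<Sum>i\<in>UNIV. \<Sum>k\<in>UNIV. m i k * inner (x i) (x k))"
proof (induction "card {i. x i \<noteq> 0}" arbitrary: x rule: less_induct)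
  case less
  show ?case
  proof (cases "\<exists>k. x k \<noteq> 0")
    case False
    then show ?thesis by simp
  next
    case True
    then obtain k0 where k0: "x k0 \<noteq> 0" by blast
    define e where "e = x k0 /\<^sub>R norm (x k0)"
    define l where "l i = inner (x i) e" for i
    define x' where "x' i = x i - l i *\<^sub>R e" for i
    have e1: "inner e e = 1"
      using k0 by (simp add: e_def power2_norm_eq_inner[symmetric] power2_eq_square)
    have orth: "inner (x' i) e = 0" for i
      by (simp add: x'_def l_def inner_diff_left e1)
    have orth': "inner e (x' i) = 0" for i
      using orth[of i] by (simp add: inner_commute)
    have split: "inner (x i) (x k) = l i * l k + inner (x' i) (x' k)" for i k
    proof -
      have "x i = x' i + l i *\<^sub>R e" "x k = x' k + l k *\<^sub>R e"
        by (simp_all add: x'_def)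
      then have "inner (x i) (x k) = inner (x' i + l i *\<^sub>R e) (x' k + l k *\<^sub>R e)"
        by simp
      also have "\<dots> = l i * l k + inner (x' i) (x' k)"
        by (simp add: inner_add_left inner_add_right orth orth' e1)
      finally show ?thesis .
    qed
    have "x' k0 = 0"
    proof -
      have "l k0 = norm (x k0)"
        using k0 by (simp add: l_def e_def power2_norm_eq_inner[symmetric] power2_eq_square)
      then show ?thesis
        using k0 by (simp add: x'_def e_def)
    qed
    moreover have "x' i = 0" if "x i = 0" for i
      using that by (simp add: x'_def l_def)
    ultimately have "{i. x' i \<noteq> 0} \<subset> {i. x i \<noteq> 0}"
      using k0 by blast
    then have "card {i. x' i \<noteq> 0} < card {i. x i \<noteq> 0}"
      by (simp add: psubset_card_mono)
    then have "0 \<le> (\<Sum>i\<in>UNIV. \<Sum>k\<in>UNIV. m i k * inner (x' i) (x' k))"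
      using less by blast
    moreover have "(\<Sum>i\<in>UNIV. \<Sum>k\<in>UNIV. m i k * inner (x i) (x k)) =
        (\<Sum>i\<in>UNIV. \<Sum>k\<in>UNIV. m i k * (l i * l k)) + (\<Sum>i\<in>UNIV. \<Sum>k\<in>UNIV. m i k * inner (x' i) (x' k))"
      by (simp add: split distrib_left sum.distrib)
    ultimately show ?thesis
      using form[of l] by simp
  qed
qed

lemma norm_weighted_sum_le:
  fixes f :: "'m::finite \<Rightarrow> 'e::real_normed_vector"
  assumes "\<And>m. norm (f m) \<le> B"
  shows "norm (\<Sum>m\<in>UNIV. c m *\<^sub>R f m) \<le> (\<Sum>m\<in>UNIV. \<bar>c m\<bar>) * B"
proof -
  have "norm (\<Sum>m\<in>UNIV. c m *\<^sub>R f m) \<le> (\<Sum>m\<in>UNIV. \<bar>c m\<bar> * B)"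
    using assms by (intro sum_norm_le) (auto intro!: mult_left_mono)
  then show ?thesis by (simp add: sum_distrib_right)
qed

lemma invertible_sum_inverse:
  fixes a :: "real^'m^'m"
  assumes "invertible a"
  shows "(\<Sum>k\<in>UNIV. matrix_inv a $ i $ k * a $ k $ l) = (if i = l then 1 else 0)"
    and "(\<Sum>k\<in>UNIV. a $ i $ k * matrix_inv a $ k $ l) = (if i = l then 1 else 0)"
proof -
  have "matrix_inv a ** a = mat 1" "a ** matrix_inv a = mat 1"
    using assms unfolding invertible_def matrix_inv_def
    by (metis (mono_tags, lifting) someI_ex)+
  then have "(matrix_inv a ** a) $ i $ l = mat 1 $ i $ l" "(a ** matrix_inv a) $ i $ l = mat 1 $ i $ l"
    by simp_all
  then show "(\<Sum>k\<in>UNIV. matrix_inv a $ i $ k * a $ k $ l) = (if i = l then 1 else 0)"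
    and "(\<Sum>k\<in>UNIV. a $ i $ k * matrix_inv a $ k $ l) = (if i = l then 1 else 0)"
    by (simp_all add: matrix_matrix_mult_def mat_def)
qed

lemma solve_matrix_vectors:
  fixes a :: "real^'m^'m" and x :: "'m \<Rightarrow> 'x::real_vector"
  assumes "invertible a"
  shows "(\<Sum>k\<in>UNIV. a $ i $ k *\<^sub>R (\<Sum>l\<in>UNIV. matrix_inv a $ k $ l *\<^sub>R x l)) = x i"
    and "(\<Sum>k\<in>UNIV. matrix_inv a $ i $ k *\<^sub>R (\<Sum>l\<in>UNIV. a $ k $ l *\<^sub>R x l)) = x i"
proof -
  have aux: "(\<Sum>k\<in>UNIV. f k *\<^sub>R (\<Sum>l\<in>UNIV. g k l *\<^sub>R x l)) = x i"
    if "\<And>l. (\<Sum>k\<in>UNIV. f k * g k l) = (if i = l then 1 else 0)"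
    for f :: "'m \<Rightarrow> real" and g :: "'m \<Rightarrow> 'm \<Rightarrow> real"
  proof -
    have "(\<Sum>k\<in>UNIV. f k *\<^sub>R (\<Sum>l\<in>UNIV. g k l *\<^sub>R x l)) = (\<Sum>k\<in>UNIV. \<Sum>l\<in>UNIV. (f k * g k l) *\<^sub>R x l)"
      by (simp add: scaleR_sum_right)
    also have "\<dots> = (\<Sum>l\<in>UNIV. (\<Sum>k\<in>UNIV. f k * g k l) *\<^sub>R x l)"
      by (subst sum.swap) (simp add: scaleR_sum_left)
    also have "\<dots> = (\<Sum>l\<in>UNIV. if i = l then x l else 0)"
      by (intro sum.cong) (auto simp: that)
    finally show ?thesis by simp
  qed
  show "(\<Sum>k\<in>UNIV. a $ i $ k *\<^sub>R (\<Sum>l\<in>UNIV. matrix_inv a $ k $ l *\<^sub>R x l)) = x i"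
    by (rule aux) (rule invertible_sum_inverse[OF assms])
  show "(\<Sum>k\<in>UNIV. matrix_inv a $ i $ k *\<^sub>R (\<Sum>l\<in>UNIV. a $ k $ l *\<^sub>R x l)) = x i"
    by (rule aux) (rule invertible_sum_inverse[OF assms])
qed

text \<open>
  The stages of a step for a dissipative equation: the slopes satisfy a one-sided Lipschitz condition
  up to a perturbation of size \<open>\<rho>\<close>.
\<close>

definition one_sided_stages ::
  "real^'m^'m \<Rightarrow> real \<Rightarrow> real \<Rightarrow> real \<Rightarrow> 'x::real_inner \<Rightarrow> ('m \<Rightarrow> 'x) \<Rightarrow> ('m \<Rightarrow> 'x) \<Rightarrow> bool"
  where "one_sided_stages a \<tau> \<kappa> \<rho> x X V \<longleftrightarrow> 0 < \<tau> \<and> 0 \<le> \<kappa> \<and> 0 \<le> \<rho> \<and>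
    (\<forall>i. X i = x + \<tau> *\<^sub>R (\<Sum>k\<in>UNIV. a $ i $ k *\<^sub>R V k)) \<and>
    (\<forall>i. inner (X i) (V i) \<le> \<kappa> * (norm (X i))\<^sup>2 + \<rho> * norm (X i))"

text \<open>
  Coercivity bounds the stages: testing the stage equations, multiplied by the inverse of the
  coefficient matrix, with the stages themselves leaves only one-sided information on the slopes.
\<close>

lemma coercive_stage_bound:
  fixes a :: "real^'m^'m"
  assumes "coercive a"
  obtains \<gamma> c :: real where "\<gamma> > 0" "c > 0"
    "\<And>(x::'x::real_inner) X V \<tau> \<kappa> \<rho>. one_sided_stages a \<tau> \<kappa> \<rho> x X V \<Longrightarrow> \<tau> * \<kappa> \<le> \<gamma> \<Longrightarrow>
      (\<Sum>i\<in>UNIV. norm (X i)) \<le> c * (norm x + \<tau> * \<rho>)"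
proof -
  have inv: "invertible a" using assms by (simp add: coercive_def)
  obtain d :: "real^'m" and \<alpha> where d: "\<And>i. d $ i > 0" and \<alpha>: "\<alpha> > 0" and
    co: "\<And>v. inner v (((\<chi> i k. if i = k then d $ i else 0) ** matrix_inv a) *v v)
          \<ge> \<alpha> * inner v ((\<chi> i k. if i = k then d $ i else 0) *v v)"
    using assms unfolding coercive_def Let_def by blast
  define ai where "ai = matrix_inv a"
  \<comment> \<open>Coercivity says that the following form is nonnegative.\<close>
  define M where "M i k = d $ i * ai $ i $ k - (if i = k then \<alpha> * d $ i else 0)" for i k
  have form: "0 \<le> (\<Sum>i\<in>UNIV. \<Sum>k\<in>UNIV. M i k * (v i * v k))" for v :: "'m \<Rightarrow> real"
  proof -
    have 1: "((\<chi> i k. if i = k then d $ i else 0) ** ai) = (\<chi> i k. d $ i * ai $ i $ k)"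
      by (simp add: matrix_matrix_mult_def vec_eq_iff if_distrib[where f="\<lambda>z. z * _"] cong: if_cong)
    have 2: "((\<chi> i k. if i = k then d $ i else 0) *v w) = (\<chi> i. d $ i * w $ i)" for w :: "real^'m"
      by (simp add: matrix_vector_mult_def vec_eq_iff if_distrib[where f="\<lambda>z. z * _"] cong: if_cong)
    have "\<alpha> * (\<Sum>i\<in>UNIV. v i * (d $ i * v i)) \<le> (\<Sum>i\<in>UNIV. v i * (\<Sum>k\<in>UNIV. d $ i * ai $ i $ k * v k))"
      using co[of "\<chi> i. v i"] unfolding ai_def[symmetric] 1 2
      by (simp add: inner_vec_def matrix_vector_mult_def)
    moreover have "(\<Sum>i\<in>UNIV. \<Sum>k\<in>UNIV. M i k * (v i * v k)) =
        (\<Sum>i\<in>UNIV. v i * (\<Sum>k\<in>UNIV. d $ i * ai $ i $ k * v k)) - \<alpha> * (\<Sum>i\<in>UNIV. v i * (d $ i * v i))"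
      by (simp add: M_def left_diff_distrib sum_subtractf sum_distrib_left algebra_simps
          if_distrib[where f="\<lambda>z. z * _"] if_distrib[where f="\<lambda>z. _ * z"] cong: if_cong)
    ultimately show ?thesis by simp
  qed
  define dm where "dm = Min (range (($) d))"
  have dm: "dm > 0" "dm \<le> d $ i" for i
    using d by (auto simp: dm_def)
  define n where "n = real CARD('m)"
  have n: "n \<ge> 1" using zero_less_card_finite[where 'a='m] by (simp add: n_def)
  define c0 where "c0 = (\<Sum>i\<in>UNIV. d $ i * (1 + (\<Sum>k\<in>UNIV. \<bar>ai $ i $ k\<bar>)))"
  have c0: "c0 > 0" unfolding c0_def
    by (intro sum_pos mult_pos_pos d add_pos_nonneg sum_nonneg) auto
  have c0i: "d $ i * (1 + (\<Sum>k\<in>UNIV. \<bar>ai $ i $ k\<bar>)) \<le> c0" for i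
    unfolding c0_def
    by (intro member_le_sum mult_nonneg_nonneg add_nonneg_nonneg sum_nonneg less_imp_le[OF d]) auto
  show thesis
  proof (rule that[of "\<alpha> / 2" "2 * c0 * n / (\<alpha> * dm)"])
    show "\<alpha> / 2 > 0" "2 * c0 * n / (\<alpha> * dm) > 0" using \<alpha> c0 n dm by auto
    fix x :: 'x and X V :: "'m \<Rightarrow> 'x" and \<tau> \<kappa> \<rho> :: real
    assume stages: "one_sided_stages a \<tau> \<kappa> \<rho> x X V" and \<tau>\<kappa>: "\<tau> * \<kappa> \<le> \<alpha> / 2"
    then have \<tau>: "0 < \<tau>" and \<kappa>: "0 \<le> \<kappa>" and \<rho>: "0 \<le> \<rho>"
      and X: "\<And>i. X i = x + \<tau> *\<^sub>R (\<Sum>k\<in>UNIV. a $ i $ k *\<^sub>R V k)"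
      and one: "\<And>i. inner (X i) (V i) \<le> \<kappa> * (norm (X i))\<^sup>2 + \<rho> * norm (X i)"
      by (auto simp: one_sided_stages_def)
    define s where "s = (\<Sum>i\<in>UNIV. d $ i * (norm (X i))\<^sup>2)"
    define N where "N = (\<Sum>i\<in>UNIV. norm (X i))"
    have N0: "N \<ge> 0" by (simp add: N_def sum_nonneg)
    have slope: "(\<Sum>k\<in>UNIV. ai $ i $ k *\<^sub>R (X k - x)) = \<tau> *\<^sub>R V i" for i
    proof -
      have "(\<Sum>k\<in>UNIV. ai $ i $ k *\<^sub>R (X k - x)) = \<tau> *\<^sub>R (\<Sum>k\<in>UNIV. ai $ i $ k *\<^sub>R (\<Sum>l\<in>UNIV. a $ k $ l *\<^sub>R V l))"
        unfolding X add_diff_cancel_left' scaleR_left_commute[of _ \<tau>] scaleR_sum_right[of \<tau>, symmetric] ..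
      then show ?thesis
        unfolding ai_def solve_matrix_vectors(2)[OF inv] .
    qed
    have "0 \<le> (\<Sum>i\<in>UNIV. \<Sum>k\<in>UNIV. M i k * inner (X i) (X k))"
      by (rule nonneg_form_vectors) (rule form)
    also have "\<dots> = (\<Sum>i\<in>UNIV. \<Sum>k\<in>UNIV. d $ i * ai $ i $ k * inner (X i) (X k)) - \<alpha> * s"
      by (simp add: M_def left_diff_distrib sum_subtractf sum_distrib_left algebra_simps s_def power2_norm_eq_inner
          if_distrib[where f="\<lambda>z. z * _"] if_distrib[where f="\<lambda>z. _ * z"] cong: if_cong)
    also have "(\<Sum>i\<in>UNIV. \<Sum>k\<in>UNIV. d $ i * ai $ i $ k * inner (X i) (X k)) =
        (\<Sum>i\<in>UNIV. d $ i * (\<tau> * inner (X i) (V i)) + d $ i * inner (X i) ((\<Sum>k\<in>UNIV. ai $ i $ k) *\<^sub>R x))"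
    proof (rule sum.cong[OF refl])
      fix i
      have "(\<Sum>k\<in>UNIV. d $ i * ai $ i $ k * inner (X i) (X k)) = d $ i * inner (X i) (\<Sum>k\<in>UNIV. ai $ i $ k *\<^sub>R X k)"
        by (simp add: inner_sum_right sum_distrib_left mult.assoc)
      also have "(\<Sum>k\<in>UNIV. ai $ i $ k *\<^sub>R X k) = \<tau> *\<^sub>R V i + (\<Sum>k\<in>UNIV. ai $ i $ k) *\<^sub>R x"
        using slope[of i] by (simp add: scaleR_diff_right sum_subtractf scaleR_sum_left algebra_simps)
      finally show "(\<Sum>k\<in>UNIV. d $ i * ai $ i $ k * inner (X i) (X k)) =
          d $ i * (\<tau> * inner (X i) (V i)) + d $ i * inner (X i) ((\<Sum>k\<in>UNIV. ai $ i $ k) *\<^sub>R x)"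
        by (simp add: inner_add_right distrib_left)
    qed
    also have "\<dots> \<le> (\<Sum>i\<in>UNIV. (\<tau> * \<kappa>) * (d $ i * (norm (X i))\<^sup>2) + c0 * (norm x + \<tau> * \<rho>) * norm (X i))"
    proof (rule sum_mono)
      fix i
      have 1: "d $ i * (\<tau> * inner (X i) (V i)) \<le> d $ i * (\<tau> * (\<kappa> * (norm (X i))\<^sup>2 + \<rho> * norm (X i)))"
        using d[of i] \<tau> one[of i] by (intro mult_left_mono) auto
      have "inner (X i) ((\<Sum>k\<in>UNIV. ai $ i $ k) *\<^sub>R x) \<le> norm (X i) * (\<bar>\<Sum>k\<in>UNIV. ai $ i $ k\<bar> * norm x)"
        using norm_cauchy_schwarz[of "X i" "(\<Sum>k\<in>UNIV. ai $ i $ k) *\<^sub>R x"] by simp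
      also have "\<dots> \<le> norm (X i) * ((\<Sum>k\<in>UNIV. \<bar>ai $ i $ k\<bar>) * norm x)"
        by (intro mult_left_mono mult_right_mono sum_abs) auto
      finally have 2: "d $ i * inner (X i) ((\<Sum>k\<in>UNIV. ai $ i $ k) *\<^sub>R x) \<le> d $ i * (norm (X i) * ((\<Sum>k\<in>UNIV. \<bar>ai $ i $ k\<bar>) * norm x))"
        using d[of i] by (intro mult_left_mono) auto
      have "0 \<le> d $ i * (\<Sum>k\<in>UNIV. \<bar>ai $ i $ k\<bar>)"
        by (intro mult_nonneg_nonneg sum_nonneg less_imp_le[OF d]) auto
      then have dc: "d $ i \<le> c0" "d $ i * (\<Sum>k\<in>UNIV. \<bar>ai $ i $ k\<bar>) \<le> c0"
        using c0i[of i] d[of i] unfolding distrib_left mult_1_right by linarith+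
      have "d $ i * \<tau> * \<rho> \<le> c0 * \<tau> * \<rho>"
        using dc(1) \<tau> \<rho> by (intro mult_right_mono) auto
      moreover have "d $ i * (\<Sum>k\<in>UNIV. \<bar>ai $ i $ k\<bar>) * norm x \<le> c0 * norm x"
        using dc(2) by (intro mult_right_mono) auto
      ultimately have "(d $ i * \<tau> * \<rho> + d $ i * (\<Sum>k\<in>UNIV. \<bar>ai $ i $ k\<bar>) * norm x) * norm (X i)
          \<le> (c0 * \<tau> * \<rho> + c0 * norm x) * norm (X i)"
        by (intro mult_right_mono) auto
      with 1 2 show "d $ i * (\<tau> * inner (X i) (V i)) + d $ i * inner (X i) ((\<Sum>k\<in>UNIV. ai $ i $ k) *\<^sub>R x)
          \<le> (\<tau> * \<kappa>) * (d $ i * (norm (X i))\<^sup>2) + c0 * (norm x + \<tau> * \<rho>) * norm (X i)"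
        by (simp add: algebra_simps)
    qed
    also have "\<dots> = (\<tau> * \<kappa>) * s + c0 * (norm x + \<tau> * \<rho>) * N"
      by (simp add: sum.distrib s_def N_def sum_distrib_left)
    finally have "\<alpha> * s \<le> (\<tau> * \<kappa>) * s + c0 * (norm x + \<tau> * \<rho>) * N" by simp
    moreover have "(\<tau> * \<kappa>) * s \<le> \<alpha> / 2 * s"
      using \<tau>\<kappa> by (intro mult_right_mono) (auto simp: s_def intro!: sum_nonneg mult_nonneg_nonneg less_imp_le[OF d])
    ultimately have 1: "\<alpha> / 2 * s \<le> c0 * (norm x + \<tau> * \<rho>) * N" by simp
    have "N\<^sup>2 \<le> n * (\<Sum>i\<in>UNIV. (norm (X i))\<^sup>2)"
      using sum_squared_le_sum_of_squares[of "\<lambda>i. norm (X i)" UNIV] by (simp add: N_def n_def mult.commute)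
    moreover have "dm * (\<Sum>i\<in>UNIV. (norm (X i))\<^sup>2) \<le> s"
      unfolding s_def sum_distrib_left using dm by (intro sum_mono mult_right_mono) auto
    ultimately have "dm * N\<^sup>2 \<le> dm * (n * (\<Sum>i\<in>UNIV. (norm (X i))\<^sup>2))"
      and "n * (dm * (\<Sum>i\<in>UNIV. (norm (X i))\<^sup>2)) \<le> n * s"
      using dm(1) n by (auto intro!: mult_left_mono)
    then have "dm * N\<^sup>2 \<le> n * s" by (simp add: mult.left_commute)
    then have "\<alpha> * (dm * N\<^sup>2) \<le> \<alpha> * (n * s)"
      using \<alpha> by (intro mult_left_mono) auto
    then have "\<alpha> * dm * N\<^sup>2 \<le> 2 * n * (\<alpha> / 2 * s)"
      by (simp add: ac_simps)
    also have "\<dots> \<le> 2 * n * (c0 * (norm x + \<tau> * \<rho>) * N)"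
      using 1 n by (intro mult_left_mono) auto
    finally have 2: "(\<alpha> * dm * N) * N \<le> (2 * n * c0 * (norm x + \<tau> * \<rho>)) * N"
      by (simp add: algebra_simps power2_eq_square)
    have "\<alpha> * dm * N \<le> 2 * n * c0 * (norm x + \<tau> * \<rho>)"
    proof (cases "N = 0")
      case True
      then show ?thesis using n c0 \<tau> \<rho> by simp
    next
      case False
      then show ?thesis using 2 N0 by (simp add: mult_le_cancel_right)
    qed
    then show "(\<Sum>i\<in>UNIV. norm (X i)) \<le> 2 * c0 * n / (\<alpha> * dm) * (norm x + \<tau> * \<rho>)"
      unfolding N_def[symmetric] using \<alpha> dm(1) by (simp add: field_simps)
  qed
qed

text \<open>
  The B-stability identity: the square of the norm of the new value is that of the old one, plus
  products of stages with slopes, minus the form of algebraic stability in the slopes.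
\<close>

lemma algebraically_stable_update:
  fixes a :: "real^'m^'m" and x :: "'x::real_inner"
  assumes "algebraically_stable a b"
    and X: "\<And>i. X i = x + \<tau> *\<^sub>R (\<Sum>k\<in>UNIV. a $ i $ k *\<^sub>R V k)"
  shows "(norm (x + \<tau> *\<^sub>R (\<Sum>i\<in>UNIV. b $ i *\<^sub>R V i)))\<^sup>2 \<le> (norm x)\<^sup>2 + 2 * \<tau> * (\<Sum>i\<in>UNIV. b $ i * inner (X i) (V i))"
proof -
  define P where "P = (\<Sum>i\<in>UNIV. \<Sum>k\<in>UNIV. b $ i * b $ k * inner (V i) (V k))"
  define R where "R = (\<Sum>i\<in>UNIV. \<Sum>k\<in>UNIV. b $ i * a $ i $ k * inner (V i) (V k))"
  have "0 \<le> (\<Sum>i\<in>UNIV. \<Sum>k\<in>UNIV. (b $ i * a $ i $ k + b $ k * a $ k $ i - b $ i * b $ k) * inner (V i) (V k))"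
  proof (rule nonneg_form_vectors)
    fix v :: "'m \<Rightarrow> real"
    have "0 \<le> inner (\<chi> i. v i) ((\<chi> i k. b $ i * a $ i $ k + b $ k * a $ k $ i - b $ i * b $ k) *v (\<chi> i. v i))"
      using assms(1) unfolding algebraically_stable_def by blast
    then show "0 \<le> (\<Sum>i\<in>UNIV. \<Sum>k\<in>UNIV. (b $ i * a $ i $ k + b $ k * a $ k $ i - b $ i * b $ k) * (v i * v k))"
      by (simp add: inner_vec_def matrix_vector_mult_def sum_distrib_left algebra_simps)
  qed
  also have "\<dots> = R + (\<Sum>i\<in>UNIV. \<Sum>k\<in>UNIV. b $ k * a $ k $ i * inner (V i) (V k)) - P"
    unfolding R_def P_def by (simp only: left_diff_distrib distrib_right sum.distrib sum_subtractf)
  also have "(\<Sum>i\<in>UNIV. \<Sum>k\<in>UNIV. b $ k * a $ k $ i * inner (V i) (V k)) = R"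
    unfolding R_def by (subst sum.swap) (simp only: inner_commute)
  finally have PR: "P \<le> 2 * R" by simp
  define v where "v = (\<Sum>i\<in>UNIV. b $ i *\<^sub>R V i)"
  have "(\<Sum>i\<in>UNIV. b $ i * inner (X i) (V i)) =
      (\<Sum>i\<in>UNIV. b $ i * inner x (V i) + \<tau> * (\<Sum>k\<in>UNIV. b $ i * a $ i $ k * inner (V i) (V k)))"
    by (intro sum.cong refl)
      (simp add: X inner_add_left inner_sum_left inner_add_right inner_sum_right sum_distrib_left distrib_left
        mult.assoc mult.left_commute inner_commute)
  also have "\<dots> = inner x v + \<tau> * R"
    by (simp add: v_def R_def sum.distrib inner_sum_right sum_distrib_left)
  finally have "(\<Sum>i\<in>UNIV. b $ i * inner (X i) (V i)) = inner x v + \<tau> * R" .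
  moreover have "(norm v)\<^sup>2 = P"
    unfolding v_def power2_norm_eq_inner P_def
    by (simp add: inner_sum_left inner_sum_right sum_distrib_left mult.assoc mult.left_commute inner_commute)
  moreover have "(norm (x + \<tau> *\<^sub>R v))\<^sup>2 = (norm x)\<^sup>2 + 2 * \<tau> * inner x v + \<tau>\<^sup>2 * (norm v)\<^sup>2"
    unfolding power2_norm_eq_inner
    by (simp add: inner_add_left inner_add_right inner_commute[of v x] power2_eq_square distrib_left)
  moreover have "\<tau>\<^sup>2 * P \<le> \<tau>\<^sup>2 * (2 * R)"
    using PR by (intro mult_left_mono) auto
  ultimately show ?thesis
    unfolding v_def[symmetric] by (simp add: distrib_left power2_eq_square)
qed

lemma rk_step_stable:
  fixes a :: "real^'m^'m" and b :: "real^'m"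
  assumes "algebraically_stable a b" and "coercive a"
  obtains \<gamma> c :: real where "\<gamma> > 0" "c > 0"
    "\<And>(x::'x::real_inner) X V \<tau> \<kappa> \<rho>. one_sided_stages a \<tau> \<kappa> \<rho> x X V \<Longrightarrow> \<tau> * \<kappa> \<le> \<gamma> \<Longrightarrow>
      norm (x + \<tau> *\<^sub>R (\<Sum>i\<in>UNIV. b $ i *\<^sub>R V i)) \<le> (1 + c * \<kappa> * \<tau>) * norm x + c * (\<tau> * \<rho>)"
proof -
  obtain \<gamma> c1 :: real where \<gamma>: "\<gamma> > 0" and c1: "c1 > 0" and stage:
    "\<And>(x::'x::real_inner) X V \<tau> \<kappa> \<rho>. one_sided_stages a \<tau> \<kappa> \<rho> x X V \<Longrightarrow> \<tau> * \<kappa> \<le> \<gamma> \<Longrightarrow>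
      (\<Sum>i\<in>UNIV. norm (X i)) \<le> c1 * (norm x + \<tau> * \<rho>)"
    by (rule coercive_stage_bound[OF assms(2)]) blast
  have b: "b $ i > 0" for i using assms(1) by (simp add: algebraically_stable_def)
  define \<beta> where "\<beta> = (\<Sum>i\<in>UNIV. b $ i)"
  have \<beta>: "\<beta> > 0" unfolding \<beta>_def by (intro sum_pos b) auto
  have b\<beta>: "b $ i \<le> \<beta>" for i
    unfolding \<beta>_def using b by (intro member_le_sum) (auto intro: less_imp_le)
  define c where "c = 2 * \<beta> * c1\<^sup>2 * \<gamma> + 2 * \<beta> * c1 + \<beta> * c1\<^sup>2 + 1"
  have c: "c \<ge> 1" "c \<ge> \<beta> * c1\<^sup>2" "c \<ge> 2 * \<beta> * c1\<^sup>2 * \<gamma> + 2 * \<beta> * c1"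
    unfolding c_def using \<beta> c1 \<gamma> by auto
  show thesis
  proof (rule that[of \<gamma> c])
    show "\<gamma> > 0" "c > 0" using \<gamma> c by auto
    fix x :: 'x and X V :: "'m \<Rightarrow> 'x" and \<tau> \<kappa> \<rho> :: real
    assume stages: "one_sided_stages a \<tau> \<kappa> \<rho> x X V" and \<tau>\<kappa>: "\<tau> * \<kappa> \<le> \<gamma>"
    then have \<tau>: "0 < \<tau>" and \<kappa>: "0 \<le> \<kappa>" and \<rho>: "0 \<le> \<rho>"
      and X: "\<And>i. X i = x + \<tau> *\<^sub>R (\<Sum>k\<in>UNIV. a $ i $ k *\<^sub>R V k)"
      and one: "\<And>i. inner (X i) (V i) \<le> \<kappa> * (norm (X i))\<^sup>2 + \<rho> * norm (X i)"
      by (auto simp: one_sided_stages_def)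
    define N where "N = (\<Sum>i\<in>UNIV. norm (X i))"
    define n where "n = norm x"
    define s where "s = \<tau> * \<rho>"
    have s: "s \<ge> 0" using \<tau> \<rho> by (simp add: s_def)
    have n: "n \<ge> 0" by (simp add: n_def)
    have N0: "N \<ge> 0" by (simp add: N_def sum_nonneg)
    have N: "N \<le> c1 * (n + s)"
      unfolding N_def n_def s_def by (rule stage[OF stages \<tau>\<kappa>])
    have "(\<Sum>i\<in>UNIV. b $ i * inner (X i) (V i)) \<le> (\<Sum>i\<in>UNIV. \<beta> * (\<kappa> * N + \<rho>) * norm (X i))"
    proof (rule sum_mono)
      fix i
      have "norm (X i) \<le> N" unfolding N_def by (intro member_le_sum) auto
      then have "\<kappa> * (norm (X i) * norm (X i)) \<le> \<kappa> * (N * norm (X i))"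
        using \<kappa> by (intro mult_left_mono mult_right_mono) auto
      then have "inner (X i) (V i) \<le> (\<kappa> * N + \<rho>) * norm (X i)"
        using one[of i] by (simp add: power2_eq_square algebra_simps)
      then have "b $ i * inner (X i) (V i) \<le> b $ i * ((\<kappa> * N + \<rho>) * norm (X i))"
        using b[of i] by (intro mult_left_mono) auto
      also have "\<dots> \<le> \<beta> * ((\<kappa> * N + \<rho>) * norm (X i))"
        using b\<beta>[of i] \<kappa> N0 \<rho> by (intro mult_right_mono) auto
      finally show "b $ i * inner (X i) (V i) \<le> \<beta> * (\<kappa> * N + \<rho>) * norm (X i)" by simp
    qed
    also have "\<dots> = \<beta> * (\<kappa> * N + \<rho>) * N" by (simp add: N_def sum_distrib_left)
    finally have "2 * \<tau> * (\<Sum>i\<in>UNIV. b $ i * inner (X i) (V i)) \<le> 2 * \<tau> * (\<beta> * (\<kappa> * N + \<rho>) * N)"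
      using \<tau> by (intro mult_left_mono) auto
    also have "\<dots> = 2 * \<beta> * ((\<tau> * \<kappa>) * N\<^sup>2 + s * N)"
      by (simp add: s_def algebra_simps power2_eq_square)
    also have "\<dots> \<le> 2 * \<beta> * ((\<tau> * \<kappa>) * (c1 * (n + s))\<^sup>2 + s * (c1 * (n + s)))"
      using N N0 s \<tau> \<kappa> \<beta> by (intro mult_left_mono add_mono power_mono) auto
    also have "\<dots> \<le> ((1 + c * \<kappa> * \<tau>) * n + c * s)\<^sup>2 - n\<^sup>2"
    proof -
      define k where "k = \<tau> * \<kappa>"
      have k: "0 \<le> k" "k \<le> \<gamma>" using \<tau> \<kappa> \<tau>\<kappa> by (auto simp: k_def)
      have 1: "2 * \<beta> * c1\<^sup>2 * k * n\<^sup>2 \<le> 2 * c * k * n\<^sup>2"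
        using c(2) k by (intro mult_right_mono) auto
      have "2 * \<beta> * c1\<^sup>2 * k \<le> 2 * \<beta> * c1\<^sup>2 * \<gamma>"
        using k \<beta> by (intro mult_left_mono) auto
      then have e: "2 * \<beta> * c1\<^sup>2 * k + 2 * \<beta> * c1 \<le> c" using c(3) by simp
      then have 3: "(2 * \<beta> * c1\<^sup>2 * k + 2 * \<beta> * c1) * s\<^sup>2 \<le> c * s\<^sup>2"
        by (intro mult_right_mono) auto
      have three: "c * s\<^sup>2 \<le> c\<^sup>2 * s\<^sup>2"
        using c(1) by (intro mult_right_mono) (auto simp: power2_eq_square)
      have "4 * \<beta> * c1\<^sup>2 * k + 2 * \<beta> * c1 \<le> 2 * c"
        using e mult_pos_pos[OF \<beta> c1] by linarith
      then have 2: "(4 * \<beta> * c1\<^sup>2 * k + 2 * \<beta> * c1) * (n * s) \<le> 2 * c * (n * s)"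
        using n s by (intro mult_right_mono) auto
      have 4: "0 \<le> (c * k)\<^sup>2 * n\<^sup>2 + 2 * c\<^sup>2 * k * (n * s)"
        using n s k by simp
      have "2 * \<beta> * (k * (c1 * (n + s))\<^sup>2 + s * (c1 * (n + s))) =
          2 * \<beta> * c1\<^sup>2 * k * n\<^sup>2 + (4 * \<beta> * c1\<^sup>2 * k + 2 * \<beta> * c1) * (n * s) + (2 * \<beta> * c1\<^sup>2 * k + 2 * \<beta> * c1) * s\<^sup>2"
        by (simp add: algebra_simps power2_eq_square)
      also have "\<dots> \<le> 2 * c * k * n\<^sup>2 + 2 * c * (n * s) + c\<^sup>2 * s\<^sup>2 + ((c * k)\<^sup>2 * n\<^sup>2 + 2 * c\<^sup>2 * k * (n * s))"
        using 1 2 3 three 4 by linarith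
      also have "\<dots> = ((1 + c * k) * n + c * s)\<^sup>2 - n\<^sup>2"
        by (simp add: algebra_simps power2_eq_square)
      finally show ?thesis by (simp add: k_def algebra_simps)
    qed
    finally have "(norm (x + \<tau> *\<^sub>R (\<Sum>i\<in>UNIV. b $ i *\<^sub>R V i)))\<^sup>2 \<le> ((1 + c * \<kappa> * \<tau>) * n + c * s)\<^sup>2"
      using algebraically_stable_update[OF assms(1) X] by (simp add: n_def)
    moreover have "0 \<le> (1 + c * \<kappa> * \<tau>) * n + c * s"
      using c(1) \<kappa> \<tau> n s by (intro add_nonneg_nonneg mult_nonneg_nonneg) auto
    ultimately show "norm (x + \<tau> *\<^sub>R (\<Sum>i\<in>UNIV. b $ i *\<^sub>R V i)) \<le> (1 + c * \<kappa> * \<tau>) * norm x + c * (\<tau> * \<rho>)"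
      unfolding n_def s_def by (rule power2_le_imp_le)
  qed
qed

section \<open>Functions of class \<open>C\<^sup>k\<close> on an interval\<close>

text \<open>The derivatives that \<open>Ck_on\<close> hides behind an existential quantifier, as needed in Taylor expansions.\<close>

definition Ck_family :: "nat \<Rightarrow> real set \<Rightarrow> (nat \<Rightarrow> real \<Rightarrow> 'e::real_normed_vector) \<Rightarrow> bool"
  where "Ck_family k I F \<longleftrightarrow>
    (\<forall>i<k. \<forall>t\<in>I. (F i has_vector_derivative F (Suc i) t) (at t within I)) \<and>
    (\<forall>i\<le>k. continuous_on I (F i))"

lemma Ck_on_iff_family: "Ck_on k I f \<longleftrightarrow> (\<exists>F. (\<forall>t\<in>I. F 0 t = f t) \<and> Ck_family k I F)"
  by (auto simp: Ck_on_def Ck_family_def)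

lemma Ck_family_Suc: "Ck_family (Suc k) I F \<Longrightarrow> Ck_family k I (\<lambda>i. F (Suc i))"
  by (auto simp: Ck_family_def)

lemma Ck_family_mono: "Ck_family k I F \<Longrightarrow> l \<le> k \<Longrightarrow> Ck_family l I F"
  by (auto simp: Ck_family_def)

lemma Ck_on_mono: "Ck_on k I f \<Longrightarrow> l \<le> k \<Longrightarrow> Ck_on l I f"
  unfolding Ck_on_iff_family using Ck_family_mono by blast

lemma Ck_on_0: "Ck_on 0 I f \<longleftrightarrow> continuous_on I f"
proof
  assume "Ck_on 0 I f"
  then obtain F where "\<And>t. t \<in> I \<Longrightarrow> F 0 t = f t" "continuous_on I (F (0::nat))"
    by (auto simp: Ck_on_def)
  then show "continuous_on I f"
    by (metis (mono_tags, lifting) continuous_on_cong)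
next
  assume "continuous_on I f"
  then show "Ck_on 0 I f"
    unfolding Ck_on_def by (intro exI[of _ "\<lambda>_. f"]) auto
qed

lemma Ck_on_Suc:
  "Ck_on (Suc k) I f \<longleftrightarrow>
    (\<exists>f'. (\<forall>t\<in>I. (f has_vector_derivative f' t) (at t within I)) \<and> Ck_on k I f')"
proof
  assume "Ck_on (Suc k) I f"
  then obtain F where F: "\<And>t. t \<in> I \<Longrightarrow> F 0 t = f t" "Ck_family (Suc k) I F"
    by (auto simp: Ck_on_iff_family)
  have "(f has_vector_derivative F 1 t) (at t within I)" if "t \<in> I" for t
  proof (rule has_vector_derivative_transform[OF that])
    show "(F 0 has_vector_derivative F 1 t) (at t within I)"
      using F(2) that by (auto simp: Ck_family_def)
  qed (simp add: F(1))
  moreover have "Ck_on k I (F 1)"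
    unfolding Ck_on_iff_family using Ck_family_Suc[OF F(2)] by (intro exI[of _ "\<lambda>i. F (Suc i)"]) auto
  ultimately show "\<exists>f'. (\<forall>t\<in>I. (f has_vector_derivative f' t) (at t within I)) \<and> Ck_on k I f'"
    by blast
next
  assume "\<exists>f'. (\<forall>t\<in>I. (f has_vector_derivative f' t) (at t within I)) \<and> Ck_on k I f'"
  then obtain f' G where f': "\<And>t. t \<in> I \<Longrightarrow> (f has_vector_derivative f' t) (at t within I)"
    and G: "\<And>t. t \<in> I \<Longrightarrow> G 0 t = f' t" "Ck_family k I G"
    by (auto simp: Ck_on_iff_family)
  define F where "F i = (case i of 0 \<Rightarrow> f | Suc l \<Rightarrow> G l)" for i
  have "continuous_on I f"
    using f' by (meson continuous_on_vector_derivative)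
  then have "Ck_family (Suc k) I F"
    using f' G unfolding Ck_family_def F_def
    by (auto simp: less_Suc_eq_0_disj le_Suc_eq split: nat.split)
  then show "Ck_on (Suc k) I f"
    unfolding Ck_on_iff_family by (intro exI[of _ F]) (auto simp: F_def)
qed

lemma Ck_on_imp_continuous_on: "Ck_on k I f \<Longrightarrow> continuous_on I f"
  using Ck_on_mono[of k I f 0] Ck_on_0 by blast

lemma Ck_on_SucE:
  assumes "Ck_on (Suc k) I f"
  obtains f' where "\<And>t. t \<in> I \<Longrightarrow> (f has_vector_derivative f' t) (at t within I)" "Ck_on k I f'"
  using assms Ck_on_Suc by blast

lemma Ck_on_SucI:
  "(\<And>t. t \<in> I \<Longrightarrow> (f has_vector_derivative f' t) (at t within I)) \<Longrightarrow> Ck_on k I f' \<Longrightarrow> Ck_on (Suc k) I f"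
  using Ck_on_Suc by blast

lemma Ck_on_add: "Ck_on k I f \<Longrightarrow> Ck_on k I g \<Longrightarrow> Ck_on k I (\<lambda>t. f t + g t)"
proof (induction k arbitrary: f g)
  case 0
  then show ?case by (simp add: Ck_on_0 continuous_on_add)
next
  case (Suc k)
  obtain f' where f': "\<And>t. t \<in> I \<Longrightarrow> (f has_vector_derivative f' t) (at t within I)" "Ck_on k I f'"
    using Suc.prems(1) by (elim Ck_on_SucE) blast
  obtain g' where g': "\<And>t. t \<in> I \<Longrightarrow> (g has_vector_derivative g' t) (at t within I)" "Ck_on k I g'"
    using Suc.prems(2) by (elim Ck_on_SucE) blast
  show ?case
    by (rule Ck_on_SucI[OF has_vector_derivative_add[OF f'(1) g'(1)] Suc.IH[OF f'(2) g'(2)]])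
qed

lemma Ck_on_const: "Ck_on k I (\<lambda>t. c)"
proof (induction k arbitrary: c)
  case 0
  then show ?case by (simp add: Ck_on_0)
next
  case (Suc k)
  show ?case by (rule Ck_on_SucI[OF has_vector_derivative_const Suc])
qed

lemma Ck_on_sum: "(\<And>i. i \<in> S \<Longrightarrow> Ck_on k I (f i)) \<Longrightarrow> Ck_on k I (\<lambda>t. \<Sum>i\<in>S. f i t)"
  by (induction S rule: infinite_finite_induct) (auto simp: Ck_on_const intro!: Ck_on_add)

lemma Ck_on_bounded_linear:
  assumes "bounded_linear L" shows "Ck_on k I f \<Longrightarrow> Ck_on k I (\<lambda>t. L (f t))"
proof (induction k arbitrary: f)
  case 0
  then show ?case by (simp add: Ck_on_0 bounded_linear.continuous_on[OF assms])
next
  case (Suc k)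
  obtain f' where f': "\<And>t. t \<in> I \<Longrightarrow> (f has_vector_derivative f' t) (at t within I)" "Ck_on k I f'"
    using Suc.prems by (elim Ck_on_SucE) blast
  show ?case
    by (rule Ck_on_SucI[OF bounded_linear.has_vector_derivative[OF assms f'(1)] Suc.IH[OF f'(2)]])
qed

lemma Ck_on_bilinear:
  assumes "bounded_bilinear h"
  shows "Ck_on k I f \<Longrightarrow> Ck_on k I g \<Longrightarrow> Ck_on k I (\<lambda>t. h (f t) (g t))"
proof (induction k arbitrary: f g)
  case 0
  then show ?case by (simp add: Ck_on_0 bounded_bilinear.continuous_on[OF assms])
next
  case (Suc k)
  obtain f' where f': "\<And>t. t \<in> I \<Longrightarrow> (f has_vector_derivative f' t) (at t within I)" "Ck_on k I f'"
    using Suc.prems(1) by (elim Ck_on_SucE) blast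
  obtain g' where g': "\<And>t. t \<in> I \<Longrightarrow> (g has_vector_derivative g' t) (at t within I)" "Ck_on k I g'"
    using Suc.prems(2) by (elim Ck_on_SucE) blast
  have "Ck_on k I f" "Ck_on k I g" using Suc.prems by (auto intro: Ck_on_mono[of "Suc k"])
  then show ?case
    by (intro Ck_on_SucI[OF bounded_bilinear.has_vector_derivative[OF assms f'(1) g'(1)]]
        Ck_on_add Suc.IH f'(2) g'(2))
qed

lemma Ck_family_bounded:
  assumes "Ck_family k {\<alpha>..\<beta>} F" "i \<le> k"
  obtains C where "C > 0" "\<And>t. t \<in> {\<alpha>..\<beta>} \<Longrightarrow> norm (F i t) \<le> C"
proof -
  have "bounded (F i ` {\<alpha>..\<beta>})"
    using assms by (intro compact_imp_bounded compact_continuous_image) (auto simp: Ck_family_def)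
  then show thesis using that unfolding bounded_pos by auto
qed

lemma vector_mean_value:
  fixes f :: "real \<Rightarrow> 'e::real_normed_vector"
  assumes "\<And>x. x \<in> closed_segment t s \<Longrightarrow> (f has_vector_derivative f' x) (at x within closed_segment t s)"
    and "\<And>x. x \<in> closed_segment t s \<Longrightarrow> norm (f' x) \<le> B"
  shows "norm (f s - f t) \<le> B * \<bar>s - t\<bar>"
proof -
  have "norm (f s - f t) \<le> B * norm (s - t)"
  proof (rule differentiable_bound[of "closed_segment t s" f "\<lambda>x h. h *\<^sub>R f' x"])
    show "onorm (\<lambda>h. h *\<^sub>R f' x) \<le> B" if "x \<in> closed_segment t s" for x
      using assms(2)[OF that] by (simp add: onorm_scaleR_left onorm_id)
  qed (use assms(1) in \<open>auto simp: has_vector_derivative_def\<close>)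
  then show ?thesis by simp
qed

text \<open>
  The remainder is estimated by induction on the order: its derivative is the remainder of the
  derivative, and it vanishes at the centre.
\<close>

lemma Ck_family_Taylor:
  fixes F :: "nat \<Rightarrow> real \<Rightarrow> 'e::real_normed_vector"
  assumes "Ck_family k {\<alpha>..\<beta>} F"
  shows "\<exists>C>0. \<forall>t\<in>{\<alpha>..\<beta>}. \<forall>s\<in>{\<alpha>..\<beta>}.
    norm (F 0 s - (\<Sum>l<k. ((s - t) ^ l / fact l) *\<^sub>R F l t)) \<le> C * \<bar>s - t\<bar> ^ k"
  using assms
proof (induction k arbitrary: F)
  case 0
  then show ?case by (auto elim!: Ck_family_bounded[of 0 _ _ _ 0])
next
  case (Suc k)
  obtain C where C: "C > 0" "\<And>t s. t \<in> {\<alpha>..\<beta>} \<Longrightarrow> s \<in> {\<alpha>..\<beta>} \<Longrightarrow>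
    norm (F 1 s - (\<Sum>l<k. ((s - t) ^ l / fact l) *\<^sub>R F (Suc l) t)) \<le> C * \<bar>s - t\<bar> ^ k"
    using Suc.IH[OF Ck_family_Suc[OF Suc.prems]] by auto
  have "norm (F 0 s - (\<Sum>l<Suc k. ((s - t) ^ l / fact l) *\<^sub>R F l t)) \<le> C * \<bar>s - t\<bar> ^ Suc k"
    if t: "t \<in> {\<alpha>..\<beta>}" and s: "s \<in> {\<alpha>..\<beta>}" for t s
  proof -
    define R where "R x = F 0 x - (\<Sum>l<Suc k. ((x - t) ^ l / fact l) *\<^sub>R F l t)" for x
    define R' where "R' x = F 1 x - (\<Sum>l<k. ((x - t) ^ l / fact l) *\<^sub>R F (Suc l) t)" for x
    have seg: "closed_segment t s \<subseteq> {\<alpha>..\<beta>}"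
      using t s by (auto simp: closed_segment_eq_real_ivl)
    have dR: "(R has_vector_derivative R' x) (at x within closed_segment t s)" if x: "x \<in> closed_segment t s" for x
    proof -
      have F0: "(F 0 has_vector_derivative F 1 x) (at x within closed_segment t s)"
        using Suc.prems seg x unfolding Ck_family_def
        by (metis One_nat_def has_vector_derivative_within_subset subsetD zero_less_Suc)
      have mono: "((\<lambda>x. ((x - t) ^ Suc l / fact (Suc l)) *\<^sub>R F (Suc l) t) has_vector_derivative
          ((x - t) ^ l / fact l) *\<^sub>R F (Suc l) t) (at x within closed_segment t s)" for l
      proof -
        have "((\<lambda>x. (x - t) ^ Suc l / fact (Suc l)) has_real_derivative (real (Suc l) * (x - t) ^ l) / fact (Suc l))
            (at x within closed_segment t s)"
          by (auto intro!: derivative_eq_intros simp del: fact_Suc power_Suc)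
        also have "(real (Suc l) * (x - t) ^ l) / fact (Suc l) = (x - t) ^ l / fact l"
          by (simp add: field_simps del: of_nat_Suc)
        finally have "((\<lambda>x. (x - t) ^ Suc l / fact (Suc l)) has_vector_derivative (x - t) ^ l / fact l)
            (at x within closed_segment t s)"
          by (simp add: has_real_derivative_iff_has_vector_derivative)
        from bounded_linear.has_vector_derivative[OF bounded_linear_scaleR_left this]
        show ?thesis .
      qed
      have "((\<lambda>x. F 0 x - (F 0 t + (\<Sum>l<k. ((x - t) ^ Suc l / fact (Suc l)) *\<^sub>R F (Suc l) t))) has_vector_derivative
          F 1 x - (0 + (\<Sum>l<k. ((x - t) ^ l / fact l) *\<^sub>R F (Suc l) t))) (at x within closed_segment t s)"
        by (intro has_vector_derivative_diff has_vector_derivative_add has_vector_derivative_sum F0 mono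
            has_vector_derivative_const)
      then show ?thesis
        unfolding R_def R'_def sum.lessThan_Suc_shift by simp
    qed
    have "norm (R s - R t) \<le> (C * \<bar>s - t\<bar> ^ k) * \<bar>s - t\<bar>"
    proof (rule vector_mean_value[OF dR])
      fix x assume x: "x \<in> closed_segment t s"
      have "norm (R' x) \<le> C * \<bar>x - t\<bar> ^ k"
        unfolding R'_def using C(2)[OF t, of x] x seg by auto
      also have "\<dots> \<le> C * \<bar>s - t\<bar> ^ k"
        using x C(1) by (intro mult_left_mono power_mono) (auto simp: closed_segment_eq_real_ivl split: if_splits)
      finally show "norm (R' x) \<le> C * \<bar>s - t\<bar> ^ k" .
    qed
    moreover have "R t = 0"
      unfolding R_def sum.lessThan_Suc_shift by simp
    ultimately show ?thesis by (simp add: R_def algebra_simps)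
  qed
  then show ?case using C(1) by blast
qed

section \<open>Smooth maps between normed spaces\<close>

lemma frechet_linear_slot:
  assumes "frechet_derivatives f F" "i < length hs"
  shows "linear (\<lambda>h. F y (hs[i := h]))"
  using assms by (auto simp: frechet_derivatives_def)

lemma frechet_linear_Cons:
  assumes "frechet_derivatives f F" shows "linear (\<lambda>h. F y (h # hs))"
  using frechet_linear_slot[OF assms, of 0 "0 # hs"] by simp

lemma frechet_linear_snoc:
  assumes "frechet_derivatives f F" shows "linear (\<lambda>h. F y (hs @ [h]))"
  using frechet_linear_slot[OF assms, of "length hs" "hs @ [0]"] by simp

lemma frechet_bound:
  assumes "frechet_derivatives f F"
  obtains K where "K > 0" "\<And>hs. length hs = n \<Longrightarrow> norm (F y hs) \<le> K * prod_list (map norm hs)"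
proof -
  obtain K where K: "\<And>hs. length hs = n \<Longrightarrow> norm (F y hs) \<le> K * prod_list (map norm hs)"
    using conjunct1[OF conjunct2[OF conjunct2[OF assms[unfolded frechet_derivatives_def]]]] by blast
  have "norm (F y hs) \<le> (\<bar>K\<bar> + 1) * prod_list (map norm hs)" if "length hs = n" for hs
  proof -
    have "0 \<le> prod_list (map norm hs)" by (auto intro!: prod_list_nonneg)
    then show ?thesis
      using K[OF that] mult_right_mono[of K "\<bar>K\<bar> + 1" "prod_list (map norm hs)"] by linarith
  qed
  then show thesis using that[of "\<bar>K\<bar> + 1"] by auto
qed

lemma prod_list_norm_nonneg: "0 \<le> prod_list (map norm hs)"
  by (auto intro!: prod_list_nonneg)

lemma frechet_bounded_linear_Cons:
  assumes "frechet_derivatives f F" shows "bounded_linear (\<lambda>h. F y (h # hs))"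
proof -
  interpret linear "\<lambda>h. F y (h # hs)" by (rule frechet_linear_Cons[OF assms])
  obtain K where K: "\<And>gs. length gs = Suc (length hs) \<Longrightarrow> norm (F y gs) \<le> K * prod_list (map norm gs)"
    using frechet_bound[OF assms] by metis
  show ?thesis
    by (rule bounded_linear_intro[of _ "K * prod_list (map norm hs)"])
      (use K[of "_ # hs"] in \<open>auto simp: add scale algebra_simps\<close>)
qed

lemma frechet_bounded_linear_snoc:
  assumes "frechet_derivatives f F" shows "bounded_linear (\<lambda>h. F y (hs @ [h]))"
proof -
  interpret linear "\<lambda>h. F y (hs @ [h])" by (rule frechet_linear_snoc[OF assms])
  obtain K where K: "\<And>gs. length gs = Suc (length hs) \<Longrightarrow> norm (F y gs) \<le> K * prod_list (map norm gs)"
    using frechet_bound[OF assms] by metis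
  show ?thesis
    by (rule bounded_linear_intro[of _ "K * prod_list (map norm hs)"])
      (use K[of "hs @ [_]"] in \<open>auto simp: add scale algebra_simps\<close>)
qed

lemma frechet_has_derivative:
  assumes "frechet_derivatives f F"
  shows "((\<lambda>y. F y hs) has_derivative (\<lambda>h. F y (h # hs))) (at y within S)"
proof -
  have "((\<lambda>y. F y hs) has_derivative (\<lambda>h. F y (h # hs))) (at y)"
    unfolding has_derivative_at_alt
  proof (intro conjI allI impI)
    show "bounded_linear (\<lambda>h. F y (h # hs))" by (rule frechet_bounded_linear_Cons[OF assms])
    fix e :: real assume e: "e > 0"
    define P where "P = prod_list (map norm hs)"
    have P: "P \<ge> 0" unfolding P_def by (rule prod_list_norm_nonneg)
    obtain d where d: "d > 0" "\<And>h. norm h < d \<Longrightarrow> norm (F (y + h) hs - F y hs - F y (h # hs)) \<le> e / (P + 1) * norm h * P"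
      using assms e P unfolding frechet_derivatives_def P_def
      by (metis add_nonneg_pos divide_pos_pos zero_less_one)
    have le: "e / (P + 1) * n * P \<le> e * n" if "n \<ge> 0" for n
    proof -
      have "P / (P + 1) \<le> 1" using P by simp
      then have "(e * n) * (P / (P + 1)) \<le> (e * n) * 1"
        using e that by (intro mult_left_mono) auto
      then show ?thesis by (simp add: field_simps)
    qed
    show "\<exists>d>0. \<forall>z. norm (z - y) < d \<longrightarrow> norm (F z hs - F y hs - F y ((z - y) # hs)) \<le> e * norm (z - y)"
    proof (intro exI[of _ d] conjI allI impI d(1))
      fix z assume "norm (z - y) < d"
      then have "norm (F (y + (z - y)) hs - F y hs - F y ((z - y) # hs)) \<le> e / (P + 1) * norm (z - y) * P"
        by (rule d(2))
      also have "\<dots> \<le> e * norm (z - y)" by (rule le) simp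
      finally show "norm (F z hs - F y hs - F y ((z - y) # hs)) \<le> e * norm (z - y)" by simp
    qed
  qed
  then show ?thesis by (rule has_derivative_at_withinI)
qed

lemma tendsto_prod_list_norm:
  assumes "length gs = length l" "\<And>i. i < length l \<Longrightarrow> ((gs ! i) \<longlongrightarrow> l ! i) \<F>"
  shows "((\<lambda>t. prod_list (map (\<lambda>g. norm (g t)) gs)) \<longlongrightarrow> prod_list (map norm l)) \<F>"
  using assms
proof (induction gs l rule: list_induct2)
  case Nil
  then show ?case by simp
next
  case (Cons g gs x xs)
  have "(g \<longlongrightarrow> x) \<F>" using Cons.prems[of 0] by simp
  moreover have "((\<lambda>t. prod_list (map (\<lambda>g. norm (g t)) gs)) \<longlongrightarrow> prod_list (map norm xs)) \<F>"
    by (rule Cons.IH) (use Cons.prems[of "Suc _"] in auto)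
  ultimately show ?case by (auto intro!: tendsto_intros)
qed

text \<open>
  Derivatives of all orders depend jointly continuously on the base point and on the directions:
  change the base point first, and then one direction after the other.
\<close>

lemma frechet_tendsto:
  fixes F :: "'y::real_normed_vector \<Rightarrow> 'y list \<Rightarrow> 'z::real_normed_vector"
  assumes F: "frechet_derivatives f F" and u: "(u \<longlongrightarrow> y) \<F>"
    and len: "length gs = length l" and g: "\<And>i. i < length l \<Longrightarrow> ((gs ! i) \<longlongrightarrow> l ! i) \<F>"
  shows "((\<lambda>t. F (u t) (map (\<lambda>g. g t) gs)) \<longlongrightarrow> F y l) \<F>"
proof -
  define n where "n = length l"
  define G where "G t = map (\<lambda>g. g t) gs" for t
  have lenG: "length (G t) = n" for t by (simp add: G_def len n_def)
  have prodG: "((\<lambda>t. prod_list (map norm (G t))) \<longlongrightarrow> prod_list (map norm l)) \<F>"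
    using tendsto_prod_list_norm[OF len g] by (simp add: G_def o_def)
  obtain K where K: "K > 0" "\<And>hs. length hs = n \<Longrightarrow> norm (F y hs) \<le> K * prod_list (map norm hs)"
    using frechet_bound[OF F] by metis
  have "((\<lambda>t. F (u t) (G t) - F y (G t)) \<longlongrightarrow> 0) \<F>"
  proof -
    obtain K1 where K1: "K1 > 0" "\<And>hs. length hs = Suc n \<Longrightarrow> norm (F y hs) \<le> K1 * prod_list (map norm hs)"
      using frechet_bound[OF F] by metis
    obtain d where d: "d > 0" "\<And>h hs. norm h < d \<Longrightarrow> length hs = n \<Longrightarrow>
        norm (F (y + h) hs - F y hs - F y (h # hs)) \<le> 1 * norm h * prod_list (map norm hs)"
      using F unfolding frechet_derivatives_def by (meson zero_less_one)
    have bound: "norm (F z hs - F y hs) \<le> (K1 + 1) * norm (z - y) * prod_list (map norm hs)"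
      if "norm (z - y) < d" "length hs = n" for z hs
    proof -
      have "norm (F z hs - F y hs - F y ((z - y) # hs)) \<le> 1 * norm (z - y) * prod_list (map norm hs)"
        using d(2)[OF that] by simp
      moreover have "norm (F y ((z - y) # hs)) \<le> K1 * (norm (z - y) * prod_list (map norm hs))"
        using K1(2)[of "(z - y) # hs"] that by simp
      moreover have "norm (F z hs - F y hs) \<le> norm (F z hs - F y hs - F y ((z - y) # hs)) + norm (F y ((z - y) # hs))"
        using norm_triangle_ineq[of "F z hs - F y hs - F y ((z - y) # hs)" "F y ((z - y) # hs)"] by simp
      ultimately show ?thesis by (simp add: algebra_simps)
    qed
    have "\<forall>\<^sub>F t in \<F>. norm (u t - y) < d"
      using u d(1) unfolding tendsto_iff dist_norm by blast
    then have ev: "\<forall>\<^sub>F t in \<F>. norm (F (u t) (G t) - F y (G t)) \<le> (K1 + 1) * norm (u t - y) * prod_list (map norm (G t))"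
      by eventually_elim (rule bound, auto simp: lenG)
    have "((\<lambda>t. (K1 + 1) * norm (u t - y) * prod_list (map norm (G t))) \<longlongrightarrow> (K1 + 1) * norm (y - y) * prod_list (map norm l)) \<F>"
      by (intro tendsto_intros u prodG)
    then have lim: "((\<lambda>t. (K1 + 1) * norm (u t - y) * prod_list (map norm (G t))) \<longlongrightarrow> 0) \<F>"
      by simp
    show ?thesis by (rule Lim_null_comparison[OF ev lim])
  qed
  moreover have "((\<lambda>t. F y (take k (G t) @ drop k l)) \<longlongrightarrow> F y l) \<F>" if "k \<le> n" for k
    using that
  proof (induction k)
    case 0
    then show ?case by simp
  next
    case (Suc k)
    then have k: "k < n" by simp
    define m where "m t = take k (G t) @ 0 # drop (Suc k) l" for t
    have lm: "k < length (m t)" for t using k by (simp add: m_def lenG)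
    have len_m: "length ((m t)[k := h]) = n" for t h
      using k by (simp add: m_def lenG n_def)
    interpret L: linear "\<lambda>h. F y ((m t)[k := h])" for t
      by (rule frechet_linear_slot[OF F lm])
    have upd: "(m t)[k := h] = take k (G t) @ h # drop (Suc k) l" for t h
      using k by (simp add: m_def lenG list_update_append min_def)
    have e1: "take (Suc k) (G t) @ drop (Suc k) l = (m t)[k := (gs ! k) t]" for t
      unfolding upd using k by (simp add: take_Suc_conv_app_nth lenG G_def len n_def)
    have e2: "take k (G t) @ drop k l = (m t)[k := l ! k]" for t
      unfolding upd using k by (simp add: n_def Cons_nth_drop_Suc)
    define P where "P t = prod_list (map norm (take k (G t)))" for t
    have P: "(P \<longlongrightarrow> prod_list (map norm (take k l))) \<F>"
      unfolding P_def G_def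
      using tendsto_prod_list_norm[of "take k gs" "take k l" \<F>] g len k
      by (simp add: take_map o_def n_def)
    have "((\<lambda>t. F y (take (Suc k) (G t) @ drop (Suc k) l) - F y (take k (G t) @ drop k l)) \<longlongrightarrow> 0) \<F>"
    proof (rule Lim_null_comparison)
      define Q where "Q = prod_list (map norm (drop (Suc k) l))"
      have "norm (F y (take (Suc k) (G t) @ drop (Suc k) l) - F y (take k (G t) @ drop k l))
          \<le> K * (P t * (norm ((gs ! k) t - l ! k) * Q))" for t
      proof -
        have "F y (take (Suc k) (G t) @ drop (Suc k) l) - F y (take k (G t) @ drop k l)
            = F y ((m t)[k := (gs ! k) t - l ! k])"
          unfolding e1 e2 by (simp add: L.diff)
        also have "norm \<dots> \<le> K * prod_list (map norm ((m t)[k := (gs ! k) t - l ! k]))"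
          by (rule K(2)) (rule len_m)
        also have "prod_list (map norm ((m t)[k := (gs ! k) t - l ! k])) = P t * (norm ((gs ! k) t - l ! k) * Q)"
          unfolding upd by (simp add: P_def Q_def)
        finally show ?thesis .
      qed
      then show "\<forall>\<^sub>F t in \<F>. norm (F y (take (Suc k) (G t) @ drop (Suc k) l) - F y (take k (G t) @ drop k l))
          \<le> K * (P t * (norm ((gs ! k) t - l ! k) * Q))"
        by simp
      have "((\<lambda>t. K * (P t * (norm ((gs ! k) t - l ! k) * Q))) \<longlongrightarrow> K * (prod_list (map norm (take k l)) * (norm (l ! k - l ! k) * Q))) \<F>"
        using k g[of k] by (intro tendsto_intros P) (auto simp: n_def)
      then show "((\<lambda>t. K * (P t * (norm ((gs ! k) t - l ! k) * Q))) \<longlongrightarrow> 0) \<F>" by simp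
    qed
    from tendsto_add[OF this Suc.IH] k show ?case by simp
  qed
  from this[of n] have "((\<lambda>t. F y (G t)) \<longlongrightarrow> F y l) \<F>"
    by (simp add: lenG n_def)
  ultimately have "((\<lambda>t. (F (u t) (G t) - F y (G t)) + F y (G t)) \<longlongrightarrow> 0 + F y l) \<F>"
    by (rule tendsto_add)
  then show ?thesis by (simp add: G_def)
qed

lemma has_vector_derivative_iff_quotient:
  "(f has_vector_derivative D) (at t within I) \<longleftrightarrow> ((\<lambda>s. (f s - f t) /\<^sub>R (s - t)) \<longlongrightarrow> D) (at t within I)"
proof -
  have "((\<lambda>s. (f s - f t) /\<^sub>R (s - t)) \<longlongrightarrow> D) (at t within I) \<longleftrightarrow>
      ((\<lambda>s. norm ((f s - f t) /\<^sub>R (s - t) - D)) \<longlongrightarrow> 0) (at t within I)"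
    by (simp only: tendsto_norm_zero_iff LIM_zero_iff)
  also have "\<dots> \<longleftrightarrow> ((\<lambda>s. norm (f s - f t - (s - t) *\<^sub>R D) / norm (s - t)) \<longlongrightarrow> 0) (at t within I)"
  proof (rule filterlim_cong[OF refl refl])
    have "norm ((f s - f t) /\<^sub>R (s - t) - D) = norm (f s - f t - (s - t) *\<^sub>R D) / norm (s - t)" if "s \<noteq> t" for s
    proof -
      have "(f s - f t) /\<^sub>R (s - t) - D = (f s - f t - (s - t) *\<^sub>R D) /\<^sub>R (s - t)"
        using that by (simp add: scaleR_diff_right)
      then show ?thesis by (simp add: divide_inverse mult.commute)
    qed
    then show "\<forall>\<^sub>F s in at t within I. norm ((f s - f t) /\<^sub>R (s - t) - D) = norm (f s - f t - (s - t) *\<^sub>R D) / norm (s - t)"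
      by (auto simp: eventually_at_filter)
  qed
  finally show ?thesis
    by (simp add: has_vector_derivative_def has_derivative_iff_norm bounded_linear_scaleR_left)
qed

text \<open>
  The chain and product rules in one: the curve moves the base point, and the directions move along
  curves of their own, which are changed one after the other.
\<close>

lemma frechet_has_vector_derivative:
  fixes F :: "'y::real_normed_vector \<Rightarrow> 'y list \<Rightarrow> 'z::real_normed_vector"
  assumes F: "frechet_derivatives f F" and u: "(u has_vector_derivative u') (at t0 within I)"
    and len: "length hs' = length hs"
    and h: "\<And>i. i < length hs \<Longrightarrow> ((hs ! i) has_vector_derivative hs' ! i) (at t0 within I)"
  shows "((\<lambda>t. F (u t) (map (\<lambda>h. h t) hs)) has_vector_derivative
    (F (u t0) (u' # map (\<lambda>h. h t0) hs) + (\<Sum>i<length hs. F (u t0) ((map (\<lambda>h. h t0) hs)[i := hs' ! i]))))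
    (at t0 within I)"
proof -
  define n where "n = length hs"
  define H where "H t = map (\<lambda>h. h t) hs" for t
  have lenH: "length (H t) = n" for t by (simp add: H_def n_def)
  have uc: "(u \<longlongrightarrow> u t0) (at t0 within I)"
    using has_vector_derivative_continuous[OF u] by (simp add: continuous_within)
  have hc: "((hs ! i) \<longlongrightarrow> (hs ! i) t0) (at t0 within I)" if "i < n" for i
    using has_vector_derivative_continuous[OF h[of i]] that by (simp add: continuous_within n_def)
  have "((\<lambda>t. F (u t) (take k (H t) @ drop k (H t0))) has_vector_derivative
    (F (u t0) (u' # H t0) + (\<Sum>i<k. F (u t0) ((H t0)[i := hs' ! i])))) (at t0 within I)" if "k \<le> n" for k
    using that
  proof (induction k)
    case 0
    have "((\<lambda>t. F (u t) (H t0)) has_derivative (\<lambda>x. F (u t0) ((x *\<^sub>R u') # H t0))) (at t0 within I)"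
      using has_derivative_compose[OF u[unfolded has_vector_derivative_def] frechet_has_derivative[OF F, of "H t0"]] .
    then show ?case
      by (simp add: has_vector_derivative_def linear_scale[OF frechet_linear_Cons[OF F]])
  next
    case (Suc k)
    then have k: "k < n" by simp
    define m where "m t = take k (H t) @ 0 # drop (Suc k) (H t0)" for t
    have lm: "k < length (m t)" for t using k by (simp add: m_def lenH)
    have upd: "(m t)[k := h] = take k (H t) @ h # drop (Suc k) (H t0)" for t h
      using k by (simp add: m_def lenH list_update_append min_def)
    interpret L: linear "\<lambda>h. F y ((m t)[k := h])" for y t
      by (rule frechet_linear_slot[OF F lm])
    have e1: "take (Suc k) (H t) @ drop (Suc k) (H t0) = (m t)[k := (hs ! k) t]" for t
      unfolding upd using k by (simp add: take_Suc_conv_app_nth lenH H_def n_def)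
    have e2: "take k (H t) @ drop k (H t0) = (m t)[k := (hs ! k) t0]" for t
    proof -
      have "drop k (H t0) = (hs ! k) t0 # drop (Suc k) (H t0)"
        using k by (simp add: lenH H_def n_def flip: Cons_nth_drop_Suc)
      then show ?thesis unfolding upd by simp
    qed
    have e3: "(m t0)[k := h] = (H t0)[k := h]" for h
      unfolding upd using k by (simp add: upd_conv_take_nth_drop lenH)
    define \<Delta> where "\<Delta> t = F (u t) ((m t)[k := (hs ! k) t - (hs ! k) t0])" for t
    have "(\<Delta> has_vector_derivative F (u t0) ((H t0)[k := hs' ! k])) (at t0 within I)"
      unfolding has_vector_derivative_iff_quotient
    proof -
      define gs where "gs = take k hs @ (\<lambda>t. ((hs ! k) t - (hs ! k) t0) /\<^sub>R (t - t0)) # map (\<lambda>h t. h t0) (drop (Suc k) hs)"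
      define l where "l = (H t0)[k := hs' ! k]"
      have len_gs: "length gs = length l" using k by (simp add: gs_def l_def lenH n_def)
      have ql: "(\<Delta> t - \<Delta> t0) /\<^sub>R (t - t0) = F (u t) (map (\<lambda>g. g t) gs)" for t
      proof -
        have "map (\<lambda>g. g t) gs = (m t)[k := ((hs ! k) t - (hs ! k) t0) /\<^sub>R (t - t0)]"
          unfolding upd by (simp add: gs_def H_def take_map drop_map)
        moreover have "\<Delta> t0 = 0" by (simp add: \<Delta>_def L.zero)
        ultimately show ?thesis by (simp add: \<Delta>_def L.scale)
      qed
      have "((\<lambda>t. F (u t) (map (\<lambda>g. g t) gs)) \<longlongrightarrow> F (u t0) l) (at t0 within I)"
      proof (rule frechet_tendsto[OF F uc len_gs])
        fix i assume "i < length l"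
        then have i: "i < n" by (simp add: l_def lenH)
        consider "i < k" | "i = k" | "i > k" by linarith
        then show "((gs ! i) \<longlongrightarrow> l ! i) (at t0 within I)"
        proof cases
          case 1
          then have "gs ! i = hs ! i" "l ! i = (hs ! i) t0"
            using k by (auto simp: gs_def l_def nth_append n_def H_def)
          then show ?thesis using hc[OF i] by simp
        next
          case 2
          then have "gs ! i = (\<lambda>t. ((hs ! k) t - (hs ! k) t0) /\<^sub>R (t - t0))" "l ! i = hs' ! k"
            using k by (auto simp: gs_def l_def nth_append n_def H_def)
          then show ?thesis
            using h[of k] k by (simp add: has_vector_derivative_iff_quotient n_def)
        next
          case 3
          then have "gs ! i = (\<lambda>t. (hs ! i) t0)" "l ! i = (hs ! i) t0"
            using k i by (auto simp: gs_def l_def nth_append n_def H_def nth_Cons')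
          then show ?thesis by simp
        qed
      qed
      then show "((\<lambda>s. (\<Delta> s - \<Delta> t0) /\<^sub>R (s - t0)) \<longlongrightarrow> F (u t0) ((H t0)[k := hs' ! k])) (at t0 within I)"
        unfolding ql l_def .
    qed
    from has_vector_derivative_add[OF Suc.IH this] k
    have "((\<lambda>t. F (u t) (take k (H t) @ drop k (H t0)) + \<Delta> t) has_vector_derivative
        (F (u t0) (u' # H t0) + (\<Sum>i<k. F (u t0) ((H t0)[i := hs' ! i])) + F (u t0) ((H t0)[k := hs' ! k])))
        (at t0 within I)"
      by simp
    moreover have "F (u t) (take k (H t) @ drop k (H t0)) + \<Delta> t = F (u t) (take (Suc k) (H t) @ drop (Suc k) (H t0))" for t
      unfolding e1 e2 \<Delta>_def by (simp add: L.diff)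
    ultimately show ?case by (simp add: add.assoc)
  qed
  from this[of n] show ?thesis
    by (simp add: lenH) (simp add: H_def n_def)
qed

lemma frechet_Ck_on:
  fixes F :: "'y::real_normed_vector \<Rightarrow> 'y list \<Rightarrow> 'z::real_normed_vector"
  assumes F: "frechet_derivatives f F"
  shows "Ck_on k I u \<Longrightarrow> (\<And>h. h \<in> set hs \<Longrightarrow> Ck_on k I h) \<Longrightarrow> Ck_on k I (\<lambda>t. F (u t) (map (\<lambda>h. h t) hs))"
proof (induction k arbitrary: hs)
  case 0
  show ?case
    unfolding Ck_on_0 continuous_on_def
  proof
    fix t assume t: "t \<in> I"
    show "((\<lambda>t. F (u t) (map (\<lambda>h. h t) hs)) \<longlongrightarrow> F (u t) (map (\<lambda>h. h t) hs)) (at t within I)"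
      by (rule frechet_tendsto[OF F]) (use 0 t in \<open>auto simp: Ck_on_0 continuous_on_def\<close>)
  qed
next
  case (Suc k)
  obtain u' where u': "\<And>t. t \<in> I \<Longrightarrow> (u has_vector_derivative u' t) (at t within I)" "Ck_on k I u'"
    using Suc.prems(1) by (elim Ck_on_SucE) blast
  have "\<forall>h. \<exists>h'. h \<in> set hs \<longrightarrow> (\<forall>t\<in>I. (h has_vector_derivative h' t) (at t within I)) \<and> Ck_on k I h'"
    using Suc.prems(2) unfolding Ck_on_Suc by blast
  then obtain d where d: "\<And>h t. h \<in> set hs \<Longrightarrow> t \<in> I \<Longrightarrow> (h has_vector_derivative d h t) (at t within I)"
    "\<And>h. h \<in> set hs \<Longrightarrow> Ck_on k I (d h)"
    by metis
  have low: "Ck_on k I u" "\<And>h. h \<in> set hs \<Longrightarrow> Ck_on k I h"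
    using Suc.prems Ck_on_mono[of "Suc k" I _ k] by auto
  define f' where "f' t = F (u t) (map (\<lambda>h. h t) (u' # hs)) + (\<Sum>i<length hs. F (u t) (map (\<lambda>h. h t) (hs[i := d (hs ! i)])))" for t
  show ?case
  proof (rule Ck_on_SucI[of _ _ f'])
    show "((\<lambda>t. F (u t) (map (\<lambda>h. h t) hs)) has_vector_derivative f' t) (at t within I)" if t: "t \<in> I" for t
      using frechet_has_vector_derivative[OF F u'(1)[OF t], of "map (\<lambda>h. d h t) hs" hs] d(1)[OF nth_mem t]
      by (simp add: f'_def map_update)
    have "h \<in> set (u' # hs) \<Longrightarrow> Ck_on k I h" for h using u' low by auto
    moreover have "h \<in> set (hs[i := d (hs ! i)]) \<Longrightarrow> Ck_on k I h" if "i < length hs" for h i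
      using set_update_subset_insert[of hs i "d (hs ! i)"] low d(2)[of "hs ! i"] that by auto
    ultimately show "Ck_on k I f'"
      unfolding f'_def by (intro Ck_on_add Ck_on_sum Suc.IH low(1)) auto
  qed
qed

lemma smooth_compose_Ck_on:
  assumes "smooth_bounded_on_balls f" "Ck_on k I u"
  shows "Ck_on k I (\<lambda>t. f (u t))"
proof -
  obtain F where F: "frechet_derivatives f F"
    using assms(1) by (auto simp: smooth_bounded_on_balls_def)
  then have "F y [] = f y" for y by (simp add: frechet_derivatives_def)
  then show ?thesis using frechet_Ck_on[OF F assms(2), of "[]"] by simp
qed

text \<open>
  The derivative of a smooth map is again smooth as a map into the space of bounded linear maps: its
  derivatives are those of the given map with the last direction left open. Hence bounds and Lipschitz
  estimates for smooth maps also apply to their derivatives.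
\<close>

lemma smooth_bounded_derivative:
  fixes f :: "'y::real_normed_vector \<Rightarrow> 'z::real_normed_vector"
  assumes "smooth_bounded_on_balls f"
  obtains f1 :: "'y \<Rightarrow> 'y \<Rightarrow>\<^sub>L 'z" where "smooth_bounded_on_balls f1"
    "\<And>y S. (f has_derivative blinfun_apply (f1 y)) (at y within S)"
proof -
  obtain F where F: "frechet_derivatives f F"
    and bd: "\<And>R n. R > 0 \<Longrightarrow> \<exists>K. \<forall>y hs. norm y \<le> R \<longrightarrow> length hs = n \<longrightarrow> norm (F y hs) \<le> K * prod_list (map norm hs)"
    using assms by (auto simp: smooth_bounded_on_balls_def)
  define F1 where "F1 y hs = Blinfun (\<lambda>h. F y (hs @ [h]))" for y hs
  have F1: "blinfun_apply (F1 y hs) h = F y (hs @ [h])" for y hs h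
    unfolding F1_def by (simp add: bounded_linear_Blinfun_apply frechet_bounded_linear_snoc[OF F])
  have norm_F1: "norm (F1 y hs) \<le> \<bar>K\<bar> * prod_list (map norm hs)"
    if "\<And>gs. length gs = Suc (length hs) \<Longrightarrow> norm (F y gs) \<le> K * prod_list (map norm gs)" for y hs K
  proof (rule norm_blinfun_bound)
    show "0 \<le> \<bar>K\<bar> * prod_list (map norm hs)" by (simp add: prod_list_norm_nonneg)
    fix h
    have "norm (F y (hs @ [h])) \<le> K * (prod_list (map norm hs) * norm h)" using that[of "hs @ [h]"] by simp
    also have "\<dots> \<le> \<bar>K\<bar> * (prod_list (map norm hs) * norm h)"
      by (intro mult_right_mono mult_nonneg_nonneg prod_list_norm_nonneg) auto
    finally show "norm (blinfun_apply (F1 y hs) h) \<le> \<bar>K\<bar> * prod_list (map norm hs) * norm h"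
      by (simp add: F1 mult.assoc)
  qed
  have "frechet_derivatives (\<lambda>y. F1 y []) F1"
    unfolding frechet_derivatives_def
  proof (intro conjI allI impI)
    fix y hs i assume i: "i < length (hs :: 'y list)"
    have upd: "hs[i := h] @ [g] = (hs @ [g])[i := h]" for h g
      using i by (simp add: list_update_append1)
    interpret L: linear "\<lambda>h. F y ((hs @ [g])[i := h])" for g
      by (rule frechet_linear_slot[OF F]) (use i in simp)
    show "linear (\<lambda>h. F1 y (hs[i := h]))"
      by (rule linearI; rule blinfun_eqI)
        (simp_all add: F1 upd L.add L.scale blinfun.add_left blinfun.scaleR_left)
  next
    fix y n
    obtain K where "\<And>gs. length gs = Suc n \<Longrightarrow> norm (F y gs) \<le> K * prod_list (map norm gs)"
      using frechet_bound[OF F] by metis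
    then show "\<exists>K. \<forall>hs. length hs = n \<longrightarrow> norm (F1 y hs) \<le> K * prod_list (map norm hs)"
      using norm_F1 by blast
  next
    fix y :: 'y and n :: nat and e :: real assume e: "e > 0"
    obtain d where d: "d > 0" "\<And>h gs. norm h < d \<Longrightarrow> length gs = Suc n \<Longrightarrow>
        norm (F (y + h) gs - F y gs - F y (h # gs)) \<le> e * norm h * prod_list (map norm gs)"
      using F e unfolding frechet_derivatives_def by meson
    show "\<exists>d>0. \<forall>h. norm h < d \<longrightarrow> (\<forall>hs. length hs = n \<longrightarrow>
        norm (F1 (y + h) hs - F1 y hs - F1 y (h # hs)) \<le> e * norm h * prod_list (map norm hs))"
    proof (intro exI[of _ d] conjI allI impI d(1))
      fix h :: 'y and hs :: "'y list" assume h: "norm h < d" "length hs = n"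
      show "norm (F1 (y + h) hs - F1 y hs - F1 y (h # hs)) \<le> e * norm h * prod_list (map norm hs)"
      proof (rule norm_blinfun_bound)
        show "0 \<le> e * norm h * prod_list (map norm hs)" using e by (simp add: prod_list_norm_nonneg)
        fix g
        show "norm (blinfun_apply (F1 (y + h) hs - F1 y hs - F1 y (h # hs)) g) \<le> e * norm h * prod_list (map norm hs) * norm g"
          using d(2)[OF h(1), of "hs @ [g]"] h(2) by (simp add: blinfun.diff_left F1 mult.assoc)
      qed
    qed
  qed simp
  moreover have "\<exists>K. \<forall>y hs. norm y \<le> R \<longrightarrow> length hs = n \<longrightarrow> norm (F1 y hs) \<le> K * prod_list (map norm hs)"
    if R: "R > 0" for R n
  proof -
    obtain K where "\<And>y gs. norm y \<le> R \<Longrightarrow> length gs = Suc n \<Longrightarrow> norm (F y gs) \<le> K * prod_list (map norm gs)"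
      using bd[OF R, of "Suc n"] by blast
    then show ?thesis by (intro exI[of _ "\<bar>K\<bar>"]) (auto intro!: norm_F1)
  qed
  ultimately have "smooth_bounded_on_balls (\<lambda>y. F1 y [])"
    unfolding smooth_bounded_on_balls_def by blast
  moreover have "(f has_derivative blinfun_apply (F1 y [])) (at y within S)" for y S
  proof -
    have "F y [] = f y" for y using F by (simp add: frechet_derivatives_def)
    then show ?thesis using frechet_has_derivative[OF F, of "[]"] by (simp add: F1[abs_def])
  qed
  ultimately show thesis by (rule that)
qed

lemma smooth_bounded_bound:
  assumes "smooth_bounded_on_balls f" "R > 0"
  obtains K where "K > 0" "\<And>y. norm y \<le> R \<Longrightarrow> norm (f y) \<le> K"
proof -
  obtain F where F: "frechet_derivatives f F"
    and bd: "\<And>n. \<exists>K. \<forall>y hs. norm y \<le> R \<longrightarrow> length hs = n \<longrightarrow> norm (F y hs) \<le> K * prod_list (map norm hs)"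
    using assms by (auto simp: smooth_bounded_on_balls_def)
  obtain K where K: "\<forall>y hs. norm y \<le> R \<longrightarrow> length hs = 0 \<longrightarrow> norm (F y hs) \<le> K * prod_list (map norm hs)"
    using bd[of 0] by blast
  have "norm (f y) \<le> \<bar>K\<bar> + 1" if "norm y \<le> R" for y
    using K[rule_format, of y "[]"] that F by (simp add: frechet_derivatives_def)
  then show thesis using that[of "\<bar>K\<bar> + 1"] by auto
qed

lemma smooth_bounded_Lipschitz:
  fixes f :: "'y::real_normed_vector \<Rightarrow> 'z::real_normed_vector"
  assumes "smooth_bounded_on_balls f" "R > 0"
  obtains L where "L > 0" "\<And>y z. norm y \<le> R \<Longrightarrow> norm z \<le> R \<Longrightarrow> norm (f y - f z) \<le> L * norm (y - z)"
proof -
  obtain f1 :: "'y \<Rightarrow> 'y \<Rightarrow>\<^sub>L 'z" where f1: "smooth_bounded_on_balls f1" "\<And>y S. (f has_derivative blinfun_apply (f1 y)) (at y within S)"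
    using smooth_bounded_derivative[OF assms(1)] by blast
  obtain L where L: "L > 0" "\<And>y. norm y \<le> R \<Longrightarrow> norm (f1 y) \<le> L"
    using smooth_bounded_bound[OF f1(1) assms(2)] by blast
  have "norm (f y - f z) \<le> L * norm (y - z)" if "norm y \<le> R" "norm z \<le> R" for y z
    by (rule differentiable_bound[of "cball 0 R" f "\<lambda>y. blinfun_apply (f1 y)"])
      (use that L f1(2) in \<open>auto simp: norm_blinfun.rep_eq[symmetric]\<close>)
  then show thesis using that L(1) by blast
qed

lemma smooth_bounded_quadratic:
  fixes f :: "'y::real_normed_vector \<Rightarrow> 'z::real_normed_vector"
  assumes "smooth_bounded_on_balls f1" "\<And>y S. (f has_derivative blinfun_apply (f1 y)) (at y within S)" "R > 0"
  obtains L where "L > 0" "\<And>y h. norm y \<le> R \<Longrightarrow> norm (y + h) \<le> R \<Longrightarrow>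
    norm (f (y + h) - f y - blinfun_apply (f1 y) h) \<le> L * (norm h)\<^sup>2"
proof -
  obtain L where L: "L > 0" "\<And>y z. norm y \<le> R \<Longrightarrow> norm z \<le> R \<Longrightarrow> norm (f1 y - f1 z) \<le> L * norm (y - z)"
    using smooth_bounded_Lipschitz[OF assms(1,3)] by blast
  have "norm (f (y + h) - f y - blinfun_apply (f1 y) h) \<le> L * (norm h)\<^sup>2"
    if y: "norm y \<le> R" and yh: "norm (y + h) \<le> R" for y h
  proof -
    have "norm (f (y + h) - f y - blinfun_apply (f1 y) (y + h - y)) \<le> norm (y + h - y) * (L * norm h)"
    proof (rule differentiable_bound_linearization[where S = "closed_segment y (y + h)"])
      fix x assume x: "x \<in> closed_segment y (y + h)"
      then obtain s where s: "0 \<le> s" "s \<le> 1" "x = y + s *\<^sub>R h"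
        by (auto simp: in_segment algebra_simps)
      have "closed_segment y (y + h) \<subseteq> cball 0 R"
        using y yh by (intro closed_segment_subset) auto
      then have "norm (f1 x - f1 y) \<le> L * norm (x - y)" using L(2)[of x y] x y by auto
      also have "\<dots> \<le> L * norm h"
        using L(1) s by (intro mult_left_mono) (auto simp: mult_left_le_one_le)
      finally show "onorm (blinfun_apply (f1 x) - blinfun_apply (f1 y)) \<le> L * norm h"
        by (simp add: norm_blinfun.rep_eq minus_blinfun.rep_eq fun_diff_def)
    qed (auto simp: in_segment algebra_simps assms(2) intro!: exI)
    then show ?thesis by (simp add: power2_eq_square mult_ac)
  qed
  then show thesis using that L(1) by blast
qed

lemma smooth_bounded_linear:
  assumes "smooth_bounded_on_balls f" and L: "bounded_linear L"
  shows "smooth_bounded_on_balls (\<lambda>y. L (f y))"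
proof -
  interpret L: bounded_linear L by (rule L)
  obtain K where K: "K > 0" "\<And>z. norm (L z) \<le> K * norm z"
    using L.pos_bounded by (auto simp: mult.commute)
  obtain F where F: "frechet_derivatives f F"
    and bd: "\<And>R n. R > 0 \<Longrightarrow> \<exists>K. \<forall>y hs. norm y \<le> R \<longrightarrow> length hs = n \<longrightarrow> norm (F y hs) \<le> K * prod_list (map norm hs)"
    using assms(1) by (auto simp: smooth_bounded_on_balls_def)
  have tr: "norm (L z) \<le> (K * M) * P" if "norm z \<le> M * P" for z M P
    using order_trans[OF K(2)[of z] mult_left_mono[OF that, of K]] K(1) by (simp add: mult.assoc)
  have "frechet_derivatives (\<lambda>y. L (f y)) (\<lambda>y hs. L (F y hs))"
    unfolding frechet_derivatives_def
  proof (intro conjI allI impI)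
    show "L (F y []) = L (f y)" for y using F by (simp add: frechet_derivatives_def)
    show "linear (\<lambda>h. L (F y (hs[i := h])))" if "i < length hs" for y hs i
      using linear_compose[OF frechet_linear_slot[OF F that] L.linear_axioms] by (simp add: o_def)
    show "\<exists>K. \<forall>hs. length hs = n \<longrightarrow> norm (L (F y hs)) \<le> K * prod_list (map norm hs)" for y n
    proof -
      obtain M where "\<And>hs. length hs = n \<Longrightarrow> norm (F y hs) \<le> M * prod_list (map norm hs)"
        using frechet_bound[OF F] by metis
      then show ?thesis using tr by blast
    qed
    fix y n and e :: real assume "e > 0"
    then have "e / K > 0" using K by simp
    then obtain d where d: "d > 0" "\<And>h gs. norm h < d \<Longrightarrow> length gs = n \<Longrightarrow>
        norm (F (y + h) gs - F y gs - F y (h # gs)) \<le> e / K * norm h * prod_list (map norm gs)"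
      using F unfolding frechet_derivatives_def by meson
    have "norm (L (F (y + h) hs) - L (F y hs) - L (F y (h # hs))) \<le> e * norm h * prod_list (map norm hs)"
      if "norm h < d" "length hs = n" for h hs
      using tr[OF d(2)[OF that, unfolded mult.assoc]] K(1) by (simp add: L.diff mult.assoc)
    then show "\<exists>d>0. \<forall>h. norm h < d \<longrightarrow> (\<forall>hs. length hs = n \<longrightarrow>
        norm (L (F (y + h) hs) - L (F y hs) - L (F y (h # hs))) \<le> e * norm h * prod_list (map norm hs))"
      using d(1) by blast
  qed
  moreover have "\<exists>K. \<forall>y hs. norm y \<le> R \<longrightarrow> length hs = n \<longrightarrow> norm (L (F y hs)) \<le> K * prod_list (map norm hs)"
    if "R > 0" for R n
    using bd[OF that, of n] tr by blast
  ultimately show ?thesis unfolding smooth_bounded_on_balls_def by blast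
qed

lemma smooth_bounded_add:
  assumes "smooth_bounded_on_balls f" "smooth_bounded_on_balls g"
  shows "smooth_bounded_on_balls (\<lambda>y. f y + g y)"
proof -
  obtain F where F: "frechet_derivatives f F"
    and Fb: "\<And>R n. R > 0 \<Longrightarrow> \<exists>K. \<forall>y hs. norm y \<le> R \<longrightarrow> length hs = n \<longrightarrow> norm (F y hs) \<le> K * prod_list (map norm hs)"
    using assms(1) by (auto simp: smooth_bounded_on_balls_def)
  obtain G where G: "frechet_derivatives g G"
    and Gb: "\<And>R n. R > 0 \<Longrightarrow> \<exists>K. \<forall>y hs. norm y \<le> R \<longrightarrow> length hs = n \<longrightarrow> norm (G y hs) \<le> K * prod_list (map norm hs)"
    using assms(2) by (auto simp: smooth_bounded_on_balls_def)
  have tr: "norm (a + b) \<le> (K + M) * P" if "norm a \<le> K * P" "norm b \<le> M * P" for a b :: 'b and K M P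
    using norm_triangle_mono[OF that] by (simp add: distrib_right)
  have "frechet_derivatives (\<lambda>y. f y + g y) (\<lambda>y hs. F y hs + G y hs)"
    unfolding frechet_derivatives_def
  proof (intro conjI allI impI)
    show "F y [] + G y [] = f y + g y" for y using F G by (simp add: frechet_derivatives_def)
    show "linear (\<lambda>h. F y (hs[i := h]) + G y (hs[i := h]))" if "i < length hs" for y hs i
      by (rule linear_compose_add[OF frechet_linear_slot[OF F that] frechet_linear_slot[OF G that]])
    show "\<exists>K. \<forall>hs. length hs = n \<longrightarrow> norm (F y hs + G y hs) \<le> K * prod_list (map norm hs)" for y n
    proof -
      obtain K M where "\<And>hs. length hs = n \<Longrightarrow> norm (F y hs) \<le> K * prod_list (map norm hs)"
        "\<And>hs. length hs = n \<Longrightarrow> norm (G y hs) \<le> M * prod_list (map norm hs)"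
        using frechet_bound[OF F] frechet_bound[OF G] by metis
      then show ?thesis using tr by blast
    qed
    fix y n and e :: real assume "e > 0"
    then have e: "e / 2 > 0" by simp
    obtain d where d: "d > 0" "\<And>h gs. norm h < d \<Longrightarrow> length gs = n \<Longrightarrow>
        norm (F (y + h) gs - F y gs - F y (h # gs)) \<le> e / 2 * norm h * prod_list (map norm gs)"
      using F e unfolding frechet_derivatives_def by meson
    obtain d' where d': "d' > 0" "\<And>h gs. norm h < d' \<Longrightarrow> length gs = n \<Longrightarrow>
        norm (G (y + h) gs - G y gs - G y (h # gs)) \<le> e / 2 * norm h * prod_list (map norm gs)"
      using G e unfolding frechet_derivatives_def by meson
    have "norm (F (y + h) hs + G (y + h) hs - (F y hs + G y hs) - (F y (h # hs) + G y (h # hs))) \<le> e * norm h * prod_list (map norm hs)"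
      if "norm h < min d d'" "length hs = n" for h hs
    proof -
      have "norm ((F (y + h) hs - F y hs - F y (h # hs)) + (G (y + h) hs - G y hs - G y (h # hs)))
          \<le> e / 2 * norm h * prod_list (map norm hs) + e / 2 * norm h * prod_list (map norm hs)"
        using that by (intro norm_triangle_mono d(2) d'(2)) auto
      then show ?thesis by (simp add: algebra_simps)
    qed
    then show "\<exists>d>0. \<forall>h. norm h < d \<longrightarrow> (\<forall>hs. length hs = n \<longrightarrow>
        norm (F (y + h) hs + G (y + h) hs - (F y hs + G y hs) - (F y (h # hs) + G y (h # hs))) \<le> e * norm h * prod_list (map norm hs))"
      using d(1) d'(1) by (intro exI[of _ "min d d'"]) auto
  qed
  moreover have "\<exists>K. \<forall>y hs. norm y \<le> R \<longrightarrow> length hs = n \<longrightarrow> norm (F y hs + G y hs) \<le> K * prod_list (map norm hs)"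
    if R: "R > 0" for R n
  proof -
    obtain K M where "\<forall>y hs. norm y \<le> R \<longrightarrow> length hs = n \<longrightarrow> norm (F y hs) \<le> K * prod_list (map norm hs)"
      "\<forall>y hs. norm y \<le> R \<longrightarrow> length hs = n \<longrightarrow> norm (G y hs) \<le> M * prod_list (map norm hs)"
      using Fb[OF R, of n] Gb[OF R, of n] by blast
    then show ?thesis using tr by (intro exI[of _ "K + M"]) blast
  qed
  ultimately show ?thesis unfolding smooth_bounded_on_balls_def by blast
qed

section \<open>Extension beyond the time interval\<close>

text \<open>
  The nodes of the method may lie outside of \<open>[0, 1]\<close>, so the solution is needed slightly beyond the
  time interval. It is extended by a fixed linear combination of reflections. In contrast to a Taylor
  polynomial, this is linear in the values of the function, and thus compatible with every linear
  operator that acts on the values, whatever the order of differentiability.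
\<close>

lemma alternating_sum_Suc:
  "(\<Sum>i\<le>Suc N. (-1) ^ i * real (Suc N choose i) * g i) = (\<Sum>i\<le>N. (-1) ^ i * real (N choose i) * (g i - g (Suc i)))"
proof -
  have "(\<Sum>i\<le>Suc N. (-1) ^ i * real (Suc N choose i) * g i) =
      g 0 + (\<Sum>i\<le>N. (-1) ^ Suc i * real (N choose Suc i) * g (Suc i)) - (\<Sum>i\<le>N. (-1) ^ i * real (N choose i) * g (Suc i))"
    unfolding sum.atMost_Suc_shift by (simp add: algebra_simps sum.distrib sum_negf sum_subtractf)
  also have "g 0 + (\<Sum>i\<le>N. (-1) ^ Suc i * real (N choose Suc i) * g (Suc i)) = (\<Sum>i\<le>Suc N. (-1) ^ i * real (N choose i) * g i)"
    unfolding sum.atMost_Suc_shift by simp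
  also have "\<dots> = (\<Sum>i\<le>N. (-1) ^ i * real (N choose i) * g i)" by simp
  finally show ?thesis by (simp add: right_diff_distrib sum_subtractf)
qed

text \<open>The \<open>N\<close>-th difference of a polynomial of degree less than \<open>N\<close> vanishes.\<close>

lemma alternating_sum_power:
  "l < N \<Longrightarrow> (\<Sum>i\<le>N. (-1) ^ i * real (N choose i) * (a + h * real i) ^ l) = 0"
proof (induction N arbitrary: l)
  case 0
  then show ?case by simp
next
  case (Suc N)
  define p where "p i = a + h * real i" for i
  have "(\<Sum>i\<le>Suc N. (-1) ^ i * real (Suc N choose i) * p i ^ l) = (\<Sum>i\<le>N. (-1) ^ i * real (N choose i) * (p i ^ l - p (Suc i) ^ l))"
    by (rule alternating_sum_Suc)
  also have "\<dots> = (\<Sum>i\<le>N. (-1) ^ i * real (N choose i) * - (\<Sum>m<l. real (l choose m) * p i ^ m * h ^ (l - m)))"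
  proof (intro sum.cong refl arg_cong2[where f="(*)"])
    fix i
    have "p (Suc i) ^ l = (p i + h) ^ l" by (simp add: p_def algebra_simps)
    also have "\<dots> = (\<Sum>m\<le>l. real (l choose m) * p i ^ m * h ^ (l - m))" by (simp add: binomial_ring)
    also have "\<dots> = (\<Sum>m<l. real (l choose m) * p i ^ m * h ^ (l - m)) + p i ^ l"
      by (simp flip: lessThan_Suc_atMost)
    finally show "p i ^ l - p (Suc i) ^ l = - (\<Sum>m<l. real (l choose m) * p i ^ m * h ^ (l - m))" by simp
  qed
  also have "\<dots> = - (\<Sum>i\<le>N. \<Sum>m<l. (real (l choose m) * h ^ (l - m)) * ((-1) ^ i * real (N choose i) * p i ^ m))"
    by (simp add: sum_negf sum_distrib_left mult_ac)
  also have "\<dots> = - (\<Sum>m<l. (real (l choose m) * h ^ (l - m)) * (\<Sum>i\<le>N. (-1) ^ i * real (N choose i) * p i ^ m))"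
    by (subst sum.swap) (simp add: sum_distrib_left)
  also have "\<dots> = 0" using Suc.IH Suc.prems by (simp add: p_def)
  finally show ?case by (simp add: p_def)
qed

text \<open>
  With these weights, the values of a polynomial of degree less than \<open>N\<close> at the points
  \<open>(1 - 2 i) t\<close> sum up to its value at \<open>t\<close>. Thus a function extended by this formula has matching
  derivatives of order less than \<open>N\<close> at \<open>0\<close>.
\<close>

definition reflect_weight :: "nat \<Rightarrow> nat \<Rightarrow> real"
  where "reflect_weight N i = - ((-1) ^ i * real (N choose i))"

lemma sum_reflect_weight: "l < N \<Longrightarrow> (\<Sum>i=1..N. reflect_weight N i * (1 - 2 * real i) ^ l) = 1"
proof -
  assume "l < N"
  then have "0 = (\<Sum>i\<le>N. (-1) ^ i * real (N choose i) * (1 - 2 * real i) ^ l)"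
    using alternating_sum_power[of l N 1 "-2"] by simp
  also have "\<dots> = (-1) ^ 0 * real (N choose 0) * (1 - 2 * real 0) ^ l + (\<Sum>i=1..N. (-1) ^ i * real (N choose i) * (1 - 2 * real i) ^ l)"
    by (simp add: atMost_atLeast0 sum.atLeast_Suc_atMost)
  finally show ?thesis by (simp add: reflect_weight_def sum_negf)
qed

definition extend_left :: "nat \<Rightarrow> (real \<Rightarrow> 'e::real_vector) \<Rightarrow> real \<Rightarrow> 'e"
  where "extend_left N f t = (if t \<le> 0 then \<Sum>i=1..N. reflect_weight N i *\<^sub>R f ((1 - 2 * real i) * t) else f t)"

lemma reflect_in_interval:
  assumes "- \<eta> \<le> t" "t \<le> 0" "\<eta> * (2 * real N) \<le> T" "i \<in> {1..N}"
  shows "(1 - 2 * real i) * t \<in> {0..T}"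
proof -
  have "(1 - 2 * real i) * t = (2 * real i - 1) * (- t)" by (simp add: algebra_simps)
  moreover have "(2 * real i - 1) * (- t) \<le> (2 * real N) * \<eta>"
    using assms by (intro mult_mono) auto
  moreover have "0 \<le> (2 * real i - 1) * (- t)" using assms by (intro mult_nonneg_nonneg) auto
  ultimately show ?thesis using assms(3) by (simp add: mult.commute)
qed

lemma extend_left_eq:
  assumes "0 < N" "0 \<le> t" shows "extend_left N f t = f t"
proof (cases "t = 0")
  case True
  have "extend_left N f t = (\<Sum>i=1..N. reflect_weight N i) *\<^sub>R f 0"
    by (simp add: True extend_left_def scaleR_sum_left)
  then show ?thesis using sum_reflect_weight[of 0 N] assms True by simp
qed (use assms in \<open>auto simp: extend_left_def\<close>)

lemma extend_left_linear:
  assumes "linear K" and fg: "\<And>t. t \<in> {0..T} \<Longrightarrow> K (f t) = g t"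
    and "\<eta> * (2 * real N) \<le> T" "t \<in> {-\<eta>..T}"
  shows "K (extend_left N f t) = extend_left N g t"
proof (cases "t \<le> 0")
  case True
  have "K (f ((1 - 2 * real i) * t)) = g ((1 - 2 * real i) * t)" if "i \<in> {1..N}" for i
    by (intro fg reflect_in_interval[of \<eta> _ N]) (use assms True that in auto)
  then show ?thesis
    using True by (simp add: extend_left_def linear_sum[OF assms(1)] linear_scale[OF assms(1)])
qed (use assms in \<open>auto simp: extend_left_def\<close>)

lemma Ck_family_affine:
  assumes "Ck_family k J F" and "\<And>t. t \<in> I \<Longrightarrow> a + b * t \<in> J"
  shows "Ck_family k I (\<lambda>l t. b ^ l *\<^sub>R F l (a + b * t))"
  unfolding Ck_family_def
proof (intro conjI allI impI ballI)
  fix i t assume i: "i < k" and t: "t \<in> I"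
  have "((\<lambda>t. a + b * t) has_vector_derivative b) (at t within I)"
    by (auto intro!: derivative_eq_intros simp: has_real_derivative_iff_has_vector_derivative[symmetric])
  moreover have "(F i has_vector_derivative F (Suc i) (a + b * t)) (at (a + b * t) within (\<lambda>t. a + b * t) ` I)"
    by (rule has_vector_derivative_within_subset[where S = J])
      (use assms i t in \<open>auto simp: Ck_family_def\<close>)
  ultimately have "((F i \<circ> (\<lambda>t. a + b * t)) has_vector_derivative b *\<^sub>R F (Suc i) (a + b * t)) (at t within I)"
    by (rule vector_diff_chain_within)
  then have "((\<lambda>t. F i (a + b * t)) has_vector_derivative b *\<^sub>R F (Suc i) (a + b * t)) (at t within I)"
    by (simp add: o_def)
  from bounded_linear.has_vector_derivative[OF bounded_linear_scaleR_right this, of "b ^ i"]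
  show "((\<lambda>t. b ^ i *\<^sub>R F i (a + b * t)) has_vector_derivative b ^ Suc i *\<^sub>R F (Suc i) (a + b * t)) (at t within I)"
    by (simp add: mult.commute)
next
  fix i assume "i \<le> k"
  then have "continuous_on J (F i)" using assms(1) by (simp add: Ck_family_def)
  then have "continuous_on I (\<lambda>t. F i (a + b * t))"
    by (rule continuous_on_compose2) (use assms(2) in \<open>auto intro!: continuous_intros\<close>)
  then show "continuous_on I (\<lambda>t. b ^ i *\<^sub>R F i (a + b * t))" by (intro continuous_intros)
qed

lemma Ck_on_affine:
  assumes "Ck_on k J f" and "\<And>t. t \<in> I \<Longrightarrow> a + b * t \<in> J"
  shows "Ck_on k I (\<lambda>t. f (a + b * t))"
proof -
  obtain F where F: "\<And>t. t \<in> J \<Longrightarrow> F 0 t = f t" "Ck_family k J F"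
    using assms(1) unfolding Ck_on_iff_family by blast
  show ?thesis
    unfolding Ck_on_iff_family
    using Ck_family_affine[OF F(2) assms(2)] F(1) assms(2) by (intro exI[of _ "\<lambda>l t. b ^ l *\<^sub>R F l (a + b * t)"]) auto
qed

lemma Ck_on_extend_left:
  assumes f: "Ck_on k {0..T} f" and k: "k < N" and \<eta>: "0 \<le> \<eta>" "\<eta> * (2 * real N) \<le> T"
  shows "Ck_on k {-\<eta>..T} (extend_left N f)"
proof -
  obtain F where F: "\<And>t. t \<in> {0..T} \<Longrightarrow> F 0 t = f t" "Ck_family k {0..T} F"
    using f unfolding Ck_on_iff_family by blast
  have T: "0 \<le> T" using \<eta> by (meson mult_nonneg_nonneg of_nat_0_le_iff order_trans zero_le_numeral)
  define G where "G l t = (\<Sum>i=1..N. reflect_weight N i *\<^sub>R ((1 - 2 * real i) ^ l *\<^sub>R F l ((1 - 2 * real i) * t)))" for l t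
  have piece: "Ck_family k {-\<eta>..0} (\<lambda>l t. (1 - 2 * real i) ^ l *\<^sub>R F l ((1 - 2 * real i) * t))" if "i \<in> {1..N}" for i
    using Ck_family_affine[OF F(2), of "{-\<eta>..0}" 0 "1 - 2 * real i"] reflect_in_interval[OF _ _ \<eta>(2) that] by simp
  define g where "g i l t = reflect_weight N i *\<^sub>R ((1 - 2 * real i) ^ l *\<^sub>R F l ((1 - 2 * real i) * t))" for i l t
  have G_g: "G l = (\<lambda>t. \<Sum>i=1..N. g i l t)" for l
    by (simp add: fun_eq_iff G_def g_def)
  have G: "Ck_family k {-\<eta>..0} G"
    unfolding Ck_family_def G_g
  proof (intro conjI allI impI ballI)
    fix l t assume l: "l < k" and t: "t \<in> {-\<eta>..0}"
    have "(g i l has_vector_derivative g i (Suc l) t) (at t within {-\<eta>..0})" if i: "i \<in> {1..N}" for i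
    proof -
      have "((\<lambda>t. (1 - 2 * real i) ^ l *\<^sub>R F l ((1 - 2 * real i) * t)) has_vector_derivative
          (1 - 2 * real i) ^ Suc l *\<^sub>R F (Suc l) ((1 - 2 * real i) * t)) (at t within {-\<eta>..0})"
        using piece[OF i] l t unfolding Ck_family_def by blast
      from bounded_linear.has_vector_derivative[OF bounded_linear_scaleR_right this]
      show ?thesis unfolding g_def .
    qed
    from has_vector_derivative_sum[OF this]
    show "((\<lambda>t. \<Sum>i=1..N. g i l t) has_vector_derivative (\<Sum>i=1..N. g i (Suc l) t)) (at t within {-\<eta>..0})" .
  next
    fix l assume l: "l \<le> k"
    have "continuous_on {-\<eta>..0} (g i l)" if i: "i \<in> {1..N}" for i
    proof -
      have "continuous_on {-\<eta>..0} (\<lambda>t. (1 - 2 * real i) ^ l *\<^sub>R F l ((1 - 2 * real i) * t))"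
        using piece[OF i] l unfolding Ck_family_def by blast
      from continuous_on_scaleR[OF continuous_on_const this] show ?thesis unfolding g_def .
    qed
    then show "continuous_on {-\<eta>..0} (\<lambda>t. \<Sum>i=1..N. g i l t)"
      by (intro continuous_on_sum)
  qed
  have G0: "G l 0 = F l 0" if "l \<le> k" for l
  proof -
    have "G l 0 = (\<Sum>i=1..N. reflect_weight N i * (1 - 2 * real i) ^ l) *\<^sub>R F l 0"
      by (simp add: G_def scaleR_sum_left)
    then show ?thesis using sum_reflect_weight[of l N] that k by simp
  qed
  define H where "H l t = (if t \<in> {-\<eta>..0} then G l t else F l t)" for l t
  have un: "{-\<eta>..T} = {-\<eta>..0} \<union> {0..T}" using \<eta> T by auto
  have "Ck_family k {-\<eta>..T} H"
    unfolding Ck_family_def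
  proof (intro conjI allI impI ballI)
    fix l t assume l: "l < k" and t: "t \<in> {-\<eta>..T}"
    have cl: "{-\<eta>..0} \<union> closure {-\<eta>..0} \<inter> closure {0..T} = {-\<eta>..0}"
      "{0..T} \<union> closure {-\<eta>..0} \<inter> closure {0..T} = {0..T}" using \<eta> T by auto
    show "(H l has_vector_derivative H (Suc l) t) (at t within {-\<eta>..T})"
      unfolding H_def
    proof (rule has_vector_derivative_If_within_closures[where T = "{0..T}"])
      show "t \<in> {-\<eta>..0} \<union> {0..T}" using t un by auto
      show "{-\<eta>..T} = {-\<eta>..0} \<union> {0..T}" by (rule un)
      show "(G l has_vector_derivative G (Suc l) t) (at t within {-\<eta>..0} \<union> closure {-\<eta>..0} \<inter> closure {0..T})"
        if "t \<in> {-\<eta>..0} \<union> closure {-\<eta>..0} \<inter> closure {0..T}"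
        using that G l unfolding cl by (auto simp: Ck_family_def)
      show "(F l has_vector_derivative F (Suc l) t) (at t within {0..T} \<union> closure {-\<eta>..0} \<inter> closure {0..T})"
        if "t \<in> {0..T} \<union> closure {-\<eta>..0} \<inter> closure {0..T}"
        using that F(2) l unfolding cl by (auto simp: Ck_family_def)
      assume "t \<in> closure {-\<eta>..0}" "t \<in> closure {0..T}"
      then have "t = 0" by auto
      then show "G l t = F l t" "G (Suc l) t = F (Suc l) t" using G0 l by auto
    qed
  next
    fix l assume l: "l \<le> k"
    show "continuous_on {-\<eta>..T} (H l)"
      unfolding H_def un
    proof (rule continuous_on_If)
      show "continuous_on {-\<eta>..0} (G l)" "continuous_on {0..T} (F l)"
        using G F(2) l by (auto simp: Ck_family_def)
      fix t assume "t \<in> {0..T}" "t \<in> {-\<eta>..0}"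
      then have "t = 0" by simp
      then show "G l t = F l t" using G0[OF l] by simp
    qed simp_all
  qed
  moreover have "H 0 t = extend_left N f t" if "t \<in> {-\<eta>..T}" for t
  proof (cases "t \<le> 0")
    case True
    have "F 0 ((1 - 2 * real i) * t) = f ((1 - 2 * real i) * t)" if "i \<in> {1..N}" for i
      by (intro F(1) reflect_in_interval[OF _ True \<eta>(2) that]) (use \<open>t \<in> _\<close> in auto)
    then show ?thesis using True \<open>t \<in> _\<close> by (simp add: H_def G_def extend_left_def)
  qed (use that F in \<open>auto simp: H_def extend_left_def\<close>)
  ultimately show ?thesis unfolding Ck_on_iff_family by blast
qed

definition extend :: "nat \<Rightarrow> real \<Rightarrow> (real \<Rightarrow> 'e::real_vector) \<Rightarrow> real \<Rightarrow> 'e"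
  where "extend N T f t = extend_left N (\<lambda>s. extend_left N f (T - s)) (T - t)"

lemma extend_eq: "0 < N \<Longrightarrow> t \<in> {0..T} \<Longrightarrow> extend N T f t = f t"
  by (simp add: extend_def extend_left_eq)

lemma extend_linear:
  assumes K: "linear K" and fg: "\<And>t. t \<in> {0..T} \<Longrightarrow> K (f t) = g t"
    and \<eta>: "0 \<le> \<eta>" "\<eta> * (2 * real N) \<le> T" and t: "t \<in> {-\<eta>..T + \<eta>}"
  shows "K (extend N T f t) = extend N T g t"
  unfolding extend_def
proof (rule extend_left_linear[OF K, of "T + \<eta>" _ _ \<eta>])
  show "K (extend_left N f (T - s)) = extend_left N g (T - s)" if "s \<in> {0..T + \<eta>}" for s
    by (rule extend_left_linear[OF K fg \<eta>(2)]) (use that in auto)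
qed (use \<eta> t in auto)

lemma Ck_on_extend:
  assumes f: "Ck_on k {0..T} f" and k: "k < N" and \<eta>: "0 \<le> \<eta>" "\<eta> * (2 * real N) \<le> T"
  shows "Ck_on k {-\<eta>..T + \<eta>} (extend N T f)"
proof -
  have "Ck_on k {-\<eta>..T} (extend_left N f)" by (rule Ck_on_extend_left[OF assms])
  from Ck_on_affine[OF this, of "{0..T + \<eta>}" T "-1"]
  have "Ck_on k {0..T + \<eta>} (\<lambda>s. extend_left N f (T - s))" by simp
  then have "Ck_on k {-\<eta>..T + \<eta>} (extend_left N (\<lambda>s. extend_left N f (T - s)))"
    by (rule Ck_on_extend_left[OF _ k \<eta>(1)]) (use \<eta> in auto)
  from Ck_on_affine[OF this, of "{-\<eta>..T + \<eta>}" T "-1"]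
  show ?thesis by (simp add: extend_def[abs_def])
qed

text \<open>
  The derivatives vanish along with the function on \<open>[0, T]\<close>, one-sided ones at the end points included,
  so that Taylor's formula around a point of \<open>[0, T]\<close> consists of the remainder alone.
\<close>

lemma Ck_on_vanishing_bound:
  fixes w :: "real \<Rightarrow> 'e::real_normed_vector"
  assumes w: "Ck_on k {-\<eta>..T + \<eta>} w" and zero: "\<And>t. t \<in> {0..T} \<Longrightarrow> w t = 0" and "0 < T" "0 \<le> \<eta>"
  shows "\<exists>C>0. \<forall>t\<in>{0..T}. \<forall>s\<in>{-\<eta>..T + \<eta>}. norm (w s) \<le> C * \<bar>s - t\<bar> ^ k"
proof -
  obtain W where W: "\<And>t. t \<in> {-\<eta>..T + \<eta>} \<Longrightarrow> W 0 t = w t" "Ck_family k {-\<eta>..T + \<eta>} W"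
    using w unfolding Ck_on_iff_family by blast
  have sub: "{0..T} \<subseteq> {-\<eta>..T + \<eta>}" using assms by auto
  have W0: "W l t = 0" if "l \<le> k" "t \<in> {0..T}" for l t
    using that
  proof (induction l arbitrary: t)
    case 0
    then show ?case using W(1) zero sub by auto
  next
    case (Suc l)
    have "(W l has_vector_derivative W (Suc l) t) (at t within {0..T})"
      using W(2) Suc.prems sub unfolding Ck_family_def
      by (meson Suc_le_lessD has_vector_derivative_within_subset subsetD)
    moreover have "(W l has_vector_derivative 0) (at t within {0..T})"
      by (rule has_vector_derivative_transform[OF Suc.prems(2), of _ "\<lambda>_. 0"])
        (use Suc in auto)
    ultimately show ?case
      using vector_derivative_unique_within_closed_interval[OF \<open>0 < T\<close>, of t "W l" "W (Suc l) t" 0] Suc.prems(2)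
      by (simp add: cbox_interval)
  qed
  obtain C where C: "C > 0" "\<And>t s. t \<in> {-\<eta>..T + \<eta>} \<Longrightarrow> s \<in> {-\<eta>..T + \<eta>} \<Longrightarrow>
      norm (W 0 s - (\<Sum>l<k. ((s - t) ^ l / fact l) *\<^sub>R W l t)) \<le> C * \<bar>s - t\<bar> ^ k"
    using Ck_family_Taylor[OF W(2)] by blast
  have "norm (w s) \<le> C * \<bar>s - t\<bar> ^ k" if "t \<in> {0..T}" "s \<in> {-\<eta>..T + \<eta>}" for t s
    using C(2)[of t s] that sub W0 W(1) by (auto simp: subset_iff)
  then show ?thesis using C(1) by blast
qed

section \<open>Order conditions\<close>

text \<open>
  The classical order is tested on polynomial vector fields, whose partial derivatives are polynomial
  again.
\<close>

inductive_set polynomial_functions :: "((nat \<Rightarrow> real) \<Rightarrow> real) set" where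
  const: "(\<lambda>x. c) \<in> polynomial_functions"
| coord: "(\<lambda>x. x i) \<in> polynomial_functions"
| add: "f \<in> polynomial_functions \<Longrightarrow> g \<in> polynomial_functions \<Longrightarrow> (\<lambda>x. f x + g x) \<in> polynomial_functions"
| mult: "f \<in> polynomial_functions \<Longrightarrow> g \<in> polynomial_functions \<Longrightarrow> (\<lambda>x. f x * g x) \<in> polynomial_functions"

lemma polynomial_functions_power:
  "f \<in> polynomial_functions \<Longrightarrow> (\<lambda>x. f x ^ n) \<in> polynomial_functions"
  by (induction n) (auto intro: polynomial_functions.intros)

lemma polynomial_functions_partial:
  assumes "f \<in> polynomial_functions"
  shows "\<exists>f'\<in>polynomial_functions. \<forall>x. ((\<lambda>s. f (x(k := s))) has_real_derivative f' x) (at (x k))"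
  using assms
proof induction
  case (const c)
  show ?case by (intro bexI[of _ "\<lambda>x. 0"]) (auto intro: polynomial_functions.const)
next
  case (coord i)
  show ?case
    by (intro bexI[of _ "\<lambda>x. if i = k then 1 else 0"]) (auto intro: polynomial_functions.const)
next
  case (add f g)
  then obtain f' g' where "f' \<in> polynomial_functions" "g' \<in> polynomial_functions"
    "\<And>x. ((\<lambda>s. f (x(k := s))) has_real_derivative f' x) (at (x k))"
    "\<And>x. ((\<lambda>s. g (x(k := s))) has_real_derivative g' x) (at (x k))"
    by blast
  then show ?case
    by (intro bexI[of _ "\<lambda>x. f' x + g' x"]) (auto intro: polynomial_functions.add DERIV_add simp del: fun_upd_apply)
next
  case (mult f g)
  then obtain f' g' where f': "f' \<in> polynomial_functions" "g' \<in> polynomial_functions"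
    and d: "\<And>x. ((\<lambda>s. f (x(k := s))) has_real_derivative f' x) (at (x k))"
    "\<And>x. ((\<lambda>s. g (x(k := s))) has_real_derivative g' x) (at (x k))"
    by blast
  have "((\<lambda>s. f (x(k := s)) * g (x(k := s))) has_real_derivative f' x * g x + g' x * f x) (at (x k))" for x
    using DERIV_mult[OF d(1)[of x] d(2)[of x]] by simp
  moreover have "(\<lambda>x. f' x * g x + g' x * f x) \<in> polynomial_functions"
    using f' mult.hyps by (intro polynomial_functions.intros)
  ultimately show ?case by (intro bexI[of _ "\<lambda>x. f' x * g x + g' x * f x"] allI)
qed

lemma polynomial_functions_continuous: "f \<in> polynomial_functions \<Longrightarrow> continuous_on S f"
proof (induction rule: polynomial_functions.induct)
  case (coord i)
  show ?case
    by (rule continuous_on_subset[OF continuous_on_product_coordinates]) simp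
qed (auto intro: continuous_intros)

lemma polynomial_smooth_field:
  assumes "\<And>i. i < N \<Longrightarrow> (\<lambda>x. g x i) \<in> polynomial_functions"
  shows "smooth_field N g"
  unfolding smooth_field_def
proof (intro allI impI)
  fix i assume "i < N"
  have "\<forall>k f. \<exists>f'. f \<in> polynomial_functions \<longrightarrow> f' \<in> polynomial_functions \<and>
      (\<forall>x. ((\<lambda>s. f (x(k := s))) has_real_derivative f' x) (at (x k)))"
    using polynomial_functions_partial by meson
  then obtain d where d: "\<And>k f. f \<in> polynomial_functions \<Longrightarrow> d k f \<in> polynomial_functions"
    "\<And>k f x. f \<in> polynomial_functions \<Longrightarrow> ((\<lambda>s. f (x(k := s))) has_real_derivative d k f x) (at (x k))"
    by metis
  define G where "G ks = foldr d ks (\<lambda>x. g x i)" for ks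
  have G: "G ks \<in> polynomial_functions" for ks
    unfolding G_def by (induction ks) (auto intro: d assms \<open>i < N\<close>)
  show "\<exists>G. (\<forall>x\<in>RN N. G [] x = g x i) \<and>
      (\<forall>ks. set ks \<subseteq> {..<N} \<longrightarrow> continuous_on (RN N) (G ks) \<and>
        (\<forall>k<N. \<forall>x\<in>RN N. ((\<lambda>s. G ks (x(k := s))) has_real_derivative G (k # ks) x) (at (x k))))"
  proof (intro exI[of _ G] conjI ballI allI impI)
    show "G [] x = g x i" for x by (simp add: G_def)
    show "continuous_on (RN N) (G ks)" for ks by (rule polynomial_functions_continuous[OF G])
    have "G (k # ks) = d k (G ks)" for k ks by (simp add: G_def)
    then show "((\<lambda>s. G ks (x(k := s))) has_real_derivative G (k # ks) x) (at (x k))" for ks k x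
      using d(2)[OF G] by simp
  qed
qed

text \<open>
  The test problem is \<open>x\<^sub>0' = 1\<close>, \<open>z\<^sub>0' = 0\<close>, \<open>z\<^sub>k\<^sub>+\<^sub>1' = x\<^sub>0 ^ l k * z\<^sub>k\<close> with initial values \<open>x\<^sub>0 = 0\<close>,
  \<open>z\<^sub>0 = 1\<close> and \<open>z\<^sub>k = 0\<close> otherwise. Its solution is \<open>z\<^sub>k = chain_exact l k * t ^ chain_deg l k\<close>, and
  the stage values of the method are \<open>chain_stage a l k * \<tau> ^ chain_deg l k\<close>.
\<close>

primrec chain_deg :: "(nat \<Rightarrow> nat) \<Rightarrow> nat \<Rightarrow> nat" where
  "chain_deg l 0 = 0"
| "chain_deg l (Suc k) = chain_deg l k + l k + 1"

primrec chain_exact :: "(nat \<Rightarrow> nat) \<Rightarrow> nat \<Rightarrow> real" where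
  "chain_exact l 0 = 1"
| "chain_exact l (Suc k) = chain_exact l k / real (chain_deg l k + l k + 1)"

primrec chain_stage :: "real^'m^'m \<Rightarrow> (nat \<Rightarrow> nat) \<Rightarrow> nat \<Rightarrow> 'm \<Rightarrow> real" where
  "chain_stage a l 0 = (\<lambda>i. 1)"
| "chain_stage a l (Suc k) = (\<lambda>i. \<Sum>m\<in>UNIV. a $ i $ m * (rk_node a m ^ l k * chain_stage a l k m))"

definition chain_field :: "(nat \<Rightarrow> nat) \<Rightarrow> (nat \<Rightarrow> real) \<Rightarrow> nat \<Rightarrow> real"
  where "chain_field l x i = (if i = 0 then 1 else if i = 1 then 0 else x 0 ^ l (i - 2) * x (i - 1))"

text \<open>
  Both sides are coefficients of the same power of \<open>\<tau>\<close>, at most the \<open>p\<close>-th, in the numerical and in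
  the exact solution of the test problem. The bound for the local error forces them to agree.
\<close>

lemma chain_order_condition:
  fixes a :: "real^'m^'m" and b :: "real^'m"
  assumes order: "has_classical_order a b p" and deg: "chain_deg l (Suc s) \<le> p"
  shows "(\<Sum>m\<in>UNIV. b $ m * (rk_node a m ^ l s * chain_stage a l s m)) = chain_exact l (Suc s)"
proof -
  define N where "N = s + 3"
  define vec where "vec t0 z i = (if i = 0 then t0 else if i < N then z (i - 1) else (0::real))" for t0 z i
  define y where "y t = vec t (\<lambda>k. chain_exact l k * t ^ chain_deg l k)" for t
  have vec_RN: "vec t0 z \<in> RN N" for t0 z by (auto simp: vec_def RN_def N_def)
  have vec0: "vec t0 z 0 = t0" and vecS: "k \<le> s + 1 \<Longrightarrow> vec t0 z (Suc k) = z k" for t0 z k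
    by (auto simp: vec_def N_def)
  have cases: "i = 0 \<or> i = 1 \<or> (\<exists>k\<le>s. i = Suc (Suc k))" if "i < N" for i
    using that unfolding N_def by presburger
  have "(\<lambda>x. chain_field l x i) \<in> polynomial_functions" for i
  proof -
    consider "i = 0" | "i = 1" | "i \<noteq> 0" "i \<noteq> 1" by blast
    then show ?thesis
      by cases (auto simp: chain_field_def intro!: polynomial_functions.intros polynomial_functions_power)
  qed
  then have smooth: "smooth_field N (chain_field l)" by (rule polynomial_smooth_field)
  have ode: "solves_ode N (chain_field l) 1 y"
    unfolding solves_ode_def
  proof (intro ballI conjI allI impI)
    fix t :: real
    show "y t \<in> RN N" by (simp add: y_def vec_RN)
    fix i assume "i < N"
    then consider "i = 0" | "i = 1" | k where "k \<le> s" "i = Suc (Suc k)" using cases by blast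
    then show "((\<lambda>s. y s i) has_real_derivative chain_field l (y t) i) (at t within {0..1})"
    proof cases
      case 1
      then show ?thesis by (simp add: y_def vec0 chain_field_def)
    next
      case 2
      then show ?thesis using vecS[of 0] by (simp add: y_def chain_field_def)
    next
      case 3
      have y: "y t (Suc (Suc k)) = chain_exact l (Suc k) * t ^ Suc (chain_deg l k + l k)" for t
        using vecS[of "Suc k"] 3 by (simp add: y_def)
      have "((\<lambda>t. chain_exact l (Suc k) * t ^ Suc (chain_deg l k + l k)) has_real_derivative
          chain_exact l (Suc k) * (real (Suc (chain_deg l k + l k)) * t ^ (chain_deg l k + l k))) (at t within {0..1})"
        by (auto intro!: derivative_eq_intros simp del: power_Suc chain_exact.simps of_nat_Suc)
      also have "chain_exact l (Suc k) * (real (Suc (chain_deg l k + l k)) * t ^ (chain_deg l k + l k)) =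
          t ^ l k * (chain_exact l k * t ^ chain_deg l k)"
        by (simp add: power_add field_simps)
      also have "\<dots> = chain_field l (y t) i"
        using 3 vecS[of k] by (simp add: chain_field_def y_def vec0)
      finally show ?thesis using 3 y by simp
    qed
  qed
  obtain C \<delta> \<tau>0 where \<delta>: "\<delta> > 0" and \<tau>0: "\<tau>0 > 0" "\<tau>0 \<le> 1" and err:
    "\<And>\<tau> y1 i. 0 < \<tau> \<Longrightarrow> \<tau> \<le> \<tau>0 \<Longrightarrow> ode_rk_step N (chain_field l) a b \<tau> \<delta> (y 0) y1 \<Longrightarrow> i < N \<Longrightarrow> \<bar>y1 i - y \<tau> i\<bar> \<le> C * \<tau> ^ (p + 1)"
    using order[unfolded has_classical_order_def, rule_format, OF smooth zero_less_one ode] by blast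
  define M where "M = 1 + (\<Sum>m\<in>UNIV. \<bar>rk_node a m\<bar>) + (\<Sum>k\<le>s + 1. \<Sum>m\<in>UNIV. \<bar>chain_stage a l k m\<bar>)"
  have M: "\<bar>rk_node a m\<bar> \<le> M" "k \<le> s + 1 \<Longrightarrow> \<bar>chain_stage a l k m\<bar> \<le> M" for m k
  proof -
    have "\<bar>rk_node a m\<bar> \<le> (\<Sum>m\<in>UNIV. \<bar>rk_node a m\<bar>)" by (intro member_le_sum) auto
    moreover have "0 \<le> (\<Sum>k\<le>s + 1. \<Sum>m\<in>UNIV. \<bar>chain_stage a l k m\<bar>)" by (intro sum_nonneg) auto
    ultimately show "\<bar>rk_node a m\<bar> \<le> M" by (simp add: M_def)
    assume k: "k \<le> s + 1"
    have "\<bar>chain_stage a l k m\<bar> \<le> (\<Sum>m\<in>UNIV. \<bar>chain_stage a l k m\<bar>)" by (intro member_le_sum) auto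
    also have "\<dots> \<le> (\<Sum>k\<le>s + 1. \<Sum>m\<in>UNIV. \<bar>chain_stage a l k m\<bar>)"
      using k by (intro member_le_sum[of k "{..s+1}" "\<lambda>k. \<Sum>m\<in>UNIV. \<bar>chain_stage a l k m\<bar>"] sum_nonneg) auto
    moreover have "0 \<le> (\<Sum>m\<in>UNIV. \<bar>rk_node a m\<bar>)" by (intro sum_nonneg) auto
    ultimately show "\<bar>chain_stage a l k m\<bar> \<le> M" unfolding M_def by linarith
  qed
  have M0: "M > 0"
    unfolding M_def by (intro add_pos_nonneg sum_nonneg) auto
  define n where "n = chain_deg l (Suc s)"
  define w where "w = (\<Sum>m\<in>UNIV. b $ m * (rk_node a m ^ l s * chain_stage a l s m))"
  have main: "\<bar>w - chain_exact l (Suc s)\<bar> \<le> \<bar>C\<bar> * \<tau>" if \<tau>: "0 < \<tau>" "\<tau> \<le> \<tau>0" "\<tau> \<le> \<delta> / M" for \<tau>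
  proof -
    have \<tau>1: "\<tau> \<le> 1" using \<tau> \<tau>0 by simp
    define Y where "Y m = vec (\<tau> * rk_node a m) (\<lambda>k. \<tau> ^ chain_deg l k * chain_stage a l k m)" for m
    define y1 where "y1 i = y 0 i + \<tau> * (\<Sum>m\<in>UNIV. b $ m * chain_field l (Y m) i)" for i
    have y0: "y 0 0 = 0" "y 0 (Suc 0) = 1" "k \<le> s \<Longrightarrow> y 0 (Suc (Suc k)) = 0" for k
      using vecS[of 0] vecS[of "Suc k"] by (simp_all add: y_def vec0)
    have field: "chain_field l (Y m) (Suc (Suc k)) = \<tau> ^ (chain_deg l k + l k) * (rk_node a m ^ l k * chain_stage a l k m)"
      if "k \<le> s" for k m
      using that vecS[of k] by (simp add: chain_field_def Y_def vec0 power_add power_mult_distrib mult_ac)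
    have "ode_rk_step N (chain_field l) a b \<tau> \<delta> (y 0) y1"
      unfolding ode_rk_step_def
    proof (intro exI[of _ Y] conjI allI impI)
      show "Y m \<in> RN N" for m by (simp add: Y_def vec_RN)
      show "y1 i = y 0 i + \<tau> * (\<Sum>k\<in>UNIV. b $ k * chain_field l (Y k) i)" for i by (simp add: y1_def)
      fix m i assume i: "i < N"
      have \<tau>M: "\<tau> * M \<le> \<delta>" using \<tau>(3) M0 by (simp add: field_simps)
      consider "i = 0" | "i = 1" | k where "k \<le> s" "i = Suc (Suc k)" using cases[OF i] by blast
      then show "\<bar>Y m i - y 0 i\<bar> \<le> \<delta>"
      proof cases
        case 1
        have "\<tau> * \<bar>rk_node a m\<bar> \<le> \<tau> * M" using M(1) \<tau> by (intro mult_left_mono) auto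
        also note \<tau>M
        finally show ?thesis using 1 \<tau> by (simp add: Y_def vec0 y0 abs_mult)
      next
        case 2
        then show ?thesis using y0 vecS[of 0] \<delta> by (simp add: Y_def)
      next
        case 3
        have "\<tau> ^ Suc (chain_deg l k + l k) \<le> \<tau> ^ 1"
          using \<tau> \<tau>1 by (intro power_decreasing) auto
        then have le: "\<tau> ^ Suc (chain_deg l k + l k) * \<bar>chain_stage a l (Suc k) m\<bar> \<le> \<tau> * M"
          using M(2)[of "Suc k" m] 3 \<tau> M0 by (intro mult_mono) auto
        show ?thesis
          using 3 vecS[of "Suc k"] \<tau>(1) order_trans[OF le \<tau>M]
          by (simp add: Y_def y0 abs_mult del: chain_stage.simps)
      qed
      from \<open>i < N\<close> consider "i = 0" | "i = 1" | k where "k \<le> s" "i = Suc (Suc k)" using cases by blast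
      then show "Y m i = y 0 i + \<tau> * (\<Sum>k\<in>UNIV. a $ m $ k * chain_field l (Y k) i)"
      proof cases
        case 1
        then show ?thesis by (simp add: Y_def vec0 y0 chain_field_def rk_node_def)
      next
        case 2
        then show ?thesis using y0 vecS[of 0] by (simp add: Y_def chain_field_def)
      next
        case 3
        then show ?thesis
          using vecS[of "Suc k"] y0(3)[of k] field[of k]
          by (simp add: Y_def sum_distrib_left mult_ac)
      qed
    qed
    from err[OF \<tau>(1,2) this, of "Suc (Suc s)"]
    have "\<bar>y1 (Suc (Suc s)) - y \<tau> (Suc (Suc s))\<bar> \<le> C * \<tau> ^ (p + 1)" by (simp add: N_def)
    moreover have "y1 (Suc (Suc s)) = \<tau> ^ n * w"
      using y0(3)[of s] field[of s] by (simp add: y1_def n_def w_def sum_distrib_left mult_ac)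
    moreover have "y \<tau> (Suc (Suc s)) = \<tau> ^ n * chain_exact l (Suc s)"
      using vecS[of "Suc s"] by (simp add: y_def n_def mult.commute del: chain_exact.simps chain_deg.simps)
    ultimately have "\<tau> ^ n * \<bar>w - chain_exact l (Suc s)\<bar> \<le> C * \<tau> ^ (p + 1)"
      using \<tau>(1) by (simp add: abs_mult flip: right_diff_distrib del: chain_exact.simps)
    also have "\<dots> \<le> \<bar>C\<bar> * \<tau> ^ (n + 1)"
      using \<tau> \<tau>1 deg by (intro mult_mono power_decreasing) (auto simp: n_def)
    also have "\<dots> = \<tau> ^ n * (\<bar>C\<bar> * \<tau>)" by simp
    finally show ?thesis using \<tau>(1) by (simp del: chain_exact.simps)
  qed
  have "\<bar>w - chain_exact l (Suc s)\<bar> \<le> 0"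
  proof (rule field_le_epsilon)
    fix e :: real assume e: "e > 0"
    define \<tau> where "\<tau> = Min {\<tau>0, \<delta> / M, e / (\<bar>C\<bar> + 1)}"
    have \<tau>: "0 < \<tau>" "\<tau> \<le> \<tau>0" "\<tau> \<le> \<delta> / M" "\<tau> \<le> e / (\<bar>C\<bar> + 1)"
      using \<tau>0 \<delta> M0 e by (auto simp: \<tau>_def)
    have "\<bar>C\<bar> * \<tau> \<le> (\<bar>C\<bar> + 1) * \<tau>" using \<tau>(1) by simp
    also have "\<dots> \<le> e" using \<tau>(4) by (simp add: field_simps)
    finally show "\<bar>w - chain_exact l (Suc s)\<bar> \<le> 0 + e" using main[OF \<tau>(1-3)] by simp
  qed
  then show ?thesis by (simp add: w_def del: chain_exact.simps)
qed

text \<open>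
  \<open>stage_weight a n \<psi> e\<close>: a stage value \<open>\<tau> ^ n * \<psi>\<close> approximates \<open>e * t ^ n\<close> at the nodes, where
  \<open>\<psi>\<close> is obtained from the constant \<open>1\<close> by multiplications with nodes and with the coefficient matrix.
\<close>

inductive stage_weight :: "real^'m^'m \<Rightarrow> nat \<Rightarrow> ('m \<Rightarrow> real) \<Rightarrow> real \<Rightarrow> bool" for a where
  one: "stage_weight a 0 (\<lambda>i. 1) 1"
| node: "stage_weight a n \<psi> e \<Longrightarrow> stage_weight a (n + l) (\<lambda>i. rk_node a i ^ l * \<psi> i) e"
| matrix: "stage_weight a n \<psi> e \<Longrightarrow> stage_weight a (Suc n) (\<lambda>i. \<Sum>m\<in>UNIV. a $ i $ m * \<psi> m) (e / real (Suc n))"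

lemma chain_upd:
  "k \<le> s \<Longrightarrow> chain_deg (l(s := r)) k = chain_deg l k"
  "k \<le> s \<Longrightarrow> chain_exact (l(s := r)) k = chain_exact l k"
  "k \<le> s \<Longrightarrow> chain_stage a (l(s := r)) k = chain_stage a l k"
proof -
  show 1: "k \<le> s \<Longrightarrow> chain_deg (l(s := r)) k = chain_deg l k" for k by (induction k) auto
  show "k \<le> s \<Longrightarrow> chain_exact (l(s := r)) k = chain_exact l k" by (induction k) (auto simp: 1)
  show "k \<le> s \<Longrightarrow> chain_stage a (l(s := r)) k = chain_stage a l k" by (induction k) auto
qed

lemma stage_weight_chain:
  assumes "stage_weight a n \<psi> e"
  shows "\<exists>l s r. n = chain_deg l s + r \<and> \<psi> = (\<lambda>i. rk_node a i ^ r * chain_stage a l s i) \<and> e = chain_exact l s"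
  using assms
proof induction
  case one
  show ?case by (rule exI, rule exI[of _ 0], rule exI[of _ 0]) auto
next
  case (node n \<psi> e k)
  then obtain l s r where "n = chain_deg l s + r" "\<psi> = (\<lambda>i. rk_node a i ^ r * chain_stage a l s i)" "e = chain_exact l s"
    by blast
  then show ?case
    by (intro exI[of _ l] exI[of _ s] exI[of _ "r + k"]) (auto simp: power_add mult_ac)
next
  case (matrix n \<psi> e)
  then obtain l s r where "n = chain_deg l s + r" "\<psi> = (\<lambda>i. rk_node a i ^ r * chain_stage a l s i)" "e = chain_exact l s"
    by blast
  moreover obtain l' where "l' s = r" "chain_deg l' s = chain_deg l s" "chain_exact l' s = chain_exact l s"
    "chain_stage a l' s = chain_stage a l s"
    by (rule that[of "l(s := r)"]) (simp_all only: fun_upd_same chain_upd order_refl)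
  ultimately show ?case
    by (rule_tac exI[of _ l'], rule_tac exI[of _ "Suc s"], rule_tac exI[of _ 0]) simp
qed

lemma stage_weight_order_condition:
  assumes "has_classical_order a b p" "stage_weight a n \<psi> e" "n + 1 \<le> p"
  shows "(\<Sum>m\<in>UNIV. b $ m * \<psi> m) = e / real (n + 1)"
proof -
  obtain l s r where l: "n = chain_deg l s + r" "\<psi> = (\<lambda>i. rk_node a i ^ r * chain_stage a l s i)" "e = chain_exact l s"
    using stage_weight_chain[OF assms(2)] by blast
  have "chain_deg (l(s := r)) (Suc s) \<le> p" using l(1) assms(3) by (simp add: chain_upd)
  from chain_order_condition[OF assms(1) this] show ?thesis by (simp add: l chain_upd)
qed

lemma quadrature_order_condition:
  assumes "has_classical_order a b p" "l + 1 \<le> p"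
  shows "(\<Sum>m\<in>UNIV. b $ m * rk_node a m ^ l) = 1 / real (l + 1)"
  using stage_weight_order_condition[OF assms(1) stage_weight.node[OF stage_weight.one, of a l]] assms(2) by simp

text \<open>
  \<open>defect_weight a q \<kappa> \<phi>\<close>: a term \<open>\<tau> ^ \<kappa> * \<phi>\<close> arises when the Taylor coefficients of the stage
  defects, beyond the stage order \<open>q\<close>, are propagated by the linearized method. The weights of the
  update annihilate such terms up to the classical order, because the two parts of a stage defect
  approximate the same polynomial.
\<close>

inductive defect_weight :: "real^'m^'m \<Rightarrow> nat \<Rightarrow> nat \<Rightarrow> ('m \<Rightarrow> real) \<Rightarrow> bool" for a q where
  base: "q < \<kappa> \<Longrightarrow> defect_weight a q \<kappa>
    (\<lambda>i. rk_node a i ^ \<kappa> - real \<kappa> * (\<Sum>m\<in>UNIV. a $ i $ m * rk_node a m ^ (\<kappa> - 1)))"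
| node: "defect_weight a q \<kappa> \<phi> \<Longrightarrow> defect_weight a q (\<kappa> + l) (\<lambda>i. rk_node a i ^ l * \<phi> i)"
| matrix: "defect_weight a q \<kappa> \<phi> \<Longrightarrow> defect_weight a q (Suc \<kappa>) (\<lambda>i. \<Sum>m\<in>UNIV. a $ i $ m * \<phi> m)"

lemma defect_weight_gt: "defect_weight a q \<kappa> \<phi> \<Longrightarrow> q < \<kappa>"
  by (induction rule: defect_weight.induct) auto

lemma defect_weight_split:
  assumes "defect_weight a q \<kappa> \<phi>"
  shows "\<exists>\<psi>1 e1 \<psi>2 e2 s. stage_weight a \<kappa> \<psi>1 e1 \<and> stage_weight a \<kappa> \<psi>2 e2 \<and> \<phi> = (\<lambda>i. \<psi>1 i - s * \<psi>2 i) \<and> e1 = s * e2"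
  using assms
proof induction
  case (base \<kappa>)
  have "stage_weight a \<kappa> (\<lambda>i. rk_node a i ^ \<kappa>) 1"
    using stage_weight.node[OF stage_weight.one, of a \<kappa>] by simp
  moreover have "stage_weight a \<kappa> (\<lambda>i. \<Sum>m\<in>UNIV. a $ i $ m * rk_node a m ^ (\<kappa> - 1)) (1 / real \<kappa>)"
    using stage_weight.matrix[OF stage_weight.node[OF stage_weight.one, of a "\<kappa> - 1"]] base by simp
  ultimately show ?case
    by (rule_tac exI, rule_tac exI[of _ 1], rule_tac exI, rule_tac exI[of _ "1 / real \<kappa>"], rule_tac exI[of _ "real \<kappa>"])
      (use base in auto)
next
  case (node \<kappa> \<phi> l)
  then obtain \<psi>1 e1 \<psi>2 e2 s where *: "stage_weight a \<kappa> \<psi>1 e1" "stage_weight a \<kappa> \<psi>2 e2" "\<phi> = (\<lambda>i. \<psi>1 i - s * \<psi>2 i)" "e1 = s * e2"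
    by blast
  have "(\<lambda>i. rk_node a i ^ l * \<phi> i) = (\<lambda>i. rk_node a i ^ l * \<psi>1 i - s * (rk_node a i ^ l * \<psi>2 i))"
    by (simp add: * algebra_simps)
  then show ?case using stage_weight.node[OF *(1), of l] stage_weight.node[OF *(2), of l] *(4) by blast
next
  case (matrix \<kappa> \<phi>)
  then obtain \<psi>1 e1 \<psi>2 e2 s where *: "stage_weight a \<kappa> \<psi>1 e1" "stage_weight a \<kappa> \<psi>2 e2" "\<phi> = (\<lambda>i. \<psi>1 i - s * \<psi>2 i)" "e1 = s * e2"
    by blast
  have "(\<lambda>i. \<Sum>m\<in>UNIV. a $ i $ m * \<phi> m) = (\<lambda>i. (\<Sum>m\<in>UNIV. a $ i $ m * \<psi>1 m) - s * (\<Sum>m\<in>UNIV. a $ i $ m * \<psi>2 m))"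
    by (simp add: * right_diff_distrib sum_subtractf sum_distrib_left mult.left_commute)
  moreover have "e1 / real (Suc \<kappa>) = s * (e2 / real (Suc \<kappa>))" by (simp add: *(4))
  ultimately show ?case using stage_weight.matrix[OF *(1)] stage_weight.matrix[OF *(2)] by blast
qed

lemma defect_weight_order_condition:
  assumes "has_classical_order a b p" "defect_weight a q \<kappa> \<phi>" "\<kappa> < p"
  shows "(\<Sum>m\<in>UNIV. b $ m * \<phi> m) = 0"
proof -
  obtain \<psi>1 e1 \<psi>2 e2 s where *: "stage_weight a \<kappa> \<psi>1 e1" "stage_weight a \<kappa> \<psi>2 e2" "\<phi> = (\<lambda>i. \<psi>1 i - s * \<psi>2 i)" "e1 = s * e2"
    using defect_weight_split[OF assms(2)] by blast
  have "(\<Sum>m\<in>UNIV. b $ m * \<phi> m) = (\<Sum>m\<in>UNIV. b $ m * \<psi>1 m) - s * (\<Sum>m\<in>UNIV. b $ m * \<psi>2 m)"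
    by (simp add: * right_diff_distrib sum_subtractf sum_distrib_left mult.left_commute)
  also have "\<dots> = 0"
    using stage_weight_order_condition[OF assms(1) *(1)] stage_weight_order_condition[OF assms(1) *(2)] assms(3) *(4)
    by simp
  finally show ?thesis .
qed

section \<open>Expansions in powers of the step size\<close>

text \<open>
  A time interval, enlarged so that all nodes of steps of length at most \<open>\<tau>1\<close> stay inside.
\<close>

locale rk_window =
  fixes a :: "real^'m^'m" and T \<eta> \<tau>1 :: real
  assumes T: "0 < T" and \<eta>: "0 < \<eta>" and \<tau>1: "0 < \<tau>1" "\<tau>1 \<le> 1"
    and nodes: "\<bar>rk_node a i\<bar> * \<tau>1 \<le> \<eta>"
begin

definition admissible :: "real \<Rightarrow> real \<Rightarrow> bool"
  where "admissible \<tau> t \<longleftrightarrow> 0 < \<tau> \<and> \<tau> \<le> \<tau>1 \<and> 0 \<le> t \<and> t \<le> T"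

definition node :: "real \<Rightarrow> real \<Rightarrow> 'm \<Rightarrow> real"
  where "node \<tau> t i = t + rk_node a i * \<tau>"

definition node_bound :: real
  where "node_bound = 1 + (\<Sum>i\<in>UNIV. \<bar>rk_node a i\<bar>)"

lemma node_bound: "\<bar>rk_node a i\<bar> \<le> node_bound" "1 \<le> node_bound"
proof -
  have "\<bar>rk_node a i\<bar> \<le> (\<Sum>i\<in>UNIV. \<bar>rk_node a i\<bar>)" by (intro member_le_sum) auto
  then show "\<bar>rk_node a i\<bar> \<le> node_bound" by (simp add: node_bound_def)
  show "1 \<le> node_bound" by (simp add: node_bound_def sum_nonneg)
qed

lemma admissible_time: "admissible \<tau> t \<Longrightarrow> t \<in> {-\<eta>..T + \<eta>}"
  using \<eta> by (auto simp: admissible_def)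

lemma admissible_node:
  assumes "admissible \<tau> t" shows "node \<tau> t i \<in> {-\<eta>..T + \<eta>}"
proof -
  have "\<bar>rk_node a i * \<tau>\<bar> \<le> \<bar>rk_node a i\<bar> * \<tau>1"
    using assms by (auto simp: abs_mult admissible_def intro!: mult_left_mono)
  then show ?thesis using nodes[of i] assms by (auto simp: node_def admissible_def)
qed

lemma admissible_power_mono:
  assumes "admissible \<tau> t" "m \<le> n" shows "\<tau> ^ n \<le> \<tau> ^ m"
  using assms \<tau>1 by (intro power_decreasing) (auto simp: admissible_def)

lemma admissible_mult_power_mono:
  assumes "admissible \<tau> t" "m \<le> n" "0 \<le> C" "x \<le> C * \<tau> ^ n" shows "x \<le> C * \<tau> ^ m"
  using order_trans[OF assms(4) mult_left_mono[OF admissible_power_mono[OF assms(1,2)] assms(3)]] .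

lemma le_abs_mult_power:
  assumes "admissible \<tau> t" "x \<le> C * \<tau> ^ n" shows "x \<le> \<bar>C\<bar> * \<tau> ^ n"
proof -
  have "C * \<tau> ^ n \<le> \<bar>C\<bar> * \<tau> ^ n"
    using assms(1) by (intro mult_right_mono) (auto simp: admissible_def)
  then show ?thesis using assms(2) by simp
qed

lemma node_Taylor:
  fixes F :: "nat \<Rightarrow> real \<Rightarrow> 'e::real_normed_vector"
  assumes "Ck_family k {-\<eta>..T + \<eta>} F"
  obtains C where "0 < C" "\<And>\<tau> t i. admissible \<tau> t \<Longrightarrow>
    norm (F 0 (node \<tau> t i) - (\<Sum>l<k. ((rk_node a i * \<tau>) ^ l / fact l) *\<^sub>R F l t)) \<le> C * \<tau> ^ k"
proof -
  obtain C where C: "C > 0" "\<And>t s. t \<in> {-\<eta>..T + \<eta>} \<Longrightarrow> s \<in> {-\<eta>..T + \<eta>} \<Longrightarrow>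
      norm (F 0 s - (\<Sum>l<k. ((s - t) ^ l / fact l) *\<^sub>R F l t)) \<le> C * \<bar>s - t\<bar> ^ k"
    using Ck_family_Taylor[OF assms] by blast
  have "norm (F 0 (node \<tau> t i) - (\<Sum>l<k. ((rk_node a i * \<tau>) ^ l / fact l) *\<^sub>R F l t)) \<le> (C * node_bound ^ k) * \<tau> ^ k"
    if ad: "admissible \<tau> t" for \<tau> t i
  proof -
    have "norm (F 0 (node \<tau> t i) - (\<Sum>l<k. ((rk_node a i * \<tau>) ^ l / fact l) *\<^sub>R F l t)) \<le> C * \<bar>rk_node a i * \<tau>\<bar> ^ k"
      using C(2)[OF admissible_time[OF ad] admissible_node[OF ad, of i]] by (simp add: node_def)
    also have "\<dots> \<le> C * (node_bound * \<tau>) ^ k"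
      using ad node_bound(1)[of i] C(1)
      by (intro mult_left_mono power_mono) (auto simp: abs_mult admissible_def intro!: mult_right_mono)
    finally show ?thesis by (simp add: power_mult_distrib mult.assoc)
  qed
  then show thesis using that[of "C * node_bound ^ k"] C(1) node_bound(2) by auto
qed

text \<open>
  The families \<open>f \<tau> t i\<close> that are, up to a remainder of size \<open>\<tau> ^ N\<close> and uniformly in the time \<open>t\<close>,
  sums of terms \<open>\<tau> ^ \<kappa> * \<phi> i\<close> times a vector, with \<open>\<phi>\<close> a weight to which the order conditions apply.
  An inductive definition avoids explicit index sets of the sums, and closure under an operation is
  shown by checking it for a remainder and for a single term.
\<close>

inductive defect_expansion :: "nat \<Rightarrow> nat \<Rightarrow> (real \<Rightarrow> real \<Rightarrow> 'm \<Rightarrow> 'y::real_normed_vector) \<Rightarrow> bool" for q N where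
  remainder: "(\<And>\<tau> t i. admissible \<tau> t \<Longrightarrow> norm (f \<tau> t i) \<le> C * \<tau> ^ N) \<Longrightarrow> defect_expansion q N f"
| monomial: "defect_weight a q \<kappa> \<phi> \<Longrightarrow> (\<And>t. 0 \<le> t \<Longrightarrow> t \<le> T \<Longrightarrow> norm (y t) \<le> C) \<Longrightarrow>
    defect_expansion q N (\<lambda>\<tau> t i. (\<tau> ^ \<kappa> * \<phi> i) *\<^sub>R y t)"
| plus: "defect_expansion q N f \<Longrightarrow> defect_expansion q N g \<Longrightarrow> defect_expansion q N (\<lambda>\<tau> t i. f \<tau> t i + g \<tau> t i)"

lemma defect_expansion_cong:
  assumes "defect_expansion q N f" "\<And>\<tau> t i. admissible \<tau> t \<Longrightarrow> f \<tau> t i = g \<tau> t i"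
  shows "defect_expansion q N g"
proof -
  have "defect_expansion q N (\<lambda>\<tau> t i. g \<tau> t i - f \<tau> t i)"
    by (rule defect_expansion.remainder[of _ 0]) (simp add: assms(2))
  from defect_expansion.plus[OF assms(1) this] show ?thesis by simp
qed

lemma defect_expansion_sum:
  "finite S \<Longrightarrow> (\<And>k. k \<in> S \<Longrightarrow> defect_expansion q N (f k)) \<Longrightarrow> defect_expansion q N (\<lambda>\<tau> t i. \<Sum>k\<in>S. f k \<tau> t i)"
proof (induction S rule: finite_induct)
  case empty
  show ?case by (rule defect_expansion.remainder[of _ 0]) simp
next
  case (insert k S)
  have "defect_expansion q N (\<lambda>\<tau> t i. f k \<tau> t i + (\<Sum>k\<in>S. f k \<tau> t i))"
    using insert by (intro defect_expansion.plus) auto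
  then show ?case using insert.hyps by simp
qed

lemma defect_expansion_matrix:
  assumes "defect_expansion q N f"
  shows "defect_expansion q (Suc N) (\<lambda>\<tau> t i. \<tau> *\<^sub>R (\<Sum>m\<in>UNIV. a $ i $ m *\<^sub>R f \<tau> t m))"
  using assms
proof induction
  case (remainder f C)
  define c where "c = (\<Sum>i\<in>UNIV. \<Sum>m\<in>UNIV. \<bar>a $ i $ m\<bar>)"
  show ?case
  proof (rule defect_expansion.remainder[of _ "c * \<bar>C\<bar>"])
    fix \<tau> t i assume ad: "admissible \<tau> t"
    then have \<tau>: "\<tau> > 0" by (simp add: admissible_def)
    have "norm (f \<tau> t m) \<le> \<bar>C\<bar> * \<tau> ^ N" for m
      by (rule le_abs_mult_power[OF ad remainder[OF ad]])
    then have "norm (\<Sum>m\<in>UNIV. a $ i $ m *\<^sub>R f \<tau> t m) \<le> (\<Sum>m\<in>UNIV. \<bar>a $ i $ m\<bar>) * (\<bar>C\<bar> * \<tau> ^ N)"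
      by (rule norm_weighted_sum_le)
    also have "\<dots> \<le> c * (\<bar>C\<bar> * \<tau> ^ N)"
      unfolding c_def using \<tau>
      by (intro mult_right_mono member_le_sum[of i UNIV "\<lambda>i. \<Sum>m\<in>UNIV. \<bar>a $ i $ m\<bar>"]) (auto intro!: sum_nonneg)
    finally have "\<tau> * norm (\<Sum>m\<in>UNIV. a $ i $ m *\<^sub>R f \<tau> t m) \<le> \<tau> * (c * (\<bar>C\<bar> * \<tau> ^ N))"
      using \<tau> by (intro mult_left_mono) auto
    then show "norm (\<tau> *\<^sub>R (\<Sum>m\<in>UNIV. a $ i $ m *\<^sub>R f \<tau> t m)) \<le> c * \<bar>C\<bar> * \<tau> ^ Suc N"
      using \<tau> by (simp add: mult_ac)
  qed
next
  case (monomial \<kappa> \<phi> y C)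
  have "(\<lambda>\<tau> t i. \<tau> *\<^sub>R (\<Sum>m\<in>UNIV. a $ i $ m *\<^sub>R ((\<tau> ^ \<kappa> * \<phi> m) *\<^sub>R y t))) =
      (\<lambda>\<tau> t i. (\<tau> ^ Suc \<kappa> * (\<Sum>m\<in>UNIV. a $ i $ m * \<phi> m)) *\<^sub>R y t)"
    by (intro ext) (simp add: scaleR_sum_left scaleR_sum_right sum_distrib_left mult_ac)
  then show ?case
    using defect_expansion.monomial[OF defect_weight.matrix[OF monomial(1)] monomial(2)] by simp
next
  case (plus f g)
  from defect_expansion.plus[OF plus.IH] show ?case
    by (simp add: scaleR_add_right sum.distrib)
qed

text \<open>
  Applying an operator that depends smoothly on time, evaluated at the nodes: its Taylor expansion
  multiplies the weights by powers of the nodes. Since the terms of the expansion have order at least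
  \<open>q + 1\<close>, only the first \<open>N - q - 1\<close> Taylor coefficients matter.
\<close>

lemma defect_expansion_operator:
  fixes F :: "nat \<Rightarrow> real \<Rightarrow> 'y::real_normed_vector \<Rightarrow>\<^sub>L 'z::real_normed_vector"
  assumes F: "Ck_family k {-\<eta>..T + \<eta>} F" and N: "N \<le> q + 1 + k" and f: "defect_expansion q N f"
  shows "defect_expansion q N (\<lambda>\<tau> t i. blinfun_apply (F 0 (node \<tau> t i)) (f \<tau> t i))"
  using f
proof induction
  case (remainder f C)
  obtain K where K: "K > 0" "\<And>s. s \<in> {-\<eta>..T + \<eta>} \<Longrightarrow> norm (F 0 s) \<le> K"
    using Ck_family_bounded[OF F] by blast
  show ?case
  proof (rule defect_expansion.remainder[of _ "K * C"])
    fix \<tau> t i assume ad: "admissible \<tau> t"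
    have "norm (blinfun_apply (F 0 (node \<tau> t i)) (f \<tau> t i)) \<le> norm (F 0 (node \<tau> t i)) * norm (f \<tau> t i)"
      by (rule norm_blinfun)
    also have "\<dots> \<le> K * (C * \<tau> ^ N)"
      using K remainder[OF ad, of i] admissible_node[OF ad] by (intro mult_mono) auto
    finally show "norm (blinfun_apply (F 0 (node \<tau> t i)) (f \<tau> t i)) \<le> K * C * \<tau> ^ N" by (simp add: mult.assoc)
  qed
next
  case (monomial \<kappa> \<phi> y C)
  define g where "g l \<tau> t i = (\<tau> ^ (\<kappa> + l) * (rk_node a i ^ l * \<phi> i)) *\<^sub>R (blinfun_apply (F l t) (y t) /\<^sub>R fact l)" for l \<tau> t i
  define E where "E \<tau> t i = F 0 (node \<tau> t i) - (\<Sum>l<k. ((rk_node a i * \<tau>) ^ l / fact l) *\<^sub>R F l t)" for \<tau> t i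
  define R where "R \<tau> t i = (\<tau> ^ \<kappa> * \<phi> i) *\<^sub>R blinfun_apply (E \<tau> t i) (y t)" for \<tau> t i
  obtain K where K: "K > 0" "\<And>\<tau> t i. admissible \<tau> t \<Longrightarrow> norm (E \<tau> t i) \<le> K * \<tau> ^ k"
    using node_Taylor[OF F] unfolding E_def by blast
  define M where "M = (\<Sum>i\<in>UNIV. \<bar>\<phi> i\<bar>)"
  have M: "\<bar>\<phi> i\<bar> \<le> M" "0 \<le> M" for i
    unfolding M_def by (intro member_le_sum sum_nonneg; simp)+
  have "defect_expansion q N (g l)" if "l < k" for l
  proof -
    have "l \<le> k" using that by simp
    then obtain B where B: "B > 0" "\<And>s. s \<in> {-\<eta>..T + \<eta>} \<Longrightarrow> norm (F l s) \<le> B"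
      using Ck_family_bounded[OF F] by blast
    show ?thesis
      unfolding g_def
    proof (rule defect_expansion.monomial[OF defect_weight.node[OF monomial(1)]])
      fix t assume t: "0 \<le> t" "t \<le> T"
      have "norm (blinfun_apply (F l t) (y t)) \<le> norm (F l t) * norm (y t)" by (rule norm_blinfun)
      also have "\<dots> \<le> B * C"
        using B monomial(2)[OF t] t \<eta> by (intro mult_mono) auto
      finally show "norm (blinfun_apply (F l t) (y t) /\<^sub>R fact l) \<le> (B * C) / fact l"
        by (simp add: divide_inverse mult.commute)
    qed
  qed
  then have "defect_expansion q N (\<lambda>\<tau> t i. \<Sum>l<k. g l \<tau> t i)" by (intro defect_expansion_sum) auto
  moreover have "defect_expansion q N R"
  proof (rule defect_expansion.remainder[of _ "M * K * \<bar>C\<bar>"])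
    fix \<tau> t i assume ad: "admissible \<tau> t"
    then have \<tau>: "\<tau> > 0" and t: "0 \<le> t" "t \<le> T" by (auto simp: admissible_def)
    have "norm (R \<tau> t i) = (\<tau> ^ \<kappa> * \<bar>\<phi> i\<bar>) * norm (blinfun_apply (E \<tau> t i) (y t))"
      using \<tau> by (simp add: R_def abs_mult)
    also have "\<dots> \<le> (\<tau> ^ \<kappa> * \<bar>\<phi> i\<bar>) * (norm (E \<tau> t i) * norm (y t))"
      using \<tau> by (intro mult_left_mono norm_blinfun) auto
    also have "\<dots> \<le> (\<tau> ^ \<kappa> * M) * ((K * \<tau> ^ k) * \<bar>C\<bar>)"
      using \<tau> M K(1) K(2)[OF ad, of i] monomial(2)[OF t] by (intro mult_mono mult_nonneg_nonneg) auto
    also have "\<dots> = (M * K * \<bar>C\<bar>) * \<tau> ^ (\<kappa> + k)" by (simp add: power_add mult_ac)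
    finally show "norm (R \<tau> t i) \<le> M * K * \<bar>C\<bar> * \<tau> ^ N"
      by (rule admissible_mult_power_mono[OF ad, rotated 2]) (use defect_weight_gt[OF monomial(1)] N M(2) K(1) in auto)
  qed
  ultimately have "defect_expansion q N (\<lambda>\<tau> t i. (\<Sum>l<k. g l \<tau> t i) + R \<tau> t i)"
    by (rule defect_expansion.plus)
  then show ?case
  proof (rule defect_expansion_cong)
    fix \<tau> t i
    have "(\<Sum>l<k. g l \<tau> t i) = (\<tau> ^ \<kappa> * \<phi> i) *\<^sub>R blinfun_apply (\<Sum>l<k. ((rk_node a i * \<tau>) ^ l / fact l) *\<^sub>R F l t) (y t)"
      by (simp add: g_def blinfun.sum_left blinfun.scaleR_left scaleR_sum_right power_add power_mult_distrib divide_inverse mult_ac)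
    then show "(\<Sum>l<k. g l \<tau> t i) + R \<tau> t i = blinfun_apply (F 0 (node \<tau> t i)) ((\<tau> ^ \<kappa> * \<phi> i) *\<^sub>R y t)"
      by (simp add: R_def E_def blinfun.diff_left blinfun.scaleR_right scaleR_diff_right)
  qed
next
  case (plus f g)
  from defect_expansion.plus[OF plus.IH] show ?case by (simp add: blinfun.add_right)
qed

lemma defect_expansion_bound:
  assumes "defect_expansion q N f" "q + 1 \<le> N"
  shows "\<exists>C\<ge>0. \<forall>\<tau> t i. admissible \<tau> t \<longrightarrow> norm (f \<tau> t i) \<le> C * \<tau> ^ (q + 1)"
  using assms(1)
proof induction
  case (remainder f C)
  show ?case
  proof (intro exI[of _ "\<bar>C\<bar>"] conjI allI impI)
    fix \<tau> t i assume ad: "admissible \<tau> t"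
    have "norm (f \<tau> t i) \<le> \<bar>C\<bar> * \<tau> ^ N"
      by (rule le_abs_mult_power[OF ad remainder[OF ad]])
    then show "norm (f \<tau> t i) \<le> \<bar>C\<bar> * \<tau> ^ (q + 1)"
      by (rule admissible_mult_power_mono[OF ad assms(2), rotated]) simp
  qed simp
next
  case (monomial \<kappa> \<phi> y C)
  define M where "M = (\<Sum>i\<in>UNIV. \<bar>\<phi> i\<bar>)"
  have M: "\<bar>\<phi> i\<bar> \<le> M" "0 \<le> M" for i
    unfolding M_def by (intro member_le_sum sum_nonneg; simp)+
  show ?case
  proof (intro exI[of _ "M * \<bar>C\<bar>"] conjI allI impI)
    show "0 \<le> M * \<bar>C\<bar>" using M by simp
    fix \<tau> t i assume ad: "admissible \<tau> t"
    then have \<tau>: "\<tau> > 0" and t: "0 \<le> t" "t \<le> T" by (auto simp: admissible_def)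
    have "norm ((\<tau> ^ \<kappa> * \<phi> i) *\<^sub>R y t) = \<tau> ^ \<kappa> * (\<bar>\<phi> i\<bar> * norm (y t))"
      using \<tau> by (simp add: abs_mult mult.assoc)
    also have "\<dots> \<le> \<tau> ^ \<kappa> * (M * \<bar>C\<bar>)"
      using \<tau> M monomial(2)[OF t] by (intro mult_left_mono mult_mono) auto
    finally have "norm ((\<tau> ^ \<kappa> * \<phi> i) *\<^sub>R y t) \<le> (M * \<bar>C\<bar>) * \<tau> ^ \<kappa>" by (simp add: mult_ac)
    then show "norm ((\<tau> ^ \<kappa> * \<phi> i) *\<^sub>R y t) \<le> M * \<bar>C\<bar> * \<tau> ^ (q + 1)"
      by (rule admissible_mult_power_mono[OF ad, rotated 2]) (use defect_weight_gt[OF monomial(1)] M(2) in auto)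
  qed
next
  case (plus f g)
  then obtain C C' where C: "C \<ge> 0" "C' \<ge> 0"
    "\<And>\<tau> t i. admissible \<tau> t \<Longrightarrow> norm (f \<tau> t i) \<le> C * \<tau> ^ (q + 1)"
    "\<And>\<tau> t i. admissible \<tau> t \<Longrightarrow> norm (g \<tau> t i) \<le> C' * \<tau> ^ (q + 1)"
    by blast
  then show ?case
    by (intro exI[of _ "C + C'"]) (auto simp: distrib_right intro!: norm_triangle_mono)
qed

text \<open>
  In the update, terms of order \<open>\<kappa> < p\<close> are annihilated by the weights \<open>b\<close>, and the other ones are small.
\<close>

lemma defect_expansion_update:
  assumes order: "has_classical_order a b p" and N: "N \<le> p" and f: "defect_expansion q N f"
  shows "\<exists>C\<ge>0. \<forall>\<tau> t. admissible \<tau> t \<longrightarrow> norm (\<tau> *\<^sub>R (\<Sum>i\<in>UNIV. b $ i *\<^sub>R f \<tau> t i)) \<le> C * \<tau> ^ (N + 1)"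
  using f
proof induction
  case (remainder f C)
  define \<beta> where "\<beta> = (\<Sum>i\<in>UNIV. \<bar>b $ i\<bar>)"
  show ?case
  proof (intro exI[of _ "\<beta> * \<bar>C\<bar>"] conjI allI impI)
    show "0 \<le> \<beta> * \<bar>C\<bar>" by (simp add: \<beta>_def sum_nonneg)
    fix \<tau> t assume ad: "admissible \<tau> t"
    then have \<tau>: "\<tau> > 0" by (simp add: admissible_def)
    have "norm (f \<tau> t i) \<le> \<bar>C\<bar> * \<tau> ^ N" for i
      by (rule le_abs_mult_power[OF ad remainder[OF ad]])
    then have "norm (\<Sum>i\<in>UNIV. b $ i *\<^sub>R f \<tau> t i) \<le> \<beta> * (\<bar>C\<bar> * \<tau> ^ N)"
      unfolding \<beta>_def by (rule norm_weighted_sum_le)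
    then have "\<tau> * norm (\<Sum>i\<in>UNIV. b $ i *\<^sub>R f \<tau> t i) \<le> \<tau> * (\<beta> * (\<bar>C\<bar> * \<tau> ^ N))"
      using \<tau> by (intro mult_left_mono) auto
    then show "norm (\<tau> *\<^sub>R (\<Sum>i\<in>UNIV. b $ i *\<^sub>R f \<tau> t i)) \<le> \<beta> * \<bar>C\<bar> * \<tau> ^ (N + 1)"
      using \<tau> by (simp add: mult_ac)
  qed
next
  case (monomial \<kappa> \<phi> y C)
  define M where "M = \<bar>\<Sum>i\<in>UNIV. b $ i * \<phi> i\<bar>"
  have M: "M = 0" if "\<kappa> < p"
    unfolding M_def using defect_weight_order_condition[OF order monomial(1) that] by simp
  show ?case
  proof (intro exI[of _ "M * \<bar>C\<bar>"] conjI allI impI)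
    show "0 \<le> M * \<bar>C\<bar>" by (simp add: M_def)
    fix \<tau> t assume ad: "admissible \<tau> t"
    then have \<tau>: "\<tau> > 0" and t: "0 \<le> t" "t \<le> T" by (auto simp: admissible_def)
    have "\<tau> *\<^sub>R (\<Sum>i\<in>UNIV. b $ i *\<^sub>R ((\<tau> ^ \<kappa> * \<phi> i) *\<^sub>R y t)) = (\<tau> ^ (\<kappa> + 1) * (\<Sum>i\<in>UNIV. b $ i * \<phi> i)) *\<^sub>R y t"
      by (simp add: scaleR_sum_left scaleR_sum_right sum_distrib_left mult_ac)
    then have "norm (\<tau> *\<^sub>R (\<Sum>i\<in>UNIV. b $ i *\<^sub>R ((\<tau> ^ \<kappa> * \<phi> i) *\<^sub>R y t))) = (M * norm (y t)) * \<tau> ^ (\<kappa> + 1)"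
      using \<tau> by (simp add: abs_mult M_def)
    also have "\<dots> \<le> (M * \<bar>C\<bar>) * \<tau> ^ (\<kappa> + 1)"
      using \<tau> monomial(2)[OF t] by (intro mult_right_mono mult_left_mono) (auto simp: M_def)
    finally show "norm (\<tau> *\<^sub>R (\<Sum>i\<in>UNIV. b $ i *\<^sub>R ((\<tau> ^ \<kappa> * \<phi> i) *\<^sub>R y t))) \<le> M * \<bar>C\<bar> * \<tau> ^ (N + 1)"
    proof (cases "\<kappa> < p")
      case False
      assume "norm (\<tau> *\<^sub>R (\<Sum>i\<in>UNIV. b $ i *\<^sub>R ((\<tau> ^ \<kappa> * \<phi> i) *\<^sub>R y t))) \<le> M * \<bar>C\<bar> * \<tau> ^ (\<kappa> + 1)"
      then show ?thesis
        by (rule admissible_mult_power_mono[OF ad, rotated 2]) (use False N in \<open>auto simp: M_def\<close>)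
    qed (simp add: M)
  qed
next
  case (plus f g)
  then obtain C C' where C: "C \<ge> 0" "C' \<ge> 0"
    "\<And>\<tau> t. admissible \<tau> t \<Longrightarrow> norm (\<tau> *\<^sub>R (\<Sum>i\<in>UNIV. b $ i *\<^sub>R f \<tau> t i)) \<le> C * \<tau> ^ (N + 1)"
    "\<And>\<tau> t. admissible \<tau> t \<Longrightarrow> norm (\<tau> *\<^sub>R (\<Sum>i\<in>UNIV. b $ i *\<^sub>R g \<tau> t i)) \<le> C' * \<tau> ^ (N + 1)"
    by blast
  show ?case
  proof (intro exI[of _ "C + C'"] conjI allI impI)
    show "0 \<le> C + C'" using C by simp
    fix \<tau> t assume ad: "admissible \<tau> t"
    have "norm (\<tau> *\<^sub>R (\<Sum>i\<in>UNIV. b $ i *\<^sub>R f \<tau> t i) + \<tau> *\<^sub>R (\<Sum>i\<in>UNIV. b $ i *\<^sub>R g \<tau> t i)) \<le> C * \<tau> ^ (N + 1) + C' * \<tau> ^ (N + 1)"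
      by (rule norm_triangle_mono[OF C(3,4)[OF ad]])
    then show "norm (\<tau> *\<^sub>R (\<Sum>i\<in>UNIV. b $ i *\<^sub>R (f \<tau> t i + g \<tau> t i))) \<le> (C + C') * \<tau> ^ (N + 1)"
      by (simp add: scaleR_add_right sum.distrib distrib_right)
  qed
qed

text \<open>
  The defect of the stage equations on inserting a smooth function: by the stage order, the Taylor
  coefficients up to order \<open>q\<close> cancel.
\<close>

lemma stage_defect_expansion:
  fixes V :: "nat \<Rightarrow> real \<Rightarrow> 'y::real_normed_vector"
  assumes V: "Ck_family (Suc k) {-\<eta>..T + \<eta>} V" and q: "has_stage_order a q"
  shows "defect_expansion q (Suc k)
    (\<lambda>\<tau> t i. V 0 t + \<tau> *\<^sub>R (\<Sum>m\<in>UNIV. a $ i $ m *\<^sub>R V 1 (node \<tau> t m)) - V 0 (node \<tau> t i))"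
proof -
  obtain C0 where C0: "C0 > 0" "\<And>\<tau> t i. admissible \<tau> t \<Longrightarrow>
    norm (V 0 (node \<tau> t i) - (\<Sum>l<Suc k. ((rk_node a i * \<tau>) ^ l / fact l) *\<^sub>R V l t)) \<le> C0 * \<tau> ^ Suc k"
    using node_Taylor[OF V] by blast
  obtain C1 where C1: "C1 > 0" "\<And>\<tau> t i. admissible \<tau> t \<Longrightarrow>
    norm (V 1 (node \<tau> t i) - (\<Sum>l<k. ((rk_node a i * \<tau>) ^ l / fact l) *\<^sub>R V (Suc l) t)) \<le> C1 * \<tau> ^ k"
    using node_Taylor[OF Ck_family_Suc[OF V]] by auto
  define R0 where "R0 \<tau> t i = - (V 0 (node \<tau> t i) - (\<Sum>l<Suc k. ((rk_node a i * \<tau>) ^ l / fact l) *\<^sub>R V l t))" for \<tau> t i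
  define R1 where "R1 \<tau> t i = V 1 (node \<tau> t i) - (\<Sum>l<k. ((rk_node a i * \<tau>) ^ l / fact l) *\<^sub>R V (Suc l) t)" for \<tau> t i
  define \<phi> where "\<phi> l i = rk_node a i ^ l - real l * (\<Sum>m\<in>UNIV. a $ i $ m * rk_node a m ^ (l - 1))" for l i
  define g where "g l \<tau> t i = (\<tau> ^ Suc l * \<phi> (Suc l) i) *\<^sub>R (- (1 / fact (Suc l)) *\<^sub>R V (Suc l) t)" for l \<tau> t i
  have "defect_expansion q (Suc k) (g l)" if l: "l < k" for l
  proof (cases "Suc l \<le> q")
    case True
    then have "(\<Sum>m\<in>UNIV. a $ i $ m * rk_node a m ^ (Suc l - 1)) = rk_node a i ^ Suc l / real (Suc l)" for i
      by (intro bspec[OF spec[OF q[unfolded has_stage_order_def]]]) simp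
    then have "\<phi> (Suc l) i = 0" for i
      unfolding \<phi>_def by simp
    then show ?thesis by (intro defect_expansion.remainder[of _ 0]) (simp add: g_def)
  next
    case False
    then have w: "defect_weight a q (Suc l) (\<phi> (Suc l))"
      using defect_weight.base[of q "Suc l" a] by (simp add: \<phi>_def[abs_def])
    have "Suc l \<le> Suc k" using l by simp
    then obtain B where B: "B > 0" "\<And>s. s \<in> {-\<eta>..T + \<eta>} \<Longrightarrow> norm (V (Suc l) s) \<le> B"
      using Ck_family_bounded[OF V] by blast
    have "norm (- (1 / fact (Suc l)) *\<^sub>R V (Suc l) t) \<le> 1 / fact (Suc l) * B" if "0 \<le> t" "t \<le> T" for t
      unfolding norm_scaleR using B(2)[of t] that \<eta> by (intro mult_mono) (auto simp del: fact_Suc)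
    then show ?thesis
      unfolding g_def by (rule defect_expansion.monomial[OF w])
  qed
  then have "defect_expansion q (Suc k) (\<lambda>\<tau> t i. \<Sum>l<k. g l \<tau> t i)" by (intro defect_expansion_sum) auto
  moreover have "defect_expansion q (Suc k) R0"
    by (rule defect_expansion.remainder[of _ C0]) (simp only: R0_def norm_minus_cancel C0(2))
  moreover have "defect_expansion q (Suc k) (\<lambda>\<tau> t i. \<tau> *\<^sub>R (\<Sum>m\<in>UNIV. a $ i $ m *\<^sub>R R1 \<tau> t m))"
    by (rule defect_expansion_matrix, rule defect_expansion.remainder[of _ C1]) (simp only: R1_def C1(2))
  ultimately have "defect_expansion q (Suc k)
      (\<lambda>\<tau> t i. (\<Sum>l<k. g l \<tau> t i) + R0 \<tau> t i + \<tau> *\<^sub>R (\<Sum>m\<in>UNIV. a $ i $ m *\<^sub>R R1 \<tau> t m))"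
    by (intro defect_expansion.plus)
  then show ?thesis
  proof (rule defect_expansion_cong)
    fix \<tau> t i
    define c where "c = rk_node a"
    have "\<tau> *\<^sub>R (\<Sum>m\<in>UNIV. a $ i $ m *\<^sub>R (\<Sum>l<k. ((c m * \<tau>) ^ l / fact l) *\<^sub>R V (Suc l) t)) =
        (\<Sum>l<k. (\<tau> ^ Suc l * (\<Sum>m\<in>UNIV. a $ i $ m * c m ^ l) / fact l) *\<^sub>R V (Suc l) t)"
      unfolding scaleR_sum_right sum_distrib_left sum_divide_distrib scaleR_sum_left
      by (subst sum.swap) (simp add: power_mult_distrib mult_ac)
    moreover have "(\<tau> ^ Suc l * (\<Sum>m\<in>UNIV. a $ i $ m * c m ^ l) / fact l) *\<^sub>R V (Suc l) t
        = g l \<tau> t i + ((c i * \<tau>) ^ Suc l / fact (Suc l)) *\<^sub>R V (Suc l) t" for l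
    proof -
      have "z * S / d = z * (X - n * S) * (- (1 / (n * d))) + X * z / (n * d)" if "d \<noteq> 0" "n \<noteq> 0" for z S X d n :: real
        using that by (simp add: field_simps)
      from this[of "fact l" "real (Suc l)" "\<tau> ^ Suc l"]
      have "\<tau> ^ Suc l * S / fact l = \<tau> ^ Suc l * (x ^ Suc l - real (Suc l) * S) * (- (1 / fact (Suc l))) + (x * \<tau>) ^ Suc l / fact (Suc l)" for S x
        unfolding power_mult_distrib fact_Suc by simp
      then show ?thesis
        unfolding g_def \<phi>_def c_def scaleR_scaleR scaleR_add_left[symmetric] diff_Suc_1 by simp
    qed
    ultimately have "\<tau> *\<^sub>R (\<Sum>m\<in>UNIV. a $ i $ m *\<^sub>R (\<Sum>l<k. ((c m * \<tau>) ^ l / fact l) *\<^sub>R V (Suc l) t)) =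
        (\<Sum>l<k. g l \<tau> t i) + (\<Sum>l<k. ((c i * \<tau>) ^ Suc l / fact (Suc l)) *\<^sub>R V (Suc l) t)"
      by (simp add: sum.distrib)
    moreover have "(\<Sum>l<Suc k. ((c i * \<tau>) ^ l / fact l) *\<^sub>R V l t) = V 0 t + (\<Sum>l<k. ((c i * \<tau>) ^ Suc l / fact (Suc l)) *\<^sub>R V (Suc l) t)"
      unfolding sum.lessThan_Suc_shift by simp
    moreover have "\<tau> *\<^sub>R (\<Sum>m\<in>UNIV. a $ i $ m *\<^sub>R R1 \<tau> t m) = \<tau> *\<^sub>R (\<Sum>m\<in>UNIV. a $ i $ m *\<^sub>R V 1 (node \<tau> t m))
        - \<tau> *\<^sub>R (\<Sum>m\<in>UNIV. a $ i $ m *\<^sub>R (\<Sum>l<k. ((c m * \<tau>) ^ l / fact l) *\<^sub>R V (Suc l) t))"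
      by (simp add: R1_def c_def scaleR_diff_right sum_subtractf)
    ultimately show "(\<Sum>l<k. g l \<tau> t i) + R0 \<tau> t i + \<tau> *\<^sub>R (\<Sum>m\<in>UNIV. a $ i $ m *\<^sub>R R1 \<tau> t m) =
        V 0 t + \<tau> *\<^sub>R (\<Sum>m\<in>UNIV. a $ i $ m *\<^sub>R V 1 (node \<tau> t m)) - V 0 (node \<tau> t i)"
      by (simp add: R0_def c_def algebra_simps)
  qed
qed

lemma quadrature_defect:
  fixes V :: "nat \<Rightarrow> real \<Rightarrow> 'y::real_normed_vector"
  assumes V: "Ck_family (Suc p) {-\<eta>..T + \<eta>} V" and order: "has_classical_order a b p"
  obtains C where "0 \<le> C" "\<And>\<tau> t. admissible \<tau> t \<Longrightarrow> t + \<tau> \<le> T \<Longrightarrow>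
    norm (V 0 (t + \<tau>) - V 0 t - \<tau> *\<^sub>R (\<Sum>i\<in>UNIV. b $ i *\<^sub>R V 1 (node \<tau> t i))) \<le> C * \<tau> ^ (p + 1)"
proof -
  obtain C0 where C0: "C0 > 0" "\<And>t s. t \<in> {-\<eta>..T + \<eta>} \<Longrightarrow> s \<in> {-\<eta>..T + \<eta>} \<Longrightarrow>
      norm (V 0 s - (\<Sum>l<Suc p. ((s - t) ^ l / fact l) *\<^sub>R V l t)) \<le> C0 * \<bar>s - t\<bar> ^ Suc p"
    using Ck_family_Taylor[OF V] by blast
  obtain C1 where C1: "C1 > 0" "\<And>\<tau> t i. admissible \<tau> t \<Longrightarrow>
    norm (V 1 (node \<tau> t i) - (\<Sum>l<p. ((rk_node a i * \<tau>) ^ l / fact l) *\<^sub>R V (Suc l) t)) \<le> C1 * \<tau> ^ p"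
    using node_Taylor[OF Ck_family_Suc[OF V]] by auto
  define \<beta> where "\<beta> = (\<Sum>i\<in>UNIV. \<bar>b $ i\<bar>)"
  have \<beta>: "\<beta> \<ge> 0" by (simp add: \<beta>_def sum_nonneg)
  have "norm (V 0 (t + \<tau>) - V 0 t - \<tau> *\<^sub>R (\<Sum>i\<in>UNIV. b $ i *\<^sub>R V 1 (node \<tau> t i))) \<le> (C0 + \<beta> * C1) * \<tau> ^ (p + 1)"
    if ad: "admissible \<tau> t" and le: "t + \<tau> \<le> T" for \<tau> t
  proof -
    have \<tau>: "\<tau> > 0" using ad by (simp add: admissible_def)
    define c where "c = rk_node a"
    define P where "P i = (\<Sum>l<p. ((c i * \<tau>) ^ l / fact l) *\<^sub>R V (Suc l) t)" for i
    have "\<tau> *\<^sub>R (\<Sum>i\<in>UNIV. b $ i *\<^sub>R P i) = (\<Sum>l<p. (\<tau> ^ Suc l * (\<Sum>i\<in>UNIV. b $ i * c i ^ l) / fact l) *\<^sub>R V (Suc l) t)"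
      unfolding P_def scaleR_sum_right sum_distrib_left sum_divide_distrib scaleR_sum_left
      by (subst sum.swap) (simp add: power_mult_distrib mult_ac)
    also have "\<dots> = (\<Sum>l<p. (\<tau> ^ Suc l / fact (Suc l)) *\<^sub>R V (Suc l) t)"
    proof (intro sum.cong refl arg_cong2[where f=scaleR])
      fix l assume "l \<in> {..<p}"
      then have e: "(\<Sum>i\<in>UNIV. b $ i * c i ^ l) = 1 / real (l + 1)"
        unfolding c_def by (intro quadrature_order_condition[OF order]) auto
      show "\<tau> ^ Suc l * (\<Sum>i\<in>UNIV. b $ i * c i ^ l) / fact l = \<tau> ^ Suc l / fact (Suc l)"
        unfolding e fact_Suc by simp
    qed
    finally have P: "\<tau> *\<^sub>R (\<Sum>i\<in>UNIV. b $ i *\<^sub>R P i) = (\<Sum>l<Suc p. (\<tau> ^ l / fact l) *\<^sub>R V l t) - V 0 t"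
      unfolding sum.lessThan_Suc_shift by simp
    have "V 0 (t + \<tau>) - V 0 t - \<tau> *\<^sub>R (\<Sum>i\<in>UNIV. b $ i *\<^sub>R V 1 (node \<tau> t i)) =
        (V 0 (t + \<tau>) - (\<Sum>l<Suc p. (\<tau> ^ l / fact l) *\<^sub>R V l t)) - \<tau> *\<^sub>R (\<Sum>i\<in>UNIV. b $ i *\<^sub>R (V 1 (node \<tau> t i) - P i))"
      unfolding scaleR_diff_right sum_subtractf P by simp
    also have "norm \<dots> \<le> C0 * \<tau> ^ (p + 1) + \<tau> * (\<beta> * (C1 * \<tau> ^ p))"
    proof (rule order_trans[OF norm_triangle_ineq4], rule add_mono)
      show "norm (V 0 (t + \<tau>) - (\<Sum>l<Suc p. (\<tau> ^ l / fact l) *\<^sub>R V l t)) \<le> C0 * \<tau> ^ (p + 1)"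
        using C0(2)[of t "t + \<tau>"] ad le \<tau> \<eta> admissible_time[OF ad] by simp
      have "norm (\<Sum>i\<in>UNIV. b $ i *\<^sub>R (V 1 (node \<tau> t i) - P i)) \<le> \<beta> * (C1 * \<tau> ^ p)"
        unfolding \<beta>_def P_def c_def by (intro norm_weighted_sum_le C1(2) ad)
      then show "norm (\<tau> *\<^sub>R (\<Sum>i\<in>UNIV. b $ i *\<^sub>R (V 1 (node \<tau> t i) - P i))) \<le> \<tau> * (\<beta> * (C1 * \<tau> ^ p))"
        using \<tau> by simp
    qed
    finally show ?thesis by (simp add: algebra_simps)
  qed
  then show thesis using that[of "C0 + \<beta> * C1"] C0(1) C1(1) \<beta> by simp
qed

end

section \<open>Reference stages with small defects\<close>

lemma bounded_linear_funpow:
  fixes f :: "'y::real_normed_vector \<Rightarrow> 'y"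
  assumes "bounded_linear f" shows "bounded_linear (f ^^ k)"
proof (induction k)
  case 0
  show ?case by (simp add: id_def bounded_linear_ident)
next
  case (Suc k)
  show ?case using bounded_linear_compose[OF assms Suc] by (simp add: o_def)
qed

text \<open>
  The abstract form of the evolution equation: on the range of \<open>K ^ k\<close>, which plays the role of the
  domain of the \<open>k\<close>-th power of the inverse of \<open>K\<close>, the right-hand side at the point \<open>y\<close> takes
  \<open>K ^ k z\<close> to \<open>K ^ (k - 1) (Q k y z)\<close>. The equation itself reads \<open>u' = Q 1 u z\<close> with \<open>u = K z\<close>. All
  operators \<open>Q k y\<close> are bounded; the loss of regularity is the loss of one power of \<open>K\<close>.
\<close>

locale regularity_scale =
  fixes K :: "'y::real_normed_vector \<Rightarrow> 'y" and Q :: "nat \<Rightarrow> 'y \<Rightarrow> 'y \<Rightarrow>\<^sub>L 'y" and r :: nat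
  assumes K_linear: "bounded_linear K" and K_norm: "norm (K y) \<le> norm y"
    and r: "1 \<le> r"
    and smooth: "1 \<le> k \<Longrightarrow> k \<le> r \<Longrightarrow> smooth_bounded_on_balls (Q k)"
    and compat: "1 \<le> k \<Longrightarrow> k < r \<Longrightarrow> K (blinfun_apply (Q (Suc k) y) z) = blinfun_apply (Q k y) (K z)"
begin

sublocale K: bounded_linear K by (rule K_linear)

lemma K_power_norm: "norm ((K ^^ k) y) \<le> norm y"
  by (induction k) (auto intro: order_trans[OF K_norm])

text \<open>The derivative of \<open>Q k\<close>, chosen among all families of operators so that it is smooth itself.\<close>

definition dQ :: "nat \<Rightarrow> 'y \<Rightarrow> 'y \<Rightarrow>\<^sub>L 'y \<Rightarrow>\<^sub>L 'y"
  where "dQ k = (SOME D. smooth_bounded_on_balls D \<and>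
    (\<forall>y S. (Q k has_derivative blinfun_apply (D y)) (at y within S)))"

lemma dQ:
  assumes "1 \<le> k" "k \<le> r"
  shows "smooth_bounded_on_balls (dQ k)" "(Q k has_derivative blinfun_apply (dQ k y)) (at y within S)"
proof -
  obtain D where D: "smooth_bounded_on_balls D" "\<And>y S. (Q k has_derivative blinfun_apply (D y)) (at y within S)"
    using smooth_bounded_derivative[OF smooth[OF assms]] by blast
  then have "\<exists>D. smooth_bounded_on_balls D \<and> (\<forall>y S. (Q k has_derivative blinfun_apply (D y)) (at y within S))"
    by (intro exI[of _ D]) simp
  then have P: "smooth_bounded_on_balls (dQ k) \<and> (\<forall>y S. (Q k has_derivative blinfun_apply (dQ k y)) (at y within S))"
    unfolding dQ_def by (rule someI_ex)
  show "smooth_bounded_on_balls (dQ k)" using P by (rule conjunct1)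
  show "(Q k has_derivative blinfun_apply (dQ k y)) (at y within S)" using P by simp
qed

lemma dQ_compat:
  assumes "1 \<le> k" "k < r"
  shows "K (blinfun_apply (blinfun_apply (dQ (Suc k) y) h) x) = blinfun_apply (blinfun_apply (dQ k y) h) (K x)"
proof -
  have "((\<lambda>y. K (blinfun_apply (Q (Suc k) y) x)) has_derivative (\<lambda>h. K (blinfun_apply (blinfun_apply (dQ (Suc k) y) h) x))) (at y)"
    using dQ(2)[of "Suc k" y UNIV] assms
    by (intro K.has_derivative bounded_linear.has_derivative[OF blinfun.bounded_linear_left]) auto
  moreover have "((\<lambda>y. blinfun_apply (Q k y) (K x)) has_derivative (\<lambda>h. blinfun_apply (blinfun_apply (dQ k y) h) (K x))) (at y)"
    using dQ(2)[of k y UNIV] assms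
    by (intro bounded_linear.has_derivative[OF blinfun.bounded_linear_left]) auto
  ultimately show ?thesis
    using has_derivative_unique unfolding compat[OF assms] by metis
qed

text \<open>
  The part of the linearized right-hand side in which the operator is differentiated: the derivative
  in the direction \<open>K ^ k z\<close> is applied to the fixed element \<open>x\<close>, and the result is an operator in \<open>z\<close>.
\<close>

definition freeze :: "nat \<Rightarrow> ('y \<Rightarrow>\<^sub>L 'y \<Rightarrow>\<^sub>L 'y) \<Rightarrow> 'y \<Rightarrow> 'y \<Rightarrow>\<^sub>L 'y"
  where "freeze k D x = Blinfun (\<lambda>z. blinfun_apply (blinfun_apply D ((K ^^ k) z)) x)"

lemma freeze_apply: "blinfun_apply (freeze k D x) z = blinfun_apply (blinfun_apply D ((K ^^ k) z)) x"
proof -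
  have "bounded_linear (\<lambda>z. blinfun_apply (blinfun_apply D ((K ^^ k) z)) x)"
    by (rule bounded_linear_compose[OF blinfun.bounded_linear_left
          bounded_linear_compose[OF blinfun.bounded_linear_right bounded_linear_funpow[OF K_linear]]])
  then show ?thesis by (simp add: freeze_def bounded_linear_Blinfun_apply)
qed

lemma freeze_bilinear: "bounded_bilinear (freeze k)"
proof
  show "freeze k (D + D') x = freeze k D x + freeze k D' x" for D D' x
    by (rule blinfun_eqI) (simp add: freeze_apply blinfun.add_left)
  show "freeze k D (x + x') = freeze k D x + freeze k D x'" for D x x'
    by (rule blinfun_eqI) (simp add: freeze_apply blinfun.add_left blinfun.add_right)
  show "freeze k (c *\<^sub>R D) x = c *\<^sub>R freeze k D x" for c D x
    by (rule blinfun_eqI) (simp add: freeze_apply blinfun.scaleR_left)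
  show "freeze k D (c *\<^sub>R x) = c *\<^sub>R freeze k D x" for c D x
    by (rule blinfun_eqI) (simp add: freeze_apply blinfun.scaleR_left blinfun.scaleR_right)
  have "norm (freeze k D x) \<le> norm D * norm x * 1" for D x
  proof (rule norm_blinfun_bound)
    fix z
    have "norm (blinfun_apply (freeze k D x) z) \<le> norm (blinfun_apply D ((K ^^ k) z)) * norm x"
      unfolding freeze_apply by (rule norm_blinfun)
    also have "\<dots> \<le> (norm D * norm z) * norm x"
      by (intro mult_right_mono order_trans[OF norm_blinfun] mult_left_mono K_power_norm) auto
    finally show "norm (blinfun_apply (freeze k D x) z) \<le> norm D * norm x * 1 * norm z" by (simp add: mult_ac)
  qed simp
  then show "\<exists>C. \<forall>D x. norm (freeze k D x) \<le> norm D * norm x * C" by blast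
qed

text \<open>
  The derivative of the right-hand side at \<open>y = K ^ k x\<close>, acting on the range of \<open>K ^ k\<close>.
\<close>

definition linearization :: "nat \<Rightarrow> 'y \<Rightarrow> 'y \<Rightarrow> 'y \<Rightarrow>\<^sub>L 'y"
  where "linearization k y x = Q k y + freeze k (dQ k y) x"

lemma linearization_apply:
  "blinfun_apply (linearization k y x) z = blinfun_apply (Q k y) z + blinfun_apply (blinfun_apply (dQ k y) ((K ^^ k) z)) x"
  by (simp add: linearization_def blinfun.add_left freeze_apply)

lemma linearization_compat:
  assumes "1 \<le> k" "k < r"
  shows "K (blinfun_apply (linearization (Suc k) y x) z) = blinfun_apply (linearization k y (K x)) (K z)"
  by (simp add: linearization_apply K.add compat[OF assms] dQ_compat[OF assms] funpow_swap1)

lemma linearization_Ck_on: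
  assumes "1 \<le> k" "k \<le> r" "Ck_on n I y" "Ck_on n I x"
  shows "Ck_on n I (\<lambda>t. linearization k (y t) (x t))"
  unfolding linearization_def
  by (intro Ck_on_add Ck_on_bilinear[OF freeze_bilinear] smooth_compose_Ck_on[of "Q k"] smooth_compose_Ck_on[of "dQ k"]
      assms smooth dQ)

lemma linearization_remainder:
  assumes "0 < R"
  obtains C where "0 < C" "\<And>y x z. norm y \<le> R \<Longrightarrow> norm (y + K z) \<le> R \<Longrightarrow>
    norm (blinfun_apply (Q 1 (y + K z)) (x + z) - blinfun_apply (Q 1 y) x - blinfun_apply (linearization 1 y x) z)
      \<le> C * (1 + norm x) * (norm z)\<^sup>2"
proof -
  obtain L1 where L1: "L1 > 0" "\<And>y z. norm y \<le> R \<Longrightarrow> norm z \<le> R \<Longrightarrow> norm (Q 1 y - Q 1 z) \<le> L1 * norm (y - z)"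
    using smooth_bounded_Lipschitz[OF smooth[OF order_refl r] assms] by blast
  obtain L2 where L2: "L2 > 0" "\<And>y h. norm y \<le> R \<Longrightarrow> norm (y + h) \<le> R \<Longrightarrow>
    norm (Q 1 (y + h) - Q 1 y - blinfun_apply (dQ 1 y) h) \<le> L2 * (norm h)\<^sup>2"
    using smooth_bounded_quadratic[OF dQ[OF order_refl r] assms] by blast
  have "norm (blinfun_apply (Q 1 (y + K z)) (x + z) - blinfun_apply (Q 1 y) x - blinfun_apply (linearization 1 y x) z)
      \<le> (L1 + L2) * (1 + norm x) * (norm z)\<^sup>2" if y: "norm y \<le> R" "norm (y + K z) \<le> R" for x y z
  proof -
    have "blinfun_apply (Q 1 (y + K z)) (x + z) - blinfun_apply (Q 1 y) x - blinfun_apply (linearization 1 y x) z =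
        blinfun_apply (Q 1 (y + K z) - Q 1 y - blinfun_apply (dQ 1 y) (K z)) x + blinfun_apply (Q 1 (y + K z) - Q 1 y) z"
      by (simp add: linearization_apply blinfun.diff_left blinfun.add_right)
    also have "norm \<dots> \<le> (L2 * (norm z)\<^sup>2) * norm x + (L1 * norm z) * norm z"
    proof (intro norm_triangle_mono order_trans[OF norm_blinfun] mult_right_mono norm_ge_zero)
      have "norm (Q 1 (y + K z) - Q 1 y - blinfun_apply (dQ 1 y) (K z)) \<le> L2 * (norm (K z))\<^sup>2" by (rule L2(2)[OF y])
      also have "\<dots> \<le> L2 * (norm z)\<^sup>2" using L2(1) K_norm by (intro mult_left_mono power_mono) auto
      finally show "norm (Q 1 (y + K z) - Q 1 y - blinfun_apply (dQ 1 y) (K z)) \<le> L2 * (norm z)\<^sup>2" .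
      have "norm (Q 1 (y + K z) - Q 1 y) \<le> L1 * norm (y + K z - y)" by (rule L1(2)[OF y(2,1)])
      also have "\<dots> \<le> L1 * norm z" using L1(1) K_norm by simp
      finally show "norm (Q 1 (y + K z) - Q 1 y) \<le> L1 * norm z" .
    qed
    also have "\<dots> = (L2 * norm x + L1) * (norm z)\<^sup>2" by (simp add: algebra_simps power2_eq_square)
    also have "\<dots> \<le> ((L1 + L2) * (1 + norm x)) * (norm z)\<^sup>2"
      using L1(1) L2(1) by (intro mult_right_mono) (auto simp: algebra_simps)
    finally show ?thesis .
  qed
  then show thesis using that[of "L1 + L2"] L1(1) L2(1) by simp
qed

text \<open>
  Inserting the solution at the nodes leaves defects of order \<open>q + 1\<close> in the stage equations. They are
  removed by \<open>r\<close> steps of a fixed-point iteration for the linearized stage equations. Each step gains one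
  power of the step size and costs one power of \<open>K\<close>, and the remaining error in the update consists of
  terms that the order conditions annihilate. The nonlinear remainder is quadratic in the corrections
  and thus of order \<open>2 q + 2\<close>.
\<close>

lemma reference_stages:
  fixes a :: "real^'m^'m" and b :: "real^'m" and v :: "nat \<Rightarrow> real \<Rightarrow> 'y"
  assumes order: "has_classical_order a b p" and stage: "has_stage_order a q"
    and rpq: "p = q + r" "r \<le> q" and T: "0 < T"
    and v_Ck: "\<And>k. k \<le> r \<Longrightarrow> Ck_on (p + 1 - k) {0..T} (v k)"
    and v_compat: "\<And>k t. k < r \<Longrightarrow> t \<in> {0..T} \<Longrightarrow> K (v (Suc k) t) = v k t"
    and ode: "\<And>t. t \<in> {0..T} \<Longrightarrow> (v 0 has_vector_derivative blinfun_apply (Q 1 (v 0 t)) (v 1 t)) (at t within {0..T})"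
  shows "\<exists>C>0. \<exists>\<tau>1>0. \<forall>\<tau> t. 0 < \<tau> \<longrightarrow> \<tau> \<le> \<tau>1 \<longrightarrow> 0 \<le> t \<longrightarrow> t + \<tau> \<le> T \<longrightarrow>
    (\<exists>Z. (\<forall>i. norm (Z i) \<le> C) \<and>
      (\<forall>i. norm (K (Z i) - v 0 t - \<tau> *\<^sub>R (\<Sum>k\<in>UNIV. a $ i $ k *\<^sub>R blinfun_apply (Q 1 (K (Z k))) (Z k))) \<le> C * \<tau> ^ (p + 1)) \<and>
      norm (v 0 (t + \<tau>) - v 0 t - \<tau> *\<^sub>R (\<Sum>i\<in>UNIV. b $ i *\<^sub>R blinfun_apply (Q 1 (K (Z i))) (Z i))) \<le> C * \<tau> ^ (p + 1))"
proof -
  \<comment> \<open>Reflections of order \<open>p + 2\<close> preserve \<open>p + 1\<close> derivatives; \<open>\<eta>\<close> keeps the reflected points in \<open>[0, T]\<close>.\<close>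
  define N where "N = p + 2"
  define \<eta> where "\<eta> = T / (2 * real N)"
  have eta: "0 < \<eta>" "0 \<le> \<eta>" "\<eta> * (2 * real N) \<le> T" using T by (auto simp: \<eta>_def N_def)
  define cs where "cs = 1 + (\<Sum>i\<in>UNIV. \<bar>rk_node a i\<bar>)"
  have cs: "\<bar>rk_node a i\<bar> \<le> cs" "1 \<le> cs" for i
  proof -
    have "\<bar>rk_node a i\<bar> \<le> (\<Sum>i\<in>UNIV. \<bar>rk_node a i\<bar>)" by (intro member_le_sum) auto
    then show "\<bar>rk_node a i\<bar> \<le> cs" by (simp add: cs_def)
    show "1 \<le> cs" by (simp add: cs_def sum_nonneg)
  qed
  define \<tau>1 where "\<tau>1 = min 1 (\<eta> / cs)"
  have \<tau>1: "0 < \<tau>1" "\<tau>1 \<le> 1" "cs * \<tau>1 \<le> \<eta>"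
    using eta(1) cs(2) by (auto simp: \<tau>1_def min_def field_simps)
  interpret rk_window a T \<eta> \<tau>1
  proof
    show "\<bar>rk_node a i\<bar> * \<tau>1 \<le> \<eta>" for i
      using mult_right_mono[OF cs(1)[of i], of \<tau>1] \<tau>1 by linarith
  qed (use T eta \<tau>1 in auto)
  define I where "I = {-\<eta>..T + \<eta>}"
  have sub: "{0..T} \<subseteq> I" using eta by (auto simp: I_def)
  have node_I: "admissible \<tau> t \<Longrightarrow> node \<tau> t i \<in> I" for \<tau> t i
    unfolding I_def by (rule admissible_node)
  have time_I: "admissible \<tau> t \<Longrightarrow> t \<in> I" for \<tau> t
    unfolding I_def by (rule admissible_time)

  define V where "V k = extend N T (v k)" for k
  have V_eq: "V k t = v k t" if "t \<in> {0..T}" for k t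
    using that by (simp add: V_def extend_eq N_def)
  have V_Ck: "Ck_on (p + 1 - k) I (V k)" if "k \<le> r" for k
    unfolding V_def I_def by (rule Ck_on_extend[OF v_Ck[OF that] _ eta(2,3)]) (simp add: N_def)
  have V_compat: "K (V (Suc k) s) = V k s" if "k < r" "s \<in> I" for k s
    unfolding V_def using that unfolding I_def
    by (intro extend_linear[OF K.linear_axioms _ eta(2,3)] v_compat) auto
  have "\<forall>k. \<exists>F. k \<le> r \<longrightarrow> (\<forall>s\<in>I. F 0 s = V k s) \<and> Ck_family (p + 1 - k) I F"
    using V_Ck unfolding Ck_on_iff_family by blast
  then obtain Vf where Vf0: "\<And>k s. k \<le> r \<Longrightarrow> s \<in> I \<Longrightarrow> Vf k 0 s = V k s"
    and Vf: "\<And>k. k \<le> r \<Longrightarrow> Ck_family (p + 1 - k) I (Vf k)"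
    by metis
  have V_deriv: "(V k has_vector_derivative Vf k 1 s) (at s within I)" if "k \<le> r" "s \<in> I" for k s
  proof (rule has_vector_derivative_transform[OF that(2)])
    show "(Vf k 0 has_vector_derivative Vf k 1 s) (at s within I)"
      using Vf[OF that(1)] that rpq unfolding Ck_family_def by auto
  qed (simp add: Vf0 that)
  have Vf1_compat: "K (Vf (Suc k) 1 s) = Vf k 1 s" if "k < r" "s \<in> I" for k s
  proof (rule vector_derivative_unique_within_closed_interval[of "-\<eta>" "T + \<eta>" s "V k"])
    show "s \<in> cbox (-\<eta>) (T + \<eta>)" using that by (simp add: I_def)
    have "((\<lambda>s. K (V (Suc k) s)) has_vector_derivative K (Vf (Suc k) 1 s)) (at s within I)"
      by (intro K.has_vector_derivative V_deriv) (use that in auto)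
    then have "(V k has_vector_derivative K (Vf (Suc k) 1 s)) (at s within I)"
      by (rule has_vector_derivative_transform[OF that(2), rotated]) (simp add: V_compat that)
    then show "(V k has_vector_derivative K (Vf (Suc k) 1 s)) (at s within cbox (-\<eta>) (T + \<eta>))" by (simp add: I_def)
    show "(V k has_vector_derivative Vf k 1 s) (at s within cbox (-\<eta>) (T + \<eta>))"
      using V_deriv[of k s] that by (simp add: I_def)
  qed (use T eta in auto)

  define L where "L k s = linearization k (V 0 s) (V k s)" for k s
  have "Ck_on (r - 1) I (L k)" if "1 \<le> k" "k \<le> r" for k
    unfolding L_def using that rpq
    by (intro linearization_Ck_on Ck_on_mono[OF V_Ck]) auto
  then have "\<forall>k. \<exists>F. 1 \<le> k \<and> k \<le> r \<longrightarrow> (\<forall>s\<in>I. F 0 s = L k s) \<and> Ck_family (r - 1) I F"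
    unfolding Ck_on_iff_family by blast
  then obtain Lf where Lf0: "\<And>k s. 1 \<le> k \<Longrightarrow> k \<le> r \<Longrightarrow> s \<in> I \<Longrightarrow> Lf k 0 s = L k s"
    and Lf: "\<And>k. 1 \<le> k \<Longrightarrow> k \<le> r \<Longrightarrow> Ck_family (r - 1) I (Lf k)"
    by metis
  have L_compat: "K (blinfun_apply (L (Suc k) s) z) = blinfun_apply (L k s) (K z)" if "1 \<le> k" "k < r" "s \<in> I" for k s z
    using that by (simp add: L_def linearization_compat V_compat)
  have expansion_L: "defect_expansion q n (\<lambda>\<tau> t i. blinfun_apply (L k (node \<tau> t i)) (f \<tau> t i))"
    if f: "defect_expansion q n f" and k: "1 \<le> k" "k \<le> r" and n: "n \<le> p" for f :: "real \<Rightarrow> real \<Rightarrow> 'm \<Rightarrow> 'y" and k n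
  proof (rule defect_expansion_cong)
    show "defect_expansion q n (\<lambda>\<tau> t i. blinfun_apply (Lf k 0 (node \<tau> t i)) (f \<tau> t i))"
      by (rule defect_expansion_operator[OF Lf[OF k, unfolded I_def] _ f]) (use n rpq r in auto)
    show "blinfun_apply (Lf k 0 (node \<tau> t i)) (f \<tau> t i) = blinfun_apply (L k (node \<tau> t i)) (f \<tau> t i)"
      if "admissible \<tau> t" for \<tau> t i
      using Lf0[OF k node_I[OF that]] by simp
  qed

  \<comment> \<open>The extended solution satisfies the equation up to a residual that is flat at the end points.\<close>
  define w where "w s = Vf 0 1 s - blinfun_apply (Q 1 (V 0 s)) (V 1 s)" for s
  have w_Ck: "Ck_on p I w"
  proof -
    have "Ck_on p I (Vf 0 1)"
      using Ck_family_Suc[of p I "Vf 0"] Vf[of 0] unfolding Ck_on_iff_family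
      by (intro exI[of _ "\<lambda>i. Vf 0 (Suc i)"]) auto
    moreover have "Ck_on p I (\<lambda>s. blinfun_apply (Q 1 (V 0 s)) (V 1 s))"
      by (intro Ck_on_bilinear[OF bounded_bilinear_blinfun_apply] smooth_compose_Ck_on[of "Q 1"] smooth)
        (use r Ck_on_mono[OF V_Ck[of 0], of p] V_Ck[of 1] in auto)
    ultimately show ?thesis
      using Ck_on_add[OF _ Ck_on_bounded_linear[OF bounded_linear_minus[OF bounded_linear_ident]]]
      by (fastforce simp: w_def[abs_def])
  qed
  have w_zero: "w t = 0" if t: "t \<in> {0..T}" for t
  proof -
    have "(V 0 has_vector_derivative Vf 0 1 t) (at t within {0..T})"
      using V_deriv[of 0 t] t sub has_vector_derivative_within_subset by blast
    then have "(v 0 has_vector_derivative Vf 0 1 t) (at t within {0..T})"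
      by (rule has_vector_derivative_transform[OF t, rotated]) (simp add: V_eq)
    from vector_derivative_unique_within_closed_interval[OF T _ this[folded cbox_interval] ode[OF t, folded cbox_interval]] t
    show ?thesis by (simp add: w_def V_eq)
  qed
  from Ck_on_vanishing_bound[OF w_Ck[unfolded I_def] w_zero T eta(2)]
  obtain Cw where Cw: "Cw > 0" "\<And>t s. t \<in> {0..T} \<Longrightarrow> s \<in> I \<Longrightarrow> norm (w s) \<le> Cw * \<bar>s - t\<bar> ^ p"
    unfolding I_def by blast
  have w_bound: "norm (w (node \<tau> t i)) \<le> (Cw * cs ^ p) * \<tau> ^ p" if ad: "admissible \<tau> t" for \<tau> t i
  proof -
    have "norm (w (node \<tau> t i)) \<le> Cw * \<bar>node \<tau> t i - t\<bar> ^ p"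
      using ad by (intro Cw(2) node_I) (auto simp: admissible_def)
    also have "\<bar>node \<tau> t i - t\<bar> ^ p \<le> (cs * \<tau>) ^ p"
      using ad cs(1)[of i] by (intro power_mono) (auto simp: node_def abs_mult admissible_def intro!: mult_right_mono)
    finally show ?thesis using Cw(1) by (simp add: power_mult_distrib mult.assoc)
  qed

  \<comment> \<open>\<open>H m s\<close> represents the correction of the \<open>m\<close>-th step as an element of the range of \<open>K ^ s\<close>.\<close>
  define H where "H = rec_nat
    (\<lambda>s \<tau> t i. Vf s 0 t + \<tau> *\<^sub>R (\<Sum>m\<in>UNIV. a $ i $ m *\<^sub>R Vf s 1 (node \<tau> t m)) - Vf s 0 (node \<tau> t i))
    (\<lambda>m Hm s \<tau> t i. \<tau> *\<^sub>R (\<Sum>l\<in>UNIV. a $ i $ l *\<^sub>R blinfun_apply (L (Suc s) (node \<tau> t l)) (Hm (Suc s) \<tau> t l)))"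
  have H0: "H 0 s \<tau> t i = Vf s 0 t + \<tau> *\<^sub>R (\<Sum>m\<in>UNIV. a $ i $ m *\<^sub>R Vf s 1 (node \<tau> t m)) - Vf s 0 (node \<tau> t i)"
    and H_Suc: "H (Suc m) s \<tau> t i = \<tau> *\<^sub>R (\<Sum>l\<in>UNIV. a $ i $ l *\<^sub>R blinfun_apply (L (Suc s) (node \<tau> t l)) (H m (Suc s) \<tau> t l))"
    for m s \<tau> t i by (simp_all add: H_def)
  have H_expansion: "s + m \<le> r \<Longrightarrow> defect_expansion q (p + 1 - s) (H m s)" for m s
  proof (induction m arbitrary: s)
    case 0
    then have "p + 1 - s = Suc (p - s)" using rpq by simp
    with stage_defect_expansion[OF _ stage, of "p - s" "Vf s"] Vf[of s] 0
    show ?case by (simp add: H0[abs_def] I_def)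
  next
    case (Suc m)
    have "defect_expansion q (p + 1 - Suc s) (H m (Suc s))" by (rule Suc.IH) (use Suc.prems in simp)
    then have "defect_expansion q (p - s) (\<lambda>\<tau> t i. blinfun_apply (L (Suc s) (node \<tau> t i)) (H m (Suc s) \<tau> t i))"
      by (intro expansion_L) (use Suc.prems in auto)
    from defect_expansion_matrix[OF this]
    have "defect_expansion q (Suc (p - s)) (H (Suc m) s)" by (simp add: H_Suc[abs_def])
    moreover have "Suc (p - s) = p + 1 - s" using Suc.prems rpq by simp
    ultimately show ?case by simp
  qed
  have H_compat: "K (H m (Suc s) \<tau> t i) = H m s \<tau> t i" if ad: "admissible \<tau> t" and "Suc s + m \<le> r" for m s \<tau> t i
    using that(2)
  proof (induction m arbitrary: s i)
    case 0
    then have "s < r" by simp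
    then show ?case
      using node_I[OF ad] time_I[OF ad]
      by (simp add: H0 K.add K.diff K.scaleR K.sum Vf1_compat Vf0 V_compat del: One_nat_def)
  next
    case (Suc m)
    have "K (blinfun_apply (L (Suc (Suc s)) (node \<tau> t l)) (H m (Suc (Suc s)) \<tau> t l)) =
        blinfun_apply (L (Suc s) (node \<tau> t l)) (H m (Suc s) \<tau> t l)" for l
      using L_compat[of "Suc s" "node \<tau> t l"] Suc.IH[of "Suc s" l] Suc.prems node_I[OF ad] by simp
    then show ?case by (simp add: H_Suc K.scaleR K.sum)
  qed
  have H_bound: "s + m \<le> r \<Longrightarrow> \<exists>C\<ge>0. \<forall>\<tau> t i. admissible \<tau> t \<longrightarrow> norm (H m s \<tau> t i) \<le> C * \<tau> ^ (q + 1 + m)" for m s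
  proof (induction m arbitrary: s)
    case 0
    then show ?case using defect_expansion_bound[OF H_expansion[of s 0]] rpq by simp
  next
    case (Suc m)
    then have "Suc s + m \<le> r" by simp
    from Suc.IH[OF this]
    obtain C where C: "C \<ge> 0" "\<And>\<tau> t i. admissible \<tau> t \<Longrightarrow> norm (H m (Suc s) \<tau> t i) \<le> C * \<tau> ^ (q + 1 + m)"
      by blast
    have s: "1 \<le> Suc s" "Suc s \<le> r" using Suc.prems by auto
    obtain B where B: "B > 0" "\<And>x. x \<in> I \<Longrightarrow> norm (Lf (Suc s) 0 x) \<le> B"
      using Ck_family_bounded[OF Lf[OF s, unfolded I_def], of 0] unfolding I_def by blast
    define c where "c = (\<Sum>i\<in>UNIV. \<Sum>m\<in>UNIV. \<bar>a $ i $ m\<bar>)"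
    have c: "(\<Sum>m\<in>UNIV. \<bar>a $ i $ m\<bar>) \<le> c" for i
      unfolding c_def by (intro member_le_sum[of i UNIV "\<lambda>i. \<Sum>m\<in>UNIV. \<bar>a $ i $ m\<bar>"]) (auto intro!: sum_nonneg)
    have c0: "0 \<le> c" by (simp add: c_def sum_nonneg)
    show ?case
    proof (intro exI[of _ "c * (B * C)"] conjI allI impI)
      show "0 \<le> c * (B * C)" using c0 B C by simp
      fix \<tau> t i assume ad: "admissible \<tau> t"
      then have \<tau>: "\<tau> > 0" by (simp add: admissible_def)
      have "norm (blinfun_apply (L (Suc s) (node \<tau> t l)) (H m (Suc s) \<tau> t l)) \<le> B * (C * \<tau> ^ (q + 1 + m))" for l
        using B C(2)[OF ad, of l] node_I[OF ad, of l] Lf0[OF s] C(1)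
        by (intro order_trans[OF norm_blinfun] mult_mono) fastforce+
      then have "norm (\<Sum>l\<in>UNIV. a $ i $ l *\<^sub>R blinfun_apply (L (Suc s) (node \<tau> t l)) (H m (Suc s) \<tau> t l)) \<le>
          (\<Sum>m\<in>UNIV. \<bar>a $ i $ m\<bar>) * (B * (C * \<tau> ^ (q + 1 + m)))"
        by (rule norm_weighted_sum_le)
      also have "\<dots> \<le> c * (B * (C * \<tau> ^ (q + 1 + m)))"
        using c B C(1) \<tau> by (intro mult_right_mono) auto
      finally have "\<tau> * norm (\<Sum>l\<in>UNIV. a $ i $ l *\<^sub>R blinfun_apply (L (Suc s) (node \<tau> t l)) (H m (Suc s) \<tau> t l)) \<le>
          \<tau> * (c * (B * (C * \<tau> ^ (q + 1 + m))))" using \<tau> by (intro mult_left_mono) auto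
      then show "norm (H (Suc m) s \<tau> t i) \<le> c * (B * C) * \<tau> ^ (q + 1 + Suc m)"
        using \<tau> by (simp add: H_Suc mult_ac)
    qed
  qed

  \<comment> \<open>The accumulated correction, represented in the range of \<open>K\<close>.\<close>
  define \<zeta> where "\<zeta> \<tau> t i = (\<Sum>m<r. H m 1 \<tau> t i)" for \<tau> t i
  have \<zeta>_expansion: "defect_expansion q p \<zeta>"
    unfolding \<zeta>_def using H_expansion[of 1] by (intro defect_expansion_sum) auto
  obtain C\<zeta> where C\<zeta>: "0 \<le> C\<zeta>" "\<And>\<tau> t i. admissible \<tau> t \<Longrightarrow> norm (\<zeta> \<tau> t i) \<le> C\<zeta> * \<tau> ^ (q + 1)"
    using defect_expansion_bound[OF \<zeta>_expansion] rpq r by auto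
  have K\<zeta>: "K (\<zeta> \<tau> t i) = (\<Sum>m<r. H m 0 \<tau> t i)" if "admissible \<tau> t" for \<tau> t i
    unfolding \<zeta>_def K.sum using H_compat[OF that, of 0] by (intro sum.cong) auto
  have L\<zeta>: "\<tau> *\<^sub>R (\<Sum>l\<in>UNIV. a $ i $ l *\<^sub>R blinfun_apply (L 1 (node \<tau> t l)) (\<zeta> \<tau> t l)) = (\<Sum>m<r. H (Suc m) 0 \<tau> t i)" for \<tau> t i
    unfolding \<zeta>_def H_Suc blinfun.sum_right scaleR_sum_right by (subst sum.swap) simp
  obtain Cu where Cu: "0 \<le> Cu" "\<And>\<tau> t. admissible \<tau> t \<Longrightarrow>
      norm (\<tau> *\<^sub>R (\<Sum>i\<in>UNIV. b $ i *\<^sub>R blinfun_apply (L 1 (node \<tau> t i)) (\<zeta> \<tau> t i))) \<le> Cu * \<tau> ^ (p + 1)"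
    using defect_expansion_update[OF order order_refl expansion_L[OF \<zeta>_expansion order_refl r order_refl]] by blast
  obtain Cq where Cq: "0 \<le> Cq" "\<And>\<tau> t. admissible \<tau> t \<Longrightarrow> t + \<tau> \<le> T \<Longrightarrow>
    norm (Vf 0 0 (t + \<tau>) - Vf 0 0 t - \<tau> *\<^sub>R (\<Sum>i\<in>UNIV. b $ i *\<^sub>R Vf 0 1 (node \<tau> t i))) \<le> Cq * \<tau> ^ (p + 1)"
    using quadrature_defect[OF _ order, of "Vf 0"] Vf[of 0] unfolding I_def by auto
  obtain Cr where Cr: "0 \<le> Cr" "\<And>\<tau> t i. admissible \<tau> t \<Longrightarrow> norm (H r 0 \<tau> t i) \<le> Cr * \<tau> ^ (p + 1)"
    using H_bound[of 0 r] rpq by auto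
  obtain B0 where B0: "B0 > 0" "\<And>s. s \<in> I \<Longrightarrow> norm (V 0 s) \<le> B0"
    using Ck_family_bounded[OF Vf[of 0, unfolded I_def], of 0] Vf0[of 0] unfolding I_def by auto
  obtain B1 where B1: "B1 > 0" "\<And>s. s \<in> I \<Longrightarrow> norm (V 1 s) \<le> B1"
    using Ck_family_bounded[OF Vf[of 1, unfolded I_def], of 0] Vf0[of 1] r unfolding I_def by auto
  have \<zeta>_le: "norm (\<zeta> \<tau> t i) \<le> C\<zeta>" if ad: "admissible \<tau> t" for \<tau> t i
    using admissible_mult_power_mono[OF ad le0 C\<zeta>(1) C\<zeta>(2)[OF ad, of i]] by simp
  have "0 < B0 + C\<zeta>" using B0 C\<zeta> by simp
  then obtain Cn where Cn: "0 < Cn" "\<And>y x z. norm y \<le> B0 + C\<zeta> \<Longrightarrow> norm (y + K z) \<le> B0 + C\<zeta> \<Longrightarrow>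
    norm (blinfun_apply (Q 1 (y + K z)) (x + z) - blinfun_apply (Q 1 y) x - blinfun_apply (linearization 1 y x) z)
      \<le> Cn * (1 + norm x) * (norm z)\<^sup>2"
    using linearization_remainder by blast
  define Z where "Z \<tau> t i = V 1 (node \<tau> t i) + \<zeta> \<tau> t i" for \<tau> t i
  \<comment> \<open>What remains of the defects: the residual and the terms that are quadratic in the correction.\<close>
  define e where "e \<tau> t i = w (node \<tau> t i) - (blinfun_apply (Q 1 (K (Z \<tau> t i))) (Z \<tau> t i)
    - blinfun_apply (Q 1 (V 0 (node \<tau> t i))) (V 1 (node \<tau> t i)) - blinfun_apply (L 1 (node \<tau> t i)) (\<zeta> \<tau> t i))" for \<tau> t i
  define Ce where "Ce = Cw * cs ^ p + Cn * (1 + B1) * C\<zeta>\<^sup>2"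
  have Ce0: "0 \<le> Ce" using Cw(1) Cn(1) B1(1) cs(2) by (simp add: Ce_def)
  have KZ: "K (Z \<tau> t i) = V 0 (node \<tau> t i) + K (\<zeta> \<tau> t i)" if ad: "admissible \<tau> t" for \<tau> t i
    using V_compat[of 0 "node \<tau> t i"] node_I[OF ad] r by (simp add: Z_def K.add)
  have e_bound: "norm (e \<tau> t i) \<le> Ce * \<tau> ^ p" if ad: "admissible \<tau> t" for \<tau> t i
  proof -
    have \<tau>: "\<tau> > 0" using ad by (simp add: admissible_def)
    let ?s = "node \<tau> t i"
    have s: "?s \<in> I" by (rule node_I[OF ad])
    have n0: "norm (V 0 ?s) \<le> B0 + C\<zeta>" using B0(2)[OF s] C\<zeta>(1) by simp
    have "norm (V 0 ?s + K (\<zeta> \<tau> t i)) \<le> B0 + C\<zeta>"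
      by (rule norm_triangle_mono[OF B0(2)[OF s] order_trans[OF K_norm \<zeta>_le[OF ad]]])
    from Cn(2)[OF n0 this, of "V 1 ?s"]
    have "norm (blinfun_apply (Q 1 (K (Z \<tau> t i))) (Z \<tau> t i)
      - blinfun_apply (Q 1 (V 0 ?s)) (V 1 ?s) - blinfun_apply (L 1 ?s) (\<zeta> \<tau> t i)) \<le> Cn * (1 + norm (V 1 ?s)) * (norm (\<zeta> \<tau> t i))\<^sup>2"
      unfolding KZ[OF ad] L_def by (simp add: Z_def)
    also have "\<dots> \<le> Cn * (1 + B1) * (C\<zeta> * \<tau> ^ (q + 1))\<^sup>2"
      using Cn(1) B1 s C\<zeta>(2)[OF ad, of i] by (intro mult_mono power_mono mult_left_mono) auto
    also have "\<dots> = (Cn * (1 + B1) * C\<zeta>\<^sup>2) * \<tau> ^ ((q + 1) * 2)"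
      unfolding power_mult_distrib power_mult by (simp only: mult.assoc)
    finally have "norm (blinfun_apply (Q 1 (K (Z \<tau> t i))) (Z \<tau> t i)
      - blinfun_apply (Q 1 (V 0 ?s)) (V 1 ?s) - blinfun_apply (L 1 ?s) (\<zeta> \<tau> t i)) \<le> (Cn * (1 + B1) * C\<zeta>\<^sup>2) * \<tau> ^ p"
      by (rule admissible_mult_power_mono[OF ad, rotated 2]) (use rpq Cn(1) B1 in auto)
    from order_trans[OF norm_triangle_ineq4 add_mono[OF w_bound[OF ad, of i] this]]
    show ?thesis unfolding e_def Ce_def by (simp add: distrib_right)
  qed
  have rhs: "blinfun_apply (Q 1 (K (Z \<tau> t i))) (Z \<tau> t i) = Vf 0 1 (node \<tau> t i) + blinfun_apply (L 1 (node \<tau> t i)) (\<zeta> \<tau> t i) - e \<tau> t i" for \<tau> t i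
    by (simp add: e_def w_def)
  define ca where "ca = (\<Sum>i\<in>UNIV. \<Sum>m\<in>UNIV. \<bar>a $ i $ m\<bar>)"
  have ca: "(\<Sum>m\<in>UNIV. \<bar>a $ i $ m\<bar>) \<le> ca" for i
    unfolding ca_def by (intro member_le_sum[of i UNIV "\<lambda>i. \<Sum>m\<in>UNIV. \<bar>a $ i $ m\<bar>"]) (auto intro!: sum_nonneg)
  define cb where "cb = (\<Sum>i\<in>UNIV. \<bar>b $ i\<bar>)"
  have cab: "0 \<le> ca" "0 \<le> cb" by (simp_all add: ca_def cb_def sum_nonneg)
  have stage_eq: "norm (K (Z \<tau> t i) - V 0 t - \<tau> *\<^sub>R (\<Sum>k\<in>UNIV. a $ i $ k *\<^sub>R blinfun_apply (Q 1 (K (Z \<tau> t k))) (Z \<tau> t k)))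
      \<le> (Cr + ca * Ce) * \<tau> ^ (p + 1)" if ad: "admissible \<tau> t" for \<tau> t i
  proof -
    have \<tau>: "\<tau> > 0" using ad by (simp add: admissible_def)
    have tel: "(\<Sum>m<r. H m 0 \<tau> t i) - (\<Sum>m<r. H (Suc m) 0 \<tau> t i) = H 0 0 \<tau> t i - H r 0 \<tau> t i"
      using sum_lessThan_telescope'[of "\<lambda>m. H m 0 \<tau> t i" r] by (simp add: sum_subtractf)
    have slopes: "(\<Sum>k\<in>UNIV. a $ i $ k *\<^sub>R blinfun_apply (Q 1 (K (Z \<tau> t k))) (Z \<tau> t k)) =
        (\<Sum>k\<in>UNIV. a $ i $ k *\<^sub>R (Vf 0 1 (node \<tau> t k) + blinfun_apply (L 1 (node \<tau> t k)) (\<zeta> \<tau> t k) - e \<tau> t k))"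
      by (simp only: rhs)
    have "K (Z \<tau> t i) - V 0 t - \<tau> *\<^sub>R (\<Sum>k\<in>UNIV. a $ i $ k *\<^sub>R blinfun_apply (Q 1 (K (Z \<tau> t k))) (Z \<tau> t k)) =
        (V 0 (node \<tau> t i) - V 0 t - \<tau> *\<^sub>R (\<Sum>k\<in>UNIV. a $ i $ k *\<^sub>R Vf 0 1 (node \<tau> t k)))
        + ((\<Sum>m<r. H m 0 \<tau> t i) - (\<Sum>m<r. H (Suc m) 0 \<tau> t i)) + \<tau> *\<^sub>R (\<Sum>k\<in>UNIV. a $ i $ k *\<^sub>R e \<tau> t k)"
      unfolding slopes unfolding KZ[OF ad] K\<zeta>[OF ad] L\<zeta>[symmetric]
      by (simp add: scaleR_add_right scaleR_diff_right sum.distrib sum_subtractf algebra_simps)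
    also have "V 0 (node \<tau> t i) - V 0 t - \<tau> *\<^sub>R (\<Sum>k\<in>UNIV. a $ i $ k *\<^sub>R Vf 0 1 (node \<tau> t k)) = - H 0 0 \<tau> t i"
      using Vf0[of 0] node_I[OF ad] time_I[OF ad] by (simp add: H0)
    finally have eq: "K (Z \<tau> t i) - V 0 t - \<tau> *\<^sub>R (\<Sum>k\<in>UNIV. a $ i $ k *\<^sub>R blinfun_apply (Q 1 (K (Z \<tau> t k))) (Z \<tau> t k)) =
        \<tau> *\<^sub>R (\<Sum>k\<in>UNIV. a $ i $ k *\<^sub>R e \<tau> t k) - H r 0 \<tau> t i"
      unfolding tel by simp
    have small: "norm (\<tau> *\<^sub>R (\<Sum>k\<in>UNIV. a $ i $ k *\<^sub>R e \<tau> t k)) \<le> \<tau> * (ca * (Ce * \<tau> ^ p))"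
    proof -
      have "norm (\<Sum>k\<in>UNIV. a $ i $ k *\<^sub>R e \<tau> t k) \<le> (\<Sum>m\<in>UNIV. \<bar>a $ i $ m\<bar>) * (Ce * \<tau> ^ p)"
        by (rule norm_weighted_sum_le[OF e_bound[OF ad]])
      also have "\<dots> \<le> ca * (Ce * \<tau> ^ p)" using ca Ce0 \<tau> by (intro mult_right_mono) auto
      finally show ?thesis using \<tau> by simp
    qed
    show ?thesis
      unfolding eq
      using order_trans[OF norm_triangle_ineq4 add_mono[OF small Cr(2)[OF ad, of i]]] by (simp add: algebra_simps)
  qed
  have update_eq: "norm (V 0 (t + \<tau>) - V 0 t - \<tau> *\<^sub>R (\<Sum>i\<in>UNIV. b $ i *\<^sub>R blinfun_apply (Q 1 (K (Z \<tau> t i))) (Z \<tau> t i)))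
      \<le> (Cq + Cu + cb * Ce) * \<tau> ^ (p + 1)" if ad: "admissible \<tau> t" and le: "t + \<tau> \<le> T" for \<tau> t
  proof -
    have \<tau>: "\<tau> > 0" "t + \<tau> \<in> I" using ad le sub by (auto simp: admissible_def)
    have "V 0 (t + \<tau>) - V 0 t - \<tau> *\<^sub>R (\<Sum>i\<in>UNIV. b $ i *\<^sub>R blinfun_apply (Q 1 (K (Z \<tau> t i))) (Z \<tau> t i)) =
        (V 0 (t + \<tau>) - V 0 t - \<tau> *\<^sub>R (\<Sum>i\<in>UNIV. b $ i *\<^sub>R Vf 0 1 (node \<tau> t i)))
        - \<tau> *\<^sub>R (\<Sum>i\<in>UNIV. b $ i *\<^sub>R blinfun_apply (L 1 (node \<tau> t i)) (\<zeta> \<tau> t i)) + \<tau> *\<^sub>R (\<Sum>i\<in>UNIV. b $ i *\<^sub>R e \<tau> t i)"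
      unfolding rhs by (simp add: scaleR_add_right scaleR_diff_right sum.distrib sum_subtractf algebra_simps)
    also have "norm \<dots> \<le> (Cq * \<tau> ^ (p + 1) + Cu * \<tau> ^ (p + 1)) + \<tau> * (cb * (Ce * \<tau> ^ p))"
    proof (intro norm_triangle_mono order_trans[OF norm_triangle_ineq4 add_mono])
      show "norm (V 0 (t + \<tau>) - V 0 t - \<tau> *\<^sub>R (\<Sum>i\<in>UNIV. b $ i *\<^sub>R Vf 0 1 (node \<tau> t i))) \<le> Cq * \<tau> ^ (p + 1)"
        using Cq(2)[OF ad le] Vf0[of 0] \<tau>(2) time_I[OF ad] by simp
      have "norm (\<Sum>i\<in>UNIV. b $ i *\<^sub>R e \<tau> t i) \<le> cb * (Ce * \<tau> ^ p)"
        unfolding cb_def by (rule norm_weighted_sum_le[OF e_bound[OF ad]])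
      then show "norm (\<tau> *\<^sub>R (\<Sum>i\<in>UNIV. b $ i *\<^sub>R e \<tau> t i)) \<le> \<tau> * (cb * (Ce * \<tau> ^ p))" using \<tau> by simp
    qed (rule Cu(2)[OF ad])
    also have "\<dots> = (Cq + Cu + cb * Ce) * \<tau> ^ (p + 1)" by (simp add: algebra_simps)
    finally show ?thesis .
  qed
  have Z_bound: "norm (Z \<tau> t i) \<le> B1 + C\<zeta>" if ad: "admissible \<tau> t" for \<tau> t i
    unfolding Z_def by (rule norm_triangle_mono[OF B1(2)[OF node_I[OF ad]] \<zeta>_le[OF ad]])
  define C where "C = (B1 + C\<zeta>) + (Cr + ca * Ce) + (Cq + Cu + cb * Ce)"
  have nonneg: "0 \<le> Cr + ca * Ce" "0 \<le> Cq + Cu + cb * Ce" "0 < B1 + C\<zeta>"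
    using Cr(1) Cq(1) Cu(1) cab Ce0 B1(1) C\<zeta>(1) by auto
  have "0 < C" using nonneg by (simp add: C_def)
  moreover have "\<exists>Z. (\<forall>i. norm (Z i) \<le> C) \<and>
      (\<forall>i. norm (K (Z i) - v 0 t - \<tau> *\<^sub>R (\<Sum>k\<in>UNIV. a $ i $ k *\<^sub>R blinfun_apply (Q 1 (K (Z k))) (Z k))) \<le> C * \<tau> ^ (p + 1)) \<and>
      norm (v 0 (t + \<tau>) - v 0 t - \<tau> *\<^sub>R (\<Sum>i\<in>UNIV. b $ i *\<^sub>R blinfun_apply (Q 1 (K (Z i))) (Z i))) \<le> C * \<tau> ^ (p + 1)"
    if \<tau>: "0 < \<tau>" "\<tau> \<le> \<tau>1" and t: "0 \<le> t" "t + \<tau> \<le> T" for \<tau> t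
  proof (intro exI[of _ "Z \<tau> t"] conjI allI)
    have ad: "admissible \<tau> t" using \<tau> t by (auto simp: admissible_def)
    have V: "V 0 t = v 0 t" "V 0 (t + \<tau>) = v 0 (t + \<tau>)" using \<tau> t by (auto intro!: V_eq)
    have le: "Cr + ca * Ce \<le> C" "Cq + Cu + cb * Ce \<le> C" "B1 + C\<zeta> \<le> C" using nonneg by (auto simp: C_def)
    have \<tau>p: "0 \<le> \<tau> ^ (p + 1)" using \<tau> by simp
    show "norm (Z \<tau> t i) \<le> C" for i using Z_bound[OF ad, of i] le(3) by simp
    show "norm (K (Z \<tau> t i) - v 0 t - \<tau> *\<^sub>R (\<Sum>k\<in>UNIV. a $ i $ k *\<^sub>R blinfun_apply (Q 1 (K (Z \<tau> t k))) (Z \<tau> t k))) \<le> C * \<tau> ^ (p + 1)" for i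
      using order_trans[OF stage_eq[OF ad, of i] mult_right_mono[OF le(1) \<tau>p]] by (simp add: V)
    show "norm (v 0 (t + \<tau>) - v 0 t - \<tau> *\<^sub>R (\<Sum>i\<in>UNIV. b $ i *\<^sub>R blinfun_apply (Q 1 (K (Z \<tau> t i))) (Z \<tau> t i))) \<le> C * \<tau> ^ (p + 1)"
      using order_trans[OF update_eq[OF ad t(2)] mult_right_mono[OF le(2) \<tau>p]] by (simp add: V)
  qed
  ultimately show ?thesis using \<tau>1(1) by blast
qed

end

section \<open>Operators of Kato type\<close>

text \<open>
  The operators of the evolution equation and their commutators \<open>Bk k\<close> with the powers of the isometry
  \<open>S\<close>, up to the power \<open>r = p - q\<close> in the application.
\<close>

locale kato_operators =
  fixes j :: "'y::{real_inner, complete_space} \<Rightarrow> 'x::{real_inner, complete_space}"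
    and D :: "'y \<Rightarrow> 'x set" and A :: "'y \<Rightarrow> 'x \<Rightarrow> 'x"
    and S :: "'y \<Rightarrow> 'x" and Bk :: "nat \<Rightarrow> 'y \<Rightarrow> 'x \<Rightarrow>\<^sub>L 'x" and r :: nat
  assumes embed: "dense_embedding j"
    and A_closed: "\<And>y. closed_linear_operator (D y) (A y)"
    and K1: "cond_K1 j D A"
    and S_linear: "linear S" and S_norm: "\<And>y. norm (S y) = norm y"
    and A1: "cond_A1 j D A S Bk r" and A2: "cond_A2 j A Bk r"
    and r_pos: "1 \<le> r"
begin

lemma j_linear: "bounded_linear j" and j_inj: "inj j"
  and j_dense: "closure (range j) = UNIV" and j_norm: "norm (j y) \<le> norm y"
  using embed by (auto simp: dense_embedding_def)

sublocale j: bounded_linear j by (rule j_linear)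

sublocale S: linear S by (rule S_linear)

lemma j_eq_iff: "j x = j y \<longleftrightarrow> x = y"
  using j_inj by (auto simp: inj_def)

lemma S_bounded_linear: "bounded_linear S"
  by (rule bounded_linear_intro[of _ 1]) (auto simp: S.add S.scale S_norm)

lemma j_in_D: "j w \<in> D y"
  using K1 unfolding cond_K1_def by (meson rangeI subsetD)

lemma A_add: "x \<in> D y \<Longrightarrow> z \<in> D y \<Longrightarrow> A y (x + z) = A y x + A y z"
  and A_scale: "x \<in> D y \<Longrightarrow> A y (c *\<^sub>R x) = c *\<^sub>R A y x"
  and D_subspace: "subspace (D y)"
  using A_closed[of y] by (auto simp: closed_linear_operator_def)

lemma A_diff: "x \<in> D y \<Longrightarrow> z \<in> D y \<Longrightarrow> A y (x - z) = A y x - A y z"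
  using A_add[of x y "(-1) *\<^sub>R z"] A_scale[of z y "-1"] subspace_scale[OF D_subspace, of z y "-1"] by simp

lemma A_accretive: "w \<in> D y \<Longrightarrow> 0 \<le> inner w (A y w)"
  using K1 by (auto simp: cond_K1_def)

definition Aj :: "'y \<Rightarrow> 'y \<Rightarrow>\<^sub>L 'x"
  where "Aj y = Blinfun (\<lambda>w. A y (j w))"

lemma Aj_apply: "blinfun_apply (Aj y) w = A y (j w)"
proof -
  obtain M where M: "\<And>w. norm (A y (j w)) \<le> M * norm w"
    using K1 unfolding cond_K1_def by (metis add_nonneg_pos norm_ge_zero order_refl zero_less_one less_add_one less_imp_le)
  have "bounded_linear (\<lambda>w. A y (j w))"
    by (rule bounded_linear_intro[of _ M])
      (use M in \<open>auto simp: j.add j.scaleR A_add A_scale j_in_D mult.commute\<close>)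
  then show ?thesis by (simp add: Aj_def bounded_linear_Blinfun_apply)
qed

lemma conjugate_graph_1: "conjugate_graph (graph_in_X j S) (op_graph (D y) (A y)) = op_graph (D y) (\<lambda>v. A y v + blinfun_apply (Bk 1 y) v)"
  using A1 r_pos unfolding cond_A1_def by (metis One_nat_def atLeastAtMost_iff order_refl relpow_1)

text \<open>
  The domain of \<open>A y\<close> lies in the range of \<open>S\<close>, because both sides of the commutator identity have the
  same domain. As \<open>S\<close> is isometric, its range is closed and thus the whole space.
\<close>

lemma S_surj: "surj S"
proof -
  have "j w \<in> range S" for w
  proof -
    have "(j w, A 0 (j w) + blinfun_apply (Bk 1 0) (j w)) \<in> conjugate_graph (graph_in_X j S) (op_graph (D 0) (A 0))"
      unfolding conjugate_graph_1 by (auto simp: op_graph_def j_in_D)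
    then show ?thesis by (auto simp: conjugate_graph_def graph_in_X_def)
  qed
  then have "range j \<subseteq> range S" by blast
  moreover have "closed (range S)"
    using complete_isometric_image[of 1 UNIV S] S_bounded_linear
    by (intro complete_imp_closed) (auto simp: S_norm complete_UNIV)
  ultimately have "closure (range j) \<subseteq> range S" by (rule closure_minimal)
  then show ?thesis using j_dense by auto
qed

definition Sinv :: "'x \<Rightarrow> 'y"
  where "Sinv = inv S"

lemma S_Sinv: "S (Sinv x) = x"
  using S_surj by (simp add: Sinv_def surj_f_inv_f)

lemma S_eq_iff: "S x = S y \<longleftrightarrow> x = y"
proof
  assume "S x = S y"
  then have "norm (S (x - y)) = 0" by (simp add: S.diff)
  then show "x = y" by (simp add: S_norm)
qed simp

lemma Sinv_S: "Sinv (S y) = y"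
  using S_Sinv[of "S y"] by (simp add: S_eq_iff)

lemma Sinv_norm: "norm (Sinv x) = norm x"
  using S_norm[of "Sinv x"] by (simp add: S_Sinv)

lemma Sinv_bounded_linear: "bounded_linear Sinv"
proof (rule bounded_linear_intro[of _ 1])
  show "Sinv (x + y) = Sinv x + Sinv y" for x y
    by (subst S_eq_iff[symmetric]) (simp add: S.add S_Sinv)
  show "Sinv (c *\<^sub>R x) = c *\<^sub>R Sinv x" for c x
    by (subst S_eq_iff[symmetric]) (simp add: S.scale S_Sinv)
qed (simp add: Sinv_norm)

sublocale Sinv: bounded_linear Sinv by (rule Sinv_bounded_linear)

definition K :: "'y \<Rightarrow> 'y"
  where "K y = Sinv (j y)"

lemma S_K: "S (K y) = j y"
  by (simp add: K_def S_Sinv)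

lemma K_bounded_linear: "bounded_linear K"
  unfolding K_def[abs_def] by (rule bounded_linear_compose[OF Sinv_bounded_linear j_linear])

lemma K_norm: "norm (K y) \<le> norm y"
  by (simp add: K_def Sinv_norm j_norm)

lemma K_power_eq_iff: "(K ^^ k) x = (K ^^ k) y \<longleftrightarrow> x = y"
proof (induction k)
  case (Suc k)
  have "K x = K y \<longleftrightarrow> x = y" for x y
    by (metis S_K j_eq_iff)
  then show ?case using Suc by simp
qed simp

abbreviation J :: "'x \<Rightarrow> 'x"
  where "J x \<equiv> j (Sinv x)"

lemma J_power_j: "(J ^^ k) (j z) = j ((K ^^ k) z)"
  by (induction k) (simp_all add: K_def)

lemma J_power_Suc: "(J ^^ Suc k) x = j ((K ^^ k) (Sinv x))"
  by (induction k) (simp_all add: K_def)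

lemma graph_eq: "(x, z) \<in> graph_in_X j S \<longleftrightarrow> x = J z"
  unfolding graph_in_X_def using S_Sinv Sinv_S by (auto simp: image_iff)

lemma graph_power: "(x, z) \<in> graph_in_X j S ^^ k \<longleftrightarrow> x = (J ^^ k) z"
proof (induction k arbitrary: z)
  case (Suc k)
  have "(x, z) \<in> graph_in_X j S ^^ Suc k \<longleftrightarrow> (\<exists>m. x = (J ^^ k) m \<and> m = J z)"
    by (simp only: relpow.simps relcomp_unfold mem_Collect_eq case_prod_conv Suc graph_eq)
  moreover have "(J ^^ k) (J z) = (J ^^ Suc k) z" by (simp only: funpow_Suc_right o_apply)
  ultimately show ?case by simp
qed simp

lemma A_J_power:
  assumes "1 \<le> k" "k \<le> r" "v \<in> D y"
  shows "A y ((J ^^ k) v) = (J ^^ k) (A y v + blinfun_apply (Bk k y) v)"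
proof -
  have "conjugate_graph (graph_in_X j S ^^ k) (op_graph (D y) (A y)) = op_graph (D y) (\<lambda>v. A y v + blinfun_apply (Bk k y) v)"
    using A1 assms by (auto simp: cond_A1_def)
  then have "(v, A y v + blinfun_apply (Bk k y) v) \<in> conjugate_graph (graph_in_X j S ^^ k) (op_graph (D y) (A y))"
    using assms(3) by (auto simp: op_graph_def)
  then show ?thesis by (auto simp: conjugate_graph_def op_graph_def graph_power)
qed

text \<open>
  This is where the equality of domains in the commutator identity matters: stages of the numerical
  solution are only known to lie in \<open>Y\<close>, as do their slopes, and the lemma shows that \<open>S\<close> maps these
  stages into the domain of \<open>A y\<close>.
\<close>

lemma A_J_domain:
  assumes "J v \<in> D y" "A y (J v) = J z"
  shows "v \<in> D y" "z = A y v + blinfun_apply (Bk 1 y) v"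
proof -
  have "(v, J v) \<in> (graph_in_X j S)\<inverse>" "(J v, J z) \<in> op_graph (D y) (A y)" "(J z, z) \<in> graph_in_X j S"
    using assms by (auto simp: graph_eq op_graph_def)
  then have "(v, z) \<in> conjugate_graph (graph_in_X j S) (op_graph (D y) (A y))"
    unfolding conjugate_graph_def by blast
  then show "v \<in> D y" "z = A y v + blinfun_apply (Bk 1 y) v"
    unfolding conjugate_graph_1 by (auto simp: op_graph_def)
qed

text \<open>
  The conjugate of \<open>A y\<close> by \<open>S ^ k\<close>, restricted to \<open>Y\<close>. Conjugation back by \<open>S\<close> once turns it into the
  operator \<open>Q k y\<close> on \<open>Y\<close>, up to the sign in the evolution equation.
\<close>

definition AB :: "nat \<Rightarrow> 'y \<Rightarrow> 'y \<Rightarrow>\<^sub>L 'x"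
  where "AB k y = Aj y + (Bk k y o\<^sub>L Blinfun j)"

lemma AB_apply: "blinfun_apply (AB k y) z = A y (j z) + blinfun_apply (Bk k y) (j z)"
  by (simp add: AB_def blinfun.add_left Aj_apply bounded_linear_Blinfun_apply j_linear)

lemma AB_smooth: "1 \<le> k \<Longrightarrow> k \<le> r \<Longrightarrow> smooth_bounded_on_balls (AB k)"
  unfolding AB_def using A2
  by (intro smooth_bounded_add smooth_bounded_linear[where L = "\<lambda>B. B o\<^sub>L Blinfun j"]
      bounded_bilinear.bounded_linear_left[OF bounded_bilinear_blinfun_compose])
    (auto simp: cond_A2_def Aj_def[abs_def])

definition Q :: "nat \<Rightarrow> 'y \<Rightarrow> 'y \<Rightarrow>\<^sub>L 'y"
  where "Q k y = - (Blinfun Sinv o\<^sub>L AB k y)"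

lemma Q_apply: "blinfun_apply (Q k y) z = - Sinv (blinfun_apply (AB k y) z)"
  by (simp add: Q_def blinfun.minus_left bounded_linear_Blinfun_apply Sinv_bounded_linear)

lemma S_Q: "S (blinfun_apply (Q k y) z) = - blinfun_apply (AB k y) z"
  by (simp add: Q_apply S.neg S_Sinv)

lemma A_K_power:
  assumes "1 \<le> k" "k \<le> r"
  shows "A y (j ((K ^^ k) z)) = - j ((K ^^ (k - 1)) (blinfun_apply (Q k y) z))"
proof -
  obtain m where m: "k = Suc m" using assms by (cases k) auto
  interpret Km: bounded_linear "K ^^ m" by (rule bounded_linear_funpow[OF K_bounded_linear])
  have "A y (j ((K ^^ k) z)) = (J ^^ k) (blinfun_apply (AB k y) z)"
    using A_J_power[OF assms j_in_D] by (simp add: J_power_j AB_apply)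
  also have "\<dots> = - j ((K ^^ m) (blinfun_apply (Q k y) z))"
    unfolding m J_power_Suc Q_apply by (simp add: Km.neg j.neg)
  finally show ?thesis by (simp add: m)
qed

sublocale scale: regularity_scale K Q r
proof (rule regularity_scale.intro)
  show "smooth_bounded_on_balls (Q k)" if "1 \<le> k" "k \<le> r" for k
    unfolding Q_def
    by (rule smooth_bounded_linear[OF AB_smooth[OF that]])
      (intro bounded_linear_minus bounded_bilinear.bounded_linear_right[OF bounded_bilinear_blinfun_compose])
  show "K (blinfun_apply (Q (Suc k) y) z) = blinfun_apply (Q k y) (K z)" if k: "1 \<le> k" "k < r" for k y z
  proof -
    obtain m where m: "k = Suc m" using k by (cases k) auto
    have "j ((K ^^ m) (K (blinfun_apply (Q (Suc k) y) z))) = j ((K ^^ m) (blinfun_apply (Q k y) (K z)))"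
      using A_K_power[of "Suc k" y z] A_K_power[of k y "K z"] k by (simp add: m funpow_swap1)
    then show ?thesis by (simp add: j_eq_iff K_power_eq_iff)
  qed
qed (rule K_bounded_linear K_norm r_pos)+

lemma A_K: "A y (j (K z)) = - j (blinfun_apply (Q 1 y) z)"
  using A_K_power[of 1 y z] r_pos by simp

text \<open>
  As the coefficient matrix is invertible, the slopes are linear combinations of differences of stages,
  and thus lie in \<open>Y\<close>.
\<close>

lemma stage_slopes:
  fixes a :: "real^'m^'m" and U :: "'m \<Rightarrow> 'y"
  assumes "invertible a" "0 < \<tau>"
    and U: "\<And>i. j (U i) = j y + \<tau> *\<^sub>R (\<Sum>k\<in>UNIV. a $ i $ k *\<^sub>R (- A (U k) (j (U k))))"
  obtains W where "\<And>i. j (W i) = - A (U i) (j (U i))"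
proof -
  define W where "W i = (1 / \<tau>) *\<^sub>R (\<Sum>k\<in>UNIV. matrix_inv a $ i $ k *\<^sub>R (U k - y))" for i
  have "j (W i) = - A (U i) (j (U i))" for i
  proof -
    have jU: "j (U k - y) = \<tau> *\<^sub>R (\<Sum>l\<in>UNIV. a $ k $ l *\<^sub>R (- A (U l) (j (U l))))" for k
      unfolding j.diff U[of k] by simp
    have "j (W i) = (1 / \<tau>) *\<^sub>R (\<Sum>k\<in>UNIV. matrix_inv a $ i $ k *\<^sub>R j (U k - y))"
      unfolding W_def by (simp only: j.scaleR j.sum)
    also have "\<dots> = (1 / \<tau>) *\<^sub>R (\<tau> *\<^sub>R (\<Sum>k\<in>UNIV. matrix_inv a $ i $ k *\<^sub>R (\<Sum>l\<in>UNIV. a $ k $ l *\<^sub>R (- A (U l) (j (U l))))))"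
      unfolding jU scaleR_left_commute[of _ \<tau>] scaleR_sum_right[of \<tau>, symmetric] ..
    also have "\<dots> = - A (U i) (j (U i))"
      unfolding solve_matrix_vectors(2)[OF assms(1)] using assms(2) by simp
    finally show ?thesis .
  qed
  then show thesis by (rule that)
qed

definition numerical_step :: "real^'m^'m \<Rightarrow> real^'m \<Rightarrow> real \<Rightarrow> 'y \<Rightarrow> ('m \<Rightarrow> 'y) \<Rightarrow> 'y \<Rightarrow> bool"
  where "numerical_step a b \<tau> x U x1 \<longleftrightarrow>
    (\<forall>i. j (U i) = j x + \<tau> *\<^sub>R (\<Sum>k\<in>UNIV. a $ i $ k *\<^sub>R (- A (U k) (j (U k))))) \<and>
    j x1 = j x + \<tau> *\<^sub>R (\<Sum>i\<in>UNIV. b $ i *\<^sub>R (- A (U i) (j (U i))))"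

text \<open>The defects of the reference stages are written as perturbations of the slopes.\<close>

definition perturbed_stages :: "real^'m^'m \<Rightarrow> real \<Rightarrow> 'y \<Rightarrow> ('m \<Rightarrow> 'y) \<Rightarrow> ('m \<Rightarrow> 'y) \<Rightarrow> bool"
  where "perturbed_stages a \<tau> y Z \<rho> \<longleftrightarrow>
    (\<forall>i. K (Z i) = y + \<tau> *\<^sub>R (\<Sum>k\<in>UNIV. a $ i $ k *\<^sub>R (blinfun_apply (Q 1 (K (Z k))) (Z k) + \<rho> k)))"

text \<open>
  The difference of two numerical steps is measured by applying \<open>S\<close>, which turns the norm of \<open>Y\<close> into
  the norm of \<open>X\<close>. There \<open>A y\<close> is accretive, the commutators are bounded, and the dependence of the
  operators on \<open>y\<close> is absorbed by the additional regularity \<open>K (Z i)\<close> of the reference stages.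
\<close>

lemma step_stability:
  fixes a :: "real^'m^'m" and b :: "real^'m"
  assumes stable: "algebraically_stable a b" and coer: "coercive a" and R: "0 < R"
  shows "\<exists>\<gamma>>0. \<exists>c>0. \<forall>\<tau> x x1 y y1 \<epsilon> \<delta> U Z \<rho>. 0 < \<tau> \<longrightarrow> \<tau> \<le> \<gamma> \<longrightarrow> 0 \<le> \<epsilon> \<longrightarrow>
    (\<forall>i. norm (U i) \<le> R \<and> norm (Z i) \<le> R \<and> norm (\<rho> i) \<le> \<epsilon>) \<longrightarrow>
    numerical_step a b \<tau> x U x1 \<longrightarrow> perturbed_stages a \<tau> y Z \<rho> \<longrightarrow>
    norm (y1 - y - \<tau> *\<^sub>R (\<Sum>i\<in>UNIV. b $ i *\<^sub>R (blinfun_apply (Q 1 (K (Z i))) (Z i) + \<rho> i))) \<le> \<delta> \<longrightarrow>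
    norm (x1 - y1) \<le> (1 + c * \<tau>) * norm (x - y) + c * (\<tau> * \<epsilon>) + \<delta>"
proof -
  have inv: "invertible a" using coer by (simp add: coercive_def)
  obtain \<gamma> c :: real where \<gamma>: "\<gamma> > 0" and c: "c > 0" and step:
    "\<And>(x::'x) X V \<tau> \<kappa> \<rho>. one_sided_stages a \<tau> \<kappa> \<rho> x X V \<Longrightarrow> \<tau> * \<kappa> \<le> \<gamma> \<Longrightarrow>
      norm (x + \<tau> *\<^sub>R (\<Sum>i\<in>UNIV. b $ i *\<^sub>R V i)) \<le> (1 + c * \<kappa> * \<tau>) * norm x + c * (\<tau> * \<rho>)"
    by (rule rk_step_stable[OF stable coer]) blast
  obtain M where M: "M > 0" "\<And>y. norm y \<le> R \<Longrightarrow> norm (Bk 1 y) \<le> M"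
    using A2 r_pos smooth_bounded_bound[OF _ R, of "Bk 1"] unfolding cond_A2_def by (metis atLeastAtMost_iff order_refl)
  obtain L where L: "L > 0" "\<And>y z. norm y \<le> R \<Longrightarrow> norm z \<le> R \<Longrightarrow> norm (AB 1 y - AB 1 z) \<le> L * norm (y - z)"
    using smooth_bounded_Lipschitz[OF AB_smooth[OF order_refl r_pos] R] by blast
  define \<kappa> where "\<kappa> = M + L * R"
  have \<kappa>: "\<kappa> > 0" using M(1) L(1) R by (simp add: \<kappa>_def add_pos_pos)
  define c' where "c' = c * \<kappa> + c"
  have c': "c' > 0" "c * \<kappa> \<le> c'" "c \<le> c'" using c \<kappa> by (auto simp: c'_def intro: add_pos_pos)
  show ?thesis
  proof (rule exI[of _ "\<gamma> / \<kappa>"], rule conjI[rotated], rule exI[of _ c'], rule conjI[rotated], intro allI impI)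
    show "0 < \<gamma> / \<kappa>" "0 < c'" using \<gamma> \<kappa> c' by auto
    fix \<tau> x x1 y y1 \<epsilon> \<delta> and U Z \<rho> :: "'m \<Rightarrow> 'y"
    assume \<tau>: "0 < \<tau>" "\<tau> \<le> \<gamma> / \<kappa>" and \<epsilon>: "0 \<le> \<epsilon>"
      and bounds: "\<forall>i. norm (U i) \<le> R \<and> norm (Z i) \<le> R \<and> norm (\<rho> i) \<le> \<epsilon>"
      and num: "numerical_step a b \<tau> x U x1" and pert: "perturbed_stages a \<tau> y Z \<rho>"
      and \<delta>: "norm (y1 - y - \<tau> *\<^sub>R (\<Sum>i\<in>UNIV. b $ i *\<^sub>R (blinfun_apply (Q 1 (K (Z i))) (Z i) + \<rho> i))) \<le> \<delta>"
    have UR: "norm (U i) \<le> R" and ZR: "norm (Z i) \<le> R" and \<rho>: "norm (\<rho> i) \<le> \<epsilon>" for i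
      using bounds by blast+
    have U: "j (U i) = j x + \<tau> *\<^sub>R (\<Sum>k\<in>UNIV. a $ i $ k *\<^sub>R (- A (U k) (j (U k))))" for i
      by (rule num[unfolded numerical_step_def, THEN conjunct1, THEN spec])
    have x1: "j x1 = j x + \<tau> *\<^sub>R (\<Sum>i\<in>UNIV. b $ i *\<^sub>R (- A (U i) (j (U i))))"
      by (rule num[unfolded numerical_step_def, THEN conjunct2])
    have Z: "K (Z i) = y + \<tau> *\<^sub>R (\<Sum>k\<in>UNIV. a $ i $ k *\<^sub>R (blinfun_apply (Q 1 (K (Z k))) (Z k) + \<rho> k))" for i
      by (rule pert[unfolded perturbed_stages_def, THEN spec])
    obtain W where W: "\<And>i. j (W i) = - A (U i) (j (U i))"
      using stage_slopes[OF inv \<tau>(1) U] by blast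
    have "j (U i) = j (x + \<tau> *\<^sub>R (\<Sum>k\<in>UNIV. a $ i $ k *\<^sub>R W k))" for i
      unfolding U[of i] W[symmetric] by (simp add: j.add j.scaleR j.sum)
    then have UW: "U i = x + \<tau> *\<^sub>R (\<Sum>k\<in>UNIV. a $ i $ k *\<^sub>R W k)" for i by (simp add: j_eq_iff)
    have "j x1 = j (x + \<tau> *\<^sub>R (\<Sum>i\<in>UNIV. b $ i *\<^sub>R W i))"
      unfolding x1 W[symmetric] by (simp add: j.add j.scaleR j.sum)
    then have x1W: "x1 = x + \<tau> *\<^sub>R (\<Sum>i\<in>UNIV. b $ i *\<^sub>R W i)" by (simp add: j_eq_iff)
    define q where "q i = blinfun_apply (Q 1 (K (Z i))) (Z i) + \<rho> i" for i
    define X where "X i = S (U i - K (Z i))" for i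
    define V where "V i = S (W i - q i)" for i
    have "U i - K (Z i) = (x - y) + \<tau> *\<^sub>R (\<Sum>k\<in>UNIV. a $ i $ k *\<^sub>R (W k - q k))" for i
      unfolding UW[of i] Z[of i] q_def[symmetric] by (simp add: scaleR_diff_right sum_subtractf)
    then have XV: "X i = S (x - y) + \<tau> *\<^sub>R (\<Sum>k\<in>UNIV. a $ i $ k *\<^sub>R V k)" for i
      unfolding X_def V_def by (simp only: S.add S.scale S.sum)
    have one: "inner (X i) (V i) \<le> \<kappa> * (norm (X i))\<^sup>2 + \<epsilon> * norm (X i)" for i
    proof -
      have "J (S (U i)) = j (U i)" "J (S (- W i)) = A (U i) (j (U i))"
        by (simp_all only: Sinv_S j.neg W minus_minus)
      then have SU: "S (U i) \<in> D (U i)" "S (- W i) = A (U i) (S (U i)) + blinfun_apply (Bk 1 (U i)) (S (U i))"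
        using A_J_domain[of "S (U i)" "U i" "S (- W i)"] j_in_D by simp_all
      have Xj: "X i = S (U i) - j (Z i)" by (simp add: X_def S.diff S_K)
      have XD: "X i \<in> D (U i)" unfolding Xj by (intro subspace_diff[OF D_subspace] SU j_in_D)
      have Sq: "S (q i) = S (\<rho> i) - blinfun_apply (AB 1 (K (Z i))) (Z i)" by (simp add: q_def S.add S_Q)
      have "V i = - (A (U i) (S (U i)) + blinfun_apply (Bk 1 (U i)) (S (U i))) + blinfun_apply (AB 1 (K (Z i))) (Z i) - S (\<rho> i)"
        using arg_cong[OF SU(2), of uminus] by (simp add: V_def S.diff S.neg Sq)
      also have "\<dots> = - A (U i) (X i) - (blinfun_apply (Bk 1 (U i)) (X i) + blinfun_apply (AB 1 (U i) - AB 1 (K (Z i))) (Z i) + S (\<rho> i))"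
        unfolding Xj A_diff[OF SU(1) j_in_D] by (simp add: blinfun.diff_left blinfun.diff_right AB_apply)
      finally have V: "V i = - A (U i) (X i) - (blinfun_apply (Bk 1 (U i)) (X i) + blinfun_apply (AB 1 (U i) - AB 1 (K (Z i))) (Z i) + S (\<rho> i))" .
      have KR: "norm (K (Z i)) \<le> R" by (rule order_trans[OF K_norm ZR])
      have "norm (blinfun_apply (AB 1 (U i) - AB 1 (K (Z i))) (Z i)) \<le> (L * norm (X i)) * R"
      proof (rule order_trans[OF norm_blinfun mult_mono])
        show "norm (AB 1 (U i) - AB 1 (K (Z i))) \<le> L * norm (X i)"
          using L(2)[OF UR[of i] KR] by (simp add: X_def S_norm)
      qed (use ZR L(1) in auto)
      moreover have "norm (blinfun_apply (Bk 1 (U i)) (X i)) \<le> M * norm (X i)"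
        by (rule order_trans[OF norm_blinfun mult_right_mono[OF M(2)[OF UR]]]) simp
      moreover have "norm (S (\<rho> i)) \<le> \<epsilon>" using \<rho> by (simp add: S_norm)
      ultimately have n: "norm (blinfun_apply (Bk 1 (U i)) (X i) + blinfun_apply (AB 1 (U i) - AB 1 (K (Z i))) (Z i) + S (\<rho> i))
          \<le> M * norm (X i) + (L * norm (X i)) * R + \<epsilon>"
        by (intro norm_triangle_mono)
      have "inner (X i) (V i) = - inner (X i) (A (U i) (X i))
          - inner (X i) (blinfun_apply (Bk 1 (U i)) (X i) + blinfun_apply (AB 1 (U i) - AB 1 (K (Z i))) (Z i) + S (\<rho> i))"
        by (subst V) (simp only: inner_diff_right inner_minus_right)
      also have "\<dots> \<le> 0 + norm (X i) * norm (blinfun_apply (Bk 1 (U i)) (X i) + blinfun_apply (AB 1 (U i) - AB 1 (K (Z i))) (Z i) + S (\<rho> i))"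
        using A_accretive[OF XD] Cauchy_Schwarz_ineq2[of "X i" "blinfun_apply (Bk 1 (U i)) (X i) + blinfun_apply (AB 1 (U i) - AB 1 (K (Z i))) (Z i) + S (\<rho> i)"]
        by linarith
      also have "\<dots> \<le> 0 + norm (X i) * (M * norm (X i) + (L * norm (X i)) * R + \<epsilon>)"
        using n by (intro add_left_mono mult_left_mono) auto
      also have "\<dots> = \<kappa> * (norm (X i))\<^sup>2 + \<epsilon> * norm (X i)"
        by (simp add: \<kappa>_def power2_eq_square algebra_simps)
      finally show ?thesis .
    qed
    have "one_sided_stages a \<tau> \<kappa> \<epsilon> (S (x - y)) X V"
      unfolding one_sided_stages_def using \<tau> \<kappa> \<epsilon> XV one by auto
    moreover have "\<tau> * \<kappa> \<le> \<gamma>" using \<tau>(2) \<kappa> by (simp add: field_simps)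
    ultimately have "norm (S (x - y) + \<tau> *\<^sub>R (\<Sum>i\<in>UNIV. b $ i *\<^sub>R V i)) \<le> (1 + c * \<kappa> * \<tau>) * norm (S (x - y)) + c * (\<tau> * \<epsilon>)"
      by (rule step)
    also have "S (x - y) + \<tau> *\<^sub>R (\<Sum>i\<in>UNIV. b $ i *\<^sub>R V i) = S ((x - y) + \<tau> *\<^sub>R (\<Sum>i\<in>UNIV. b $ i *\<^sub>R (W i - q i)))"
      unfolding V_def by (simp only: S.add S.scale S.sum)
    finally have n: "norm ((x - y) + \<tau> *\<^sub>R (\<Sum>i\<in>UNIV. b $ i *\<^sub>R (W i - q i))) \<le> (1 + c * \<kappa> * \<tau>) * norm (x - y) + c * (\<tau> * \<epsilon>)"
      by (simp only: S_norm)
    have "x1 - y1 = ((x - y) + \<tau> *\<^sub>R (\<Sum>i\<in>UNIV. b $ i *\<^sub>R (W i - q i))) - (y1 - y - \<tau> *\<^sub>R (\<Sum>i\<in>UNIV. b $ i *\<^sub>R q i))"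
      unfolding x1W by (simp add: scaleR_diff_right sum_subtractf)
    also have "norm \<dots> \<le> ((1 + c * \<kappa> * \<tau>) * norm (x - y) + c * (\<tau> * \<epsilon>)) + \<delta>"
      by (rule order_trans[OF norm_triangle_ineq4 add_mono[OF n]]) (use \<delta> in \<open>simp add: q_def\<close>)
    also have "\<dots> \<le> ((1 + c' * \<tau>) * norm (x - y) + c' * (\<tau> * \<epsilon>)) + \<delta>"
      using c' \<tau>(1) \<epsilon> by (intro add_mono mult_right_mono order_refl) auto
    finally show "norm (x1 - y1) \<le> (1 + c' * \<tau>) * norm (x - y) + c' * (\<tau> * \<epsilon>) + \<delta>" .
  qed
qed

text \<open>
  The solution, its images under the powers of \<open>S\<close>, and the evolution equation in terms of \<open>K\<close> and \<open>Q\<close>.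
\<close>

lemma solution_scale:
  assumes T: "0 < T" and sol: "solves_evolution j A T u" and u: "Ck_on (p + 1) {0..T} u"
    and reg: "\<And>k. k \<in> {1..r} \<Longrightarrow> power_regular j S T u k (p + 1 - k)"
  shows "\<exists>v. v 0 = u \<and> (\<forall>k\<le>r. Ck_on (p + 1 - k) {0..T} (v k)) \<and>
    (\<forall>k<r. \<forall>t\<in>{0..T}. K (v (Suc k) t) = v k t) \<and>
    (\<forall>t\<in>{0..T}. (v 0 has_vector_derivative blinfun_apply (Q 1 (v 0 t)) (v 1 t)) (at t within {0..T}))"
proof -
  have "\<forall>k. \<exists>v. k \<le> r \<longrightarrow> (k = 0 \<longrightarrow> v = u) \<and> (\<forall>t\<in>{0..T}. u t = (K ^^ k) (v t)) \<and> Ck_on (p + 1 - k) {0..T} v"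
  proof
    fix k
    show "\<exists>v. k \<le> r \<longrightarrow> (k = 0 \<longrightarrow> v = u) \<and> (\<forall>t\<in>{0..T}. u t = (K ^^ k) (v t)) \<and> Ck_on (p + 1 - k) {0..T} v"
    proof (cases "k \<in> {1..r}")
      case True
      then obtain v where v: "\<forall>t\<in>{0..T}. (j (u t), j (v t)) \<in> graph_in_X j S ^^ k" "Ck_on (p + 1 - k) {0..T} v"
        using reg unfolding power_regular_def by blast
      then show ?thesis using True by (intro exI[of _ v]) (auto simp: graph_power J_power_j j_eq_iff)
    next
      case False
      then have "k = 0" if "k \<le> r" using that by (cases k) auto
      then show ?thesis using u by (intro exI[of _ u]) auto
    qed
  qed
  then obtain v where v0: "v 0 = u" and v: "\<And>k t. k \<le> r \<Longrightarrow> t \<in> {0..T} \<Longrightarrow> u t = (K ^^ k) (v k t)"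
    and Ck: "\<And>k. k \<le> r \<Longrightarrow> Ck_on (p + 1 - k) {0..T} (v k)"
    by (metis le0)
  have compat: "K (v (Suc k) t) = v k t" if "k < r" "t \<in> {0..T}" for k t
  proof -
    have "(K ^^ k) (K (v (Suc k) t)) = (K ^^ k) (v k t)"
      using v[of "Suc k" t] v[of k t] that by (simp add: funpow_swap1)
    then show ?thesis by (simp add: K_power_eq_iff)
  qed
  have ode: "(v 0 has_vector_derivative blinfun_apply (Q 1 (v 0 t)) (v 1 t)) (at t within {0..T})" if t: "t \<in> {0..T}" for t
  proof -
    have "Ck_on (Suc p) {0..T} u" using u by simp
    then obtain u' where u': "\<And>t. t \<in> {0..T} \<Longrightarrow> (u has_vector_derivative u' t) (at t within {0..T})"
      "Ck_on p {0..T} u'"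
      by (rule Ck_on_SucE) blast
    have "((\<lambda>s. j (u s)) has_vector_derivative j (u' t)) (at t within {0..T})"
      by (rule j.has_vector_derivative[OF u'(1)[OF t]])
    moreover have "((\<lambda>s. j (u s)) has_vector_derivative - A (u t) (j (u t))) (at t within {0..T})"
      using sol t by (simp add: solves_evolution_def)
    ultimately have "j (u' t) = - A (u t) (j (u t))"
      using vector_derivative_unique_within_closed_interval[OF T, unfolded cbox_interval, OF t] by blast
    also have "\<dots> = j (blinfun_apply (Q 1 (u t)) (v 1 t))"
      using A_K[of "u t" "v 1 t"] compat[of 0 t] r_pos t by (simp add: v0)
    finally show ?thesis using u'(1)[OF t] by (simp add: v0 j_eq_iff)
  qed
  show ?thesis
    by (intro exI[of _ v] conjI allI impI ballI v0 Ck compat ode)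
qed

end

context kato_operators
begin

text \<open>
  The defects in the equations of the reference stages are turned into perturbations of the slopes by
  the inverse of the coefficient matrix. This divides them by \<open>\<tau>\<close>, but the slopes enter the step with
  the factor \<open>\<tau>\<close> again.
\<close>

lemma one_step_error:
  fixes a :: "real^'m^'m" and b :: "real^'m"
  assumes stable: "algebraically_stable a b" and coer: "coercive a"
    and order: "has_classical_order a b p" and stage: "has_stage_order a q"
    and rpq: "p = q + r" "r \<le> q" and T: "0 < T"
    and sol: "solves_evolution j A T u" and u: "Ck_on (p + 1) {0..T} u"
    and reg: "\<And>k. k \<in> {1..r} \<Longrightarrow> power_regular j S T u k (p + 1 - k)" and R0: "0 < R0"
  shows "\<exists>c1>0. \<exists>c2>0. \<exists>\<tau>1>0. \<forall>\<tau> t x U x1. 0 < \<tau> \<longrightarrow> \<tau> \<le> \<tau>1 \<longrightarrow> 0 \<le> t \<longrightarrow> t + \<tau> \<le> T \<longrightarrow>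
    (\<forall>i. norm (U i) \<le> R0) \<longrightarrow> numerical_step a b \<tau> x U x1 \<longrightarrow>
    norm (x1 - u (t + \<tau>)) \<le> (1 + c1 * \<tau>) * norm (x - u t) + c2 * \<tau> * \<tau> ^ p"
proof -
  have inv: "invertible a" using coer by (simp add: coercive_def)
  obtain v where v0: "v 0 = u"
    and v: "\<And>k. k \<le> r \<Longrightarrow> Ck_on (p + 1 - k) {0..T} (v k)"
      "\<And>k t. k < r \<Longrightarrow> t \<in> {0..T} \<Longrightarrow> K (v (Suc k) t) = v k t"
      "\<And>t. t \<in> {0..T} \<Longrightarrow> (v 0 has_vector_derivative blinfun_apply (Q 1 (v 0 t)) (v 1 t)) (at t within {0..T})"
    using solution_scale[OF T sol u reg] by blast
  obtain C \<tau>1 where C: "C > 0" and \<tau>1: "\<tau>1 > 0" and ref: "\<And>\<tau> t. 0 < \<tau> \<Longrightarrow> \<tau> \<le> \<tau>1 \<Longrightarrow> 0 \<le> t \<Longrightarrow> t + \<tau> \<le> T \<Longrightarrow>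
    (\<exists>Z. (\<forall>i. norm (Z i) \<le> C) \<and>
      (\<forall>i. norm (K (Z i) - v 0 t - \<tau> *\<^sub>R (\<Sum>k\<in>UNIV. a $ i $ k *\<^sub>R blinfun_apply (Q 1 (K (Z k))) (Z k))) \<le> C * \<tau> ^ (p + 1)) \<and>
      norm (v 0 (t + \<tau>) - v 0 t - \<tau> *\<^sub>R (\<Sum>i\<in>UNIV. b $ i *\<^sub>R blinfun_apply (Q 1 (K (Z i))) (Z i))) \<le> C * \<tau> ^ (p + 1))"
    using scale.reference_stages[OF order stage rpq T v] by blast
  have R: "0 < R0 + C" using R0 C by simp
  obtain \<gamma> c where \<gamma>: "\<gamma> > 0" and c: "c > 0" and stab: "\<And>\<tau> x x1 y y1 \<epsilon> \<delta> U Z \<rho>. 0 < \<tau> \<Longrightarrow> \<tau> \<le> \<gamma> \<Longrightarrow> 0 \<le> \<epsilon> \<Longrightarrow>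
    (\<forall>i. norm (U i) \<le> R0 + C \<and> norm (Z i) \<le> R0 + C \<and> norm (\<rho> i) \<le> \<epsilon>) \<Longrightarrow>
    numerical_step a b \<tau> x U x1 \<Longrightarrow> perturbed_stages a \<tau> y Z \<rho> \<Longrightarrow>
    norm (y1 - y - \<tau> *\<^sub>R (\<Sum>i\<in>UNIV. b $ i *\<^sub>R (blinfun_apply (Q 1 (K (Z i))) (Z i) + \<rho> i))) \<le> \<delta> \<Longrightarrow>
    norm (x1 - y1) \<le> (1 + c * \<tau>) * norm (x - y) + c * (\<tau> * \<epsilon>) + \<delta>"
    using step_stability[OF stable coer R] by blast
  define ai where "ai = (\<Sum>i\<in>UNIV. \<Sum>k\<in>UNIV. \<bar>matrix_inv a $ i $ k\<bar>)"
  have ai: "(\<Sum>k\<in>UNIV. \<bar>matrix_inv a $ i $ k\<bar>) \<le> ai" "0 \<le> ai" for i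
    unfolding ai_def by (intro member_le_sum[of i UNIV "\<lambda>i. \<Sum>k\<in>UNIV. \<bar>matrix_inv a $ i $ k\<bar>"] sum_nonneg; simp add: sum_nonneg)+
  define \<beta> where "\<beta> = (\<Sum>i\<in>UNIV. \<bar>b $ i\<bar>)"
  have \<beta>: "0 \<le> \<beta>" by (simp add: \<beta>_def sum_nonneg)
  define c2 where "c2 = c * (ai * C) + C + \<beta> * (ai * C)"
  have c2: "c2 > 0" unfolding c2_def using c C ai \<beta> by (intro add_nonneg_pos add_pos_nonneg) auto
  show ?thesis
  proof (rule exI[of _ c], rule conjI, rule c, rule exI[of _ c2], rule conjI, rule c2,
      rule exI[of _ "min \<gamma> \<tau>1"], rule conjI[rotated], intro allI impI)
    show "0 < min \<gamma> \<tau>1" using \<gamma> \<tau>1 by simp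
    fix \<tau> t x and U :: "'m \<Rightarrow> 'y" and x1
    assume \<tau>: "0 < \<tau>" "\<tau> \<le> min \<gamma> \<tau>1" and t: "0 \<le> t" "t + \<tau> \<le> T" and U: "\<forall>i. norm (U i) \<le> R0"
      and num: "numerical_step a b \<tau> x U x1"
    have "\<tau> \<le> \<tau>1" using \<tau> by simp
    from ref[OF \<tau>(1) this t] obtain Z where Z: "\<And>i. norm (Z i) \<le> C"
      and def1: "\<And>i. norm (K (Z i) - v 0 t - \<tau> *\<^sub>R (\<Sum>k\<in>UNIV. a $ i $ k *\<^sub>R blinfun_apply (Q 1 (K (Z k))) (Z k))) \<le> C * \<tau> ^ (p + 1)"
      and def2: "norm (v 0 (t + \<tau>) - v 0 t - \<tau> *\<^sub>R (\<Sum>i\<in>UNIV. b $ i *\<^sub>R blinfun_apply (Q 1 (K (Z i))) (Z i))) \<le> C * \<tau> ^ (p + 1)"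
      by blast
    define g where "g i = blinfun_apply (Q 1 (K (Z i))) (Z i)" for i
    define d where "d i = K (Z i) - v 0 t - \<tau> *\<^sub>R (\<Sum>k\<in>UNIV. a $ i $ k *\<^sub>R g k)" for i
    define \<rho> where "\<rho> i = (1 / \<tau>) *\<^sub>R (\<Sum>k\<in>UNIV. matrix_inv a $ i $ k *\<^sub>R d k)" for i
    have \<rho>_le: "norm (\<rho> i) \<le> ai * C * \<tau> ^ p" for i
    proof -
      have "norm (\<Sum>k\<in>UNIV. matrix_inv a $ i $ k *\<^sub>R d k) \<le> (\<Sum>k\<in>UNIV. \<bar>matrix_inv a $ i $ k\<bar>) * (C * \<tau> ^ (p + 1))"
        using def1 by (intro norm_weighted_sum_le) (simp add: d_def g_def)
      also have "\<dots> \<le> ai * (C * \<tau> ^ (p + 1))" using ai C \<tau> by (intro mult_right_mono) auto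
      finally show ?thesis using \<tau>(1) by (simp add: \<rho>_def field_simps)
    qed
    have pert: "perturbed_stages a \<tau> (v 0 t) Z \<rho>"
      unfolding perturbed_stages_def
    proof
      fix i
      have "(\<Sum>k\<in>UNIV. a $ i $ k *\<^sub>R \<rho> k) = (1 / \<tau>) *\<^sub>R (\<Sum>k\<in>UNIV. a $ i $ k *\<^sub>R (\<Sum>l\<in>UNIV. matrix_inv a $ k $ l *\<^sub>R d l))"
        unfolding \<rho>_def scaleR_left_commute[of _ "1 / \<tau>"] scaleR_sum_right[of "1 / \<tau>", symmetric] ..
      also have "\<dots> = (1 / \<tau>) *\<^sub>R d i" unfolding solve_matrix_vectors(1)[OF inv] ..
      finally have "\<tau> *\<^sub>R (\<Sum>k\<in>UNIV. a $ i $ k *\<^sub>R \<rho> k) = d i" using \<tau>(1) by simp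
      then show "K (Z i) = v 0 t + \<tau> *\<^sub>R (\<Sum>k\<in>UNIV. a $ i $ k *\<^sub>R (blinfun_apply (Q 1 (K (Z k))) (Z k) + \<rho> k))"
        by (simp add: d_def g_def scaleR_add_right sum.distrib)
    qed
    have "norm ((v 0 (t + \<tau>) - v 0 t - \<tau> *\<^sub>R (\<Sum>i\<in>UNIV. b $ i *\<^sub>R g i)) - \<tau> *\<^sub>R (\<Sum>i\<in>UNIV. b $ i *\<^sub>R \<rho> i))
        \<le> C * \<tau> ^ (p + 1) + \<tau> * (\<beta> * (ai * C * \<tau> ^ p))"
    proof (rule order_trans[OF norm_triangle_ineq4 add_mono])
      show "norm (v 0 (t + \<tau>) - v 0 t - \<tau> *\<^sub>R (\<Sum>i\<in>UNIV. b $ i *\<^sub>R g i)) \<le> C * \<tau> ^ (p + 1)"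
        using def2 by (simp add: g_def)
      have "norm (\<Sum>i\<in>UNIV. b $ i *\<^sub>R \<rho> i) \<le> \<beta> * (ai * C * \<tau> ^ p)"
        unfolding \<beta>_def by (rule norm_weighted_sum_le[OF \<rho>_le])
      then show "norm (\<tau> *\<^sub>R (\<Sum>i\<in>UNIV. b $ i *\<^sub>R \<rho> i)) \<le> \<tau> * (\<beta> * (ai * C * \<tau> ^ p))" using \<tau>(1) by simp
    qed
    then have \<delta>: "norm (v 0 (t + \<tau>) - v 0 t - \<tau> *\<^sub>R (\<Sum>i\<in>UNIV. b $ i *\<^sub>R (blinfun_apply (Q 1 (K (Z i))) (Z i) + \<rho> i)))
        \<le> C * \<tau> ^ (p + 1) + \<tau> * (\<beta> * (ai * C * \<tau> ^ p))"
      by (simp add: g_def scaleR_add_right sum.distrib diff_diff_eq add.assoc)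
    have "\<tau> \<le> \<gamma>" "0 \<le> ai * C * \<tau> ^ p" using \<tau> ai C by auto
    moreover have "\<forall>i. norm (U i) \<le> R0 + C \<and> norm (Z i) \<le> R0 + C \<and> norm (\<rho> i) \<le> ai * C * \<tau> ^ p"
    proof
      fix i
      show "norm (U i) \<le> R0 + C \<and> norm (Z i) \<le> R0 + C \<and> norm (\<rho> i) \<le> ai * C * \<tau> ^ p"
        using U[rule_format, of i] Z[of i] \<rho>_le[of i] R0 C by linarith
    qed
    ultimately have "norm (x1 - v 0 (t + \<tau>)) \<le> (1 + c * \<tau>) * norm (x - v 0 t) + c * (\<tau> * (ai * C * \<tau> ^ p))
        + (C * \<tau> ^ (p + 1) + \<tau> * (\<beta> * (ai * C * \<tau> ^ p)))"
      by (intro stab[OF \<tau>(1) _ _ _ num pert \<delta>])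
    also have "\<dots> = (1 + c * \<tau>) * norm (x - v 0 t) + c2 * \<tau> * \<tau> ^ p"
      by (simp add: c2_def algebra_simps)
    finally show "norm (x1 - u (t + \<tau>)) \<le> (1 + c * \<tau>) * norm (x - u t) + c2 * \<tau> * \<tau> ^ p"
      by (simp add: v0)
  qed
qed

lemma numerical_step_exists:
  fixes a :: "real^'m^'m" and U :: "'m \<Rightarrow> 'y"
  assumes "invertible a" "0 < \<tau>"
    and U: "\<And>i. j (U i) = j x + \<tau> *\<^sub>R (\<Sum>k\<in>UNIV. a $ i $ k *\<^sub>R (- A (U k) (j (U k))))"
  shows "\<exists>x1. j x1 = j x + \<tau> *\<^sub>R (\<Sum>i\<in>UNIV. b $ i *\<^sub>R (- A (U i) (j (U i))))"
proof -
  obtain W where W: "\<And>i. j (W i) = - A (U i) (j (U i))"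
    using stage_slopes[OF assms] by blast
  have "j (x + \<tau> *\<^sub>R (\<Sum>i\<in>UNIV. b $ i *\<^sub>R W i)) = j x + \<tau> *\<^sub>R (\<Sum>i\<in>UNIV. b $ i *\<^sub>R (- A (U i) (j (U i))))"
    unfolding W[symmetric] by (simp add: j.add j.scaleR j.sum)
  then show ?thesis by blast
qed

end

section \<open>Convergence\<close>

text \<open>
  The error recursion is only available as long as the error stays below a fixed bound, which the
  resulting estimate guarantees.
\<close>

lemma discrete_Gronwall:
  fixes e :: "nat \<Rightarrow> real"
  assumes c: "0 \<le> c1" "0 \<le> c2" and \<tau>: "0 < \<tau>" and h: "0 \<le> h" and e0: "e 0 \<le> 0" and N: "real N * \<tau> \<le> T"
    and B: "c2 * T * exp (c1 * T) * h \<le> B"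
    and step: "\<And>n. n < N \<Longrightarrow> e n \<le> B \<Longrightarrow> e (Suc n) \<le> (1 + c1 * \<tau>) * e n + c2 * \<tau> * h"
    and n: "n \<le> N"
  shows "e n \<le> c2 * T * exp (c1 * T) * h"
proof -
  define g where "g n = c2 * (real n * \<tau>) * (1 + c1 * \<tau>) ^ n * h" for n
  have one: "1 \<le> 1 + c1 * \<tau>" using c \<tau> by simp
  have g_le: "g n \<le> c2 * T * exp (c1 * T) * h" if "n \<le> N" for n
  proof -
    have nT: "real n * \<tau> \<le> T"
    proof -
      have "real n * \<tau> \<le> real N * \<tau>" using that \<tau> by (intro mult_right_mono) auto
      then show ?thesis using N by simp
    qed
    then have T0: "0 \<le> T" using \<tau> by (meson mult_nonneg_nonneg of_nat_0_le_iff less_imp_le order_trans)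
    have "(1 + c1 * \<tau>) ^ n \<le> exp (c1 * \<tau>) ^ n"
      using one by (intro power_mono exp_ge_add_one_self) auto
    also have "\<dots> = exp (c1 * (real n * \<tau>))" by (simp add: exp_of_nat_mult[symmetric] mult_ac)
    also have "\<dots> \<le> exp (c1 * T)" using c(1) nT by (simp add: mult_left_mono)
    finally have "(1 + c1 * \<tau>) ^ n \<le> exp (c1 * T)" .
    then show ?thesis
      unfolding g_def using c \<tau> h nT T0 one by (intro mult_mono mult_right_mono mult_left_mono) auto
  qed
  have "n \<le> N \<Longrightarrow> e n \<le> g n" for n
  proof (induction n)
    case 0
    then show ?case using e0 by (simp add: g_def)
  next
    case (Suc n)
    then have le: "e n \<le> g n" and n: "n < N" by auto
    have "e (Suc n) \<le> (1 + c1 * \<tau>) * e n + c2 * \<tau> * h"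
      by (rule step[OF n]) (use le g_le[of n] n B in linarith)
    also have "\<dots> \<le> (1 + c1 * \<tau>) * g n + c2 * \<tau> * h * (1 + c1 * \<tau>) ^ Suc n"
    proof (rule add_mono)
      show "(1 + c1 * \<tau>) * e n \<le> (1 + c1 * \<tau>) * g n" using le one by (intro mult_left_mono) auto
      have "c2 * \<tau> * h * 1 \<le> c2 * \<tau> * h * (1 + c1 * \<tau>) ^ Suc n"
        using c \<tau> h one_le_power[OF one, of "Suc n"] by (intro mult_left_mono) auto
      then show "c2 * \<tau> * h \<le> c2 * \<tau> * h * (1 + c1 * \<tau>) ^ Suc n" by simp
    qed
    also have "\<dots> = g (Suc n)" by (simp add: g_def algebra_simps)
    finally show ?case .
  qed
  then show ?thesis using g_le[OF n] n by fastforce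
qed

theorem theorem4p2:
  fixes j :: "'y::{real_inner, complete_space} \<Rightarrow> 'x::{real_inner, complete_space}"
    and D :: "'y \<Rightarrow> 'x set" and A :: "'y \<Rightarrow> 'x \<Rightarrow> 'x"
    and S :: "'y \<Rightarrow> 'x"
    and B :: "'y \<Rightarrow> 'x \<Rightarrow>\<^sub>L 'x" and Bk :: "nat \<Rightarrow> 'y \<Rightarrow> 'x \<Rightarrow>\<^sub>L 'x"
    and a :: "real^'m^'m" and b :: "real^'m" and p q :: nat
    and Cs T :: real and u :: "real \<Rightarrow> 'y"
  assumes "dense_embedding j"
    and "\<And>y. closed_linear_operator (D y) (A y)"
    and "cond_K1 j D A"
    and "cond_K2 j D A S B"
    and "cond_K3 j A B"
    and "algebraically_stable a b"
    and "coercive a"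
    and "has_stage_order a q"
    and "has_quadrature_order a b (q + 1)"
    and "has_classical_order a b p"
    and "q < p" and "p \<le> 2 * q"
    and "cond_A1 j D A S Bk (p - q)"
    and "cond_A2 j A Bk (p - q)"
    and "stage_constant j A a Cs"
    and "T > 0"
    and "solves_evolution j A T u"
    and "Ck_on (p + 1) {0..T} u"
    and "\<And>k. k \<in> {1..p - q} \<Longrightarrow> power_regular j S T u k (p + 1 - k)"
  shows "\<exists>\<tau>bar>0. \<exists>C. \<forall>\<tau>. 0 < \<tau> \<longrightarrow> \<tau> \<le> \<tau>bar \<longrightarrow>
    (\<exists>un. rk_solution j A a b Cs T \<tau> (u 0) un) \<and>
    (\<forall>un. rk_solution j A a b Cs T \<tau> (u 0) un \<longrightarrow>
       (\<forall>n. real n * \<tau> \<le> T \<longrightarrow> norm (un n - u (real n * \<tau>)) \<le> C * \<tau> ^ p))"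
proof -
  have S: "linear S" "norm (S y) = norm y" for y
    using assms(4) unfolding cond_K2_def by blast+
  interpret kato_operators j D A S Bk "p - q"
    by (rule kato_operators.intro[OF assms(1-3) S assms(13,14)]) (use assms(11) in simp)
  have inv: "invertible a" using assms(7) by (simp add: coercive_def)
  have "bounded (u ` {0..T})"
    by (intro compact_imp_bounded compact_continuous_image Ck_on_imp_continuous_on[OF assms(18)]) simp
  then obtain Bu where Bu: "Bu > 0" "\<And>t. t \<in> {0..T} \<Longrightarrow> norm (u t) \<le> Bu"
    unfolding bounded_pos by blast
  define R where "R = Bu + 1"
  have R: "R > 0" using Bu by (simp add: R_def)
  have "\<exists>\<tau>0>0. \<forall>\<tau> x. 0 < \<tau> \<longrightarrow> \<tau> \<le> \<tau>0 \<longrightarrow> norm x \<le> R \<longrightarrow> (\<exists>!U. rk_stages j A a Cs \<tau> x U)"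
    by (rule assms(15)[unfolded stage_constant_def, THEN spec, THEN mp, OF R])
  then obtain \<tau>0 where \<tau>0: "\<tau>0 > 0" and unique: "\<forall>\<tau> x. 0 < \<tau> \<longrightarrow> \<tau> \<le> \<tau>0 \<longrightarrow> norm x \<le> R \<longrightarrow> (\<exists>!U. rk_stages j A a Cs \<tau> x U)"
    by (elim exE conjE) (rule that)
  have stages: "\<exists>U. rk_stages j A a Cs \<tau> x U" if "0 < \<tau>" "\<tau> \<le> \<tau>0" "norm x \<le> R" for \<tau> x
    by (rule ex1_implies_ex[OF unique[rule_format, OF that]])
  have "0 < \<bar>Cs\<bar> * R + 1" using R by (intro add_nonneg_pos) auto
  moreover have "p = q + (p - q)" "p - q \<le> q" using assms(11,12) by auto
  ultimately
  obtain c1 c2 \<tau>1 where c: "c1 > 0" "c2 > 0" and \<tau>1: "\<tau>1 > 0"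
    and one_step: "\<And>\<tau> t x U x1. 0 < \<tau> \<Longrightarrow> \<tau> \<le> \<tau>1 \<Longrightarrow> 0 \<le> t \<Longrightarrow> t + \<tau> \<le> T \<Longrightarrow>
      \<forall>i. norm (U i) \<le> \<bar>Cs\<bar> * R + 1 \<Longrightarrow> numerical_step a b \<tau> x U x1 \<Longrightarrow>
      norm (x1 - u (t + \<tau>)) \<le> (1 + c1 * \<tau>) * norm (x - u t) + c2 * \<tau> * \<tau> ^ p"
    using one_step_error[OF assms(6,7,10,8) _ _ assms(16,17,18,19), of "\<bar>Cs\<bar> * R + 1"] by blast
  define C where "C = c2 * T * exp (c1 * T)"
  have C: "C > 0" using c assms(16) by (simp add: C_def)
  define \<tau>bar where "\<tau>bar = Min {\<tau>0, \<tau>1, 1, 1 / C}"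
  have \<tau>bar: "0 < \<tau>bar" "\<tau>bar \<le> \<tau>0" "\<tau>bar \<le> \<tau>1" "\<tau>bar \<le> 1" "\<tau>bar \<le> 1 / C"
    using \<tau>0 \<tau>1 C by (auto simp: \<tau>bar_def)
  define next_value where "next_value \<tau> x x1 \<longleftrightarrow> (\<exists>U. rk_stages j A a Cs \<tau> x U \<and>
    j x1 = j x + \<tau> *\<^sub>R (\<Sum>i\<in>UNIV. b $ i *\<^sub>R (- A (U i) (j (U i)))))" for \<tau> x x1
  have small: "C * \<tau> ^ p \<le> 1" if "0 < \<tau>" "\<tau> \<le> \<tau>bar" for \<tau>
  proof -
    have "\<tau> ^ p \<le> \<tau> ^ 1" using that \<tau>bar(4) assms(11) by (intro power_decreasing) auto
    then have "C * \<tau> ^ p \<le> C * \<tau>" using C by (intro mult_left_mono) auto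
    also have "\<dots> \<le> C * (1 / C)" using that \<tau>bar(5) C by (intro mult_left_mono) auto
    finally show ?thesis using C by simp
  qed
  have in_ball: "norm x \<le> R" if "norm (x - u t) \<le> 1" "t \<in> {0..T}" for x t
    using norm_triangle_sub[of x "u t"] Bu(2)[OF that(2)] that(1) by (simp add: R_def)
  have error: "norm (un n - u (real n * \<tau>)) \<le> C * \<tau> ^ p"
    if \<tau>: "0 < \<tau>" "\<tau> \<le> \<tau>bar" and un0: "un 0 = u 0" and steps: "\<And>m. m < N \<Longrightarrow> next_value \<tau> (un m) (un (Suc m))"
      and N: "real N * \<tau> \<le> T" and n: "n \<le> N" for \<tau> un N n
    unfolding C_def
  proof (rule discrete_Gronwall[where e = "\<lambda>n. norm (un n - u (real n * \<tau>))" and B = 1 and N = N])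
    fix m assume m: "m < N" and em: "norm (un m - u (real m * \<tau>)) \<le> 1"
    have "real (Suc m) * \<tau> \<le> real N * \<tau>" using m \<tau>(1) by (intro mult_right_mono) auto
    then have t: "0 \<le> real m * \<tau>" "real m * \<tau> + \<tau> \<le> T" using N \<tau>(1) by (auto simp: algebra_simps)
    obtain U where U: "rk_stages j A a Cs \<tau> (un m) U"
      and u1: "j (un (Suc m)) = j (un m) + \<tau> *\<^sub>R (\<Sum>i\<in>UNIV. b $ i *\<^sub>R (- A (U i) (j (U i))))"
      using steps[OF m] unfolding next_value_def by blast
    have "norm (un m) \<le> R" by (rule in_ball[OF em]) (use t \<tau>(1) in auto)
    then have "\<bar>Cs\<bar> * norm (un m) \<le> \<bar>Cs\<bar> * R" by (intro mult_left_mono) auto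
    moreover have "norm (U i) \<le> Cs * norm (un m)" for i using U unfolding rk_stages_def by blast
    moreover have "Cs * norm (un m) \<le> \<bar>Cs\<bar> * norm (un m)" by (intro mult_right_mono) auto
    ultimately have "norm (U i) \<le> \<bar>Cs\<bar> * R + 1" for i by (smt (verit))
    moreover have "numerical_step a b \<tau> (un m) U (un (Suc m))"
      using U u1 unfolding numerical_step_def rk_stages_def by blast
    ultimately have "norm (un (Suc m) - u (real m * \<tau> + \<tau>)) \<le> (1 + c1 * \<tau>) * norm (un m - u (real m * \<tau>)) + c2 * \<tau> * \<tau> ^ p"
      using \<tau> \<tau>bar(3) t by (intro one_step) auto
    then show "norm (un (Suc m) - u (real (Suc m) * \<tau>)) \<le> (1 + c1 * \<tau>) * norm (un m - u (real m * \<tau>)) + c2 * \<tau> * \<tau> ^ p"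
      by (simp add: algebra_simps)
  qed (use c \<tau> un0 N n small[OF \<tau>] in \<open>auto simp: C_def\<close>)
  have exists_next: "\<exists>x1. next_value \<tau> x x1" if \<tau>: "0 < \<tau>" "\<tau> \<le> \<tau>bar" and x: "norm x \<le> R" for \<tau> x
  proof -
    obtain U where U: "rk_stages j A a Cs \<tau> x U"
      using stages[OF \<tau>(1) order_trans[OF \<tau>(2) \<tau>bar(2)] x] by blast
    then obtain x1 where "j x1 = j x + \<tau> *\<^sub>R (\<Sum>i\<in>UNIV. b $ i *\<^sub>R (- A (U i) (j (U i))))"
      using numerical_step_exists[OF inv \<tau>(1), of U x b] unfolding rk_stages_def by blast
    then show ?thesis using U unfolding next_value_def by blast
  qed
  have solution_iff: "rk_solution j A a b Cs T \<tau> (u 0) un \<longleftrightarrow>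
      un 0 = u 0 \<and> (\<forall>n. real (Suc n) * \<tau> \<le> T \<longrightarrow> next_value \<tau> (un n) (un (Suc n)))" for \<tau> un
    unfolding rk_solution_def next_value_def ..
  show ?thesis
  proof (rule exI[of _ \<tau>bar], rule conjI[OF \<tau>bar(1)], rule exI[of _ C], intro allI impI conjI)
    fix \<tau> :: real assume \<tau>: "0 < \<tau>" "\<tau> \<le> \<tau>bar"
    have mono: "real (Suc m) * \<tau> \<le> T" if "m < n" "real n * \<tau> \<le> T" for m n
    proof -
      have "real (Suc m) * \<tau> \<le> real n * \<tau>" using that \<tau>(1) by (intro mult_right_mono) auto
      then show ?thesis using that by simp
    qed
    show "norm (un n - u (real n * \<tau>)) \<le> C * \<tau> ^ p"
      if "rk_solution j A a b Cs T \<tau> (u 0) un" "real n * \<tau> \<le> T" for un n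
    proof (rule error[OF \<tau> _ _ that(2) order_refl])
      show "un 0 = u 0" using that(1) unfolding solution_iff by blast
      show "next_value \<tau> (un m) (un (Suc m))" if "m < n" for m
        using mono[OF that] \<open>rk_solution j A a b Cs T \<tau> (u 0) un\<close> \<open>real n * \<tau> \<le> T\<close> unfolding solution_iff by blast
    qed
    define un where "un = rec_nat (u 0) (\<lambda>_ x. SOME x1. next_value \<tau> x x1)"
    have un: "un 0 = u 0" "un (Suc n) = (SOME x1. next_value \<tau> (un n) x1)" for n
      by (simp_all add: un_def)
    have "real (Suc n) * \<tau> \<le> T \<longrightarrow> next_value \<tau> (un n) (un (Suc n))" for n
    proof (induction n rule: less_induct)
      case (less n)
      show ?case
      proof
        assume le: "real (Suc n) * \<tau> \<le> T"
        then have nT: "real n * \<tau> \<le> T" using \<tau>(1) by (simp add: algebra_simps)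
        have "norm (un n - u (real n * \<tau>)) \<le> C * \<tau> ^ p"
          by (rule error[of \<tau> un n n, OF \<tau> un(1) _ nT order_refl]) (use less mono nT in blast)
        then have "norm (un n - u (real n * \<tau>)) \<le> 1" using small[OF \<tau>] by simp
        then have "norm (un n) \<le> R" by (rule in_ball) (use nT \<tau>(1) in auto)
        from someI_ex[OF exists_next[OF \<tau> this]]
        show "next_value \<tau> (un n) (un (Suc n))" by (simp add: un(2))
      qed
    qed
    then show "\<exists>un. rk_solution j A a b Cs T \<tau> (u 0) un"
      unfolding solution_iff using un(1) by blast
  qed
qed

end
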